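(* Let $\varphi(z)=\tfrac12z^2+\tfrac12$. Then for every $\psi\in H^\infty$ continuous at $1$, $$\sigma(W_{\psi,\varphi})=\{\psi(1)e^{-t/2}: t\ge0\}\cup\{0\},$$ with $W_{\psi,\varphi}$ acting on $H^2$.
   Context: $H^2$ is the Hardy space of analytic $f(z)=\sum a_nz^n$ on the open unit disk $\mathbb{D}$ with $\sum|a_n|^2<\infty$; $H^\infty$ is the space of bounded analytic functions on $\mathbb{D}$. $W_{\psi,\varphi}f=\psi\cdot(f\circ\varphi)$ is the weighted composition operator. "$\psi$ continuous at $1$" means $\psi$ extends continuously to $\mathbb{D}\cup\{1\}$. $\sigma(T)$ denotes the spectrum of the operator $T$. *)

theory Defs
  imports "HOL-Complex_Analysis.Complex_Analysis"
begin

definition taylor_coeff :: "(complex \<Rightarrow> complex) \<Rightarrow> nat \<Rightarrow> complex" where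
  "taylor_coeff f n = (deriv ^^ n) f 0 / of_nat (fact n)"

text \<open>The Hardy space H^2 (functions are only relevant on the open unit disk).\<close>
definition H2 :: "(complex \<Rightarrow> complex) set" where
  "H2 = {f. f holomorphic_on ball 0 1 \<and> summable (\<lambda>n. (cmod (taylor_coeff f n))\<^sup>2)}"

definition H2_norm :: "(complex \<Rightarrow> complex) \<Rightarrow> real" where
  "H2_norm f = sqrt (\<Sum>n. (cmod (taylor_coeff f n))\<^sup>2)"

definition Hinf :: "(complex \<Rightarrow> complex) set" where
  "Hinf = {f. f holomorphic_on ball 0 1 \<and> bounded (f ` ball 0 1)}"

definition wcomp :: "(complex \<Rightarrow> complex) \<Rightarrow> (complex \<Rightarrow> complex) \<Rightarrow> (complex \<Rightarrow> complex) \<Rightarrow> (complex \<Rightarrow> complex)" where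
  "wcomp \<psi> \<phi> f = (\<lambda>z. \<psi> z * f (\<phi> z))"

text \<open>An operator T on H^2 (assumed to map H^2 into H^2) is invertible if it has a
  bounded linear two-sided inverse on H^2; elements of H^2 are identified when they agree
  on the open unit disk.\<close>
definition H2_invertible :: "((complex \<Rightarrow> complex) \<Rightarrow> (complex \<Rightarrow> complex)) \<Rightarrow> bool" where
  "H2_invertible T \<longleftrightarrow> (\<exists>S C. (\<forall>f\<in>H2. S f \<in> H2 \<and> H2_norm (S f) \<le> C * H2_norm f)
      \<and> (\<forall>f\<in>H2. \<forall>g\<in>H2. \<forall>a b. (\<forall>z\<in>ball 0 1. S (\<lambda>w. a * f w + b * g w) z = a * S f z + b * S g z))
      \<and> (\<forall>f\<in>H2. \<forall>z\<in>ball 0 1. T (S f) z = f z)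
      \<and> (\<forall>f\<in>H2. \<forall>z\<in>ball 0 1. S (T f) z = f z))"

definition H2_spectrum :: "((complex \<Rightarrow> complex) \<Rightarrow> (complex \<Rightarrow> complex)) \<Rightarrow> complex set" where
  "H2_spectrum T = {c. \<not> H2_invertible (\<lambda>f z. T f z - c * f z)}"

end

theory Submission
  imports Defs
begin

text \<open>
  In the coordinate \<open>v = 1 / (1 - z)\<close> the disc is the half-plane \<open>Re v > 1/2\<close>, and \<open>\<phi>\<close> becomes
  \<open>v + 1/2 + O(1/v)\<close>, with \<open>Re v\<close> growing by more than \<open>1/2\<close>. Hence the iterates of \<open>\<phi>\<close> map the disc
  into the horodisc \<open>Re v > 1/(4s)\<close> for every \<open>s > 0\<close>, and \<open>W - \<lambda>\<close> (\<open>\<lambda> \<noteq> 0\<close>) is invertible on the disc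
  as soon as it is invertible on such a horodisc. Rescaled to the unit disc, the operator on the horodisc is
  close to \<open>\<psi>(1)\<close> times the translation \<open>v \<mapsto> v + s\<close>, weighted so as to be symmetric. That translation
  is the square of a symmetric operator and almost a contraction, so for small \<open>s\<close> the numerical range is
  close to the segment from \<open>0\<close> to \<open>\<psi>(1)\<close>. Off the segment, \<open>W - \<lambda>\<close> is therefore coercive after
  multiplication by a constant, and Lax-Milgram applies.

  Conversely, \<open>f = exp(-t v)\<close> times the reproducing kernel at a point \<open>r\<close> near \<open>1\<close> almost satisfies
  \<open>W f = \<lambda> f\<close>, \<open>\<lambda> = \<psi>(1) exp(-t/2)\<close>, near \<open>1\<close>, but not near \<open>-1\<close>, which \<open>\<phi>\<close> also maps to \<open>1\<close>.
  Since \<open>\<phi>\<close> stays away from \<open>-1\<close>, the function \<open>W f\<close> is an approximate eigenvector on the whole disc.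
\<close>

section \<open>Circle means and the Hardy space\<close>

text \<open>The hypothesis on \<open>\<psi>\<close> controls it only near 1, whereas
  \<open>phi\<close> is even and sends -1 to 1 as well. A small horodisc at 1 stays away from -1,
  and on it \<open>\<psi>\<close> is uniformly close to \<open>\<psi> 1\<close>. The dilation of v
  by 2 s carries the horodisc to the disc and \<open>phi\<close> to a translation by s plus an error
  of order s^2 that depends on the point. Translations are not norm-continuous as s tends to 0, so
  it is not evident that such an error is harmless. It is harmless because translations by complex
  parameters with nonnegative real part are bounded too: a Cauchy estimate over a parameter disc of
  radius s/2 costs a factor 1/s and leaves an operator error of order s. The limiting numerical
  range is a segment, hence convex, so every other point is separated from it by a line; the normal
  of that line is the multiplier that makes the operator coercive. The point 0 is treated apart, by
  the evenness of \<open>phi\<close>.\<close>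

lemma norm_circlepath_0 [simp]: "cmod (circlepath 0 r t) = \<bar>r\<bar>"
  by (simp add: circlepath norm_mult)

lemma continuous_on_circlepath [continuous_intros]:
  assumes "continuous_on S g"
  shows "continuous_on S (\<lambda>x. circlepath 0 r (g x))"
  unfolding circlepath using assms by (intro continuous_intros)

lemma continuous_on_comp_circlepath:
  assumes "f holomorphic_on ball 0 1" "0 \<le> r" "r < 1"
  shows "continuous_on S (\<lambda>t. f (circlepath 0 r t))"
  by (rule continuous_on_compose2[OF holomorphic_on_imp_continuous_on[OF assms(1)]])
     (use assms in \<open>auto intro!: continuous_intros\<close>)

text \<open>With the circle parametrised over [0, 1], the differential of \<zeta> is 2 pi i \<zeta>
  dt. Cauchy's formula thus becomes a mean with weight \<zeta> / (\<zeta> - w), free of the factor 2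
  pi i.\<close>

lemma Cauchy_circle_mean:
  assumes "continuous_on (cball 0 r) F" "F holomorphic_on ball 0 r" "cmod w < r"
  shows "((\<lambda>t. F (circlepath 0 r t) * (circlepath 0 r t / (circlepath 0 r t - w)))
            has_integral F w) {0..1}"
proof -
  have "((\<lambda>u. F u / (u - w)) has_contour_integral (2 * of_real pi * \<i> * F w)) (circlepath 0 r)"
    by (rule Cauchy_integral_circlepath) (use assms in auto)
  then have "((\<lambda>t. F (circlepath 0 r t) / (circlepath 0 r t - w) *
          (2 * pi * \<i> * r * exp (2 * of_real pi * \<i> * t))) has_integral (2 * of_real pi * \<i> * F w)) {0..1}"
    unfolding has_contour_integral_def
    by (rule has_integral_eq[rotated]) (simp add: vector_derivative_circlepath01)
  then have "((\<lambda>t. (1 / (2 * of_real pi * \<i>)) * (F (circlepath 0 r t) / (circlepath 0 r t - w) *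
          (2 * pi * \<i> * r * exp (2 * of_real pi * \<i> * t)))) has_integral
             (1 / (2 * of_real pi * \<i>)) * (2 * of_real pi * \<i> * F w)) {0..1}"
    by (rule has_integral_mult_right)
  then show ?thesis
    by (simp add: circlepath field_simps)
qed

lemma circle_mean_value:
  assumes "F holomorphic_on cball 0 r" "0 \<le> r"
  shows "((\<lambda>t. F (circlepath 0 r t)) has_integral F 0) {0..1}"
proof (cases "r = 0")
  case True
  then show ?thesis
    using has_integral_const_real[of "F 0" 0 1] by (simp add: circlepath)
next
  case False
  have "F holomorphic_on ball 0 r" using assms(1) by (rule holomorphic_on_subset) auto
  then have "((\<lambda>t. F (circlepath 0 r t) * (circlepath 0 r t / (circlepath 0 r t - 0)))
            has_integral F 0) {0..1}"
    using assms False by (intro Cauchy_circle_mean holomorphic_on_imp_continuous_on) auto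
  moreover have "circlepath 0 r t \<noteq> 0" for t using False by (simp add: circlepath)
  ultimately show ?thesis by simp
qed

definition circle_mean :: "(complex \<Rightarrow> complex) \<Rightarrow> real \<Rightarrow> real" where
  "circle_mean f r = integral {0..1} (\<lambda>t. (cmod (f (circlepath 0 r t)))\<^sup>2)"

lemma circle_mean_integrable:
  assumes "f holomorphic_on ball 0 1" "0 \<le> r" "r < 1"
  shows "(\<lambda>t. (cmod (f (circlepath 0 r t)))\<^sup>2) integrable_on {0..1}"
  by (intro integrable_continuous_real continuous_intros continuous_on_comp_circlepath assms)

lemma circle_mean_has_integral:
  assumes "f holomorphic_on ball 0 1" "0 \<le> r" "r < 1"
  shows "((\<lambda>t. (cmod (f (circlepath 0 r t)))\<^sup>2) has_integral circle_mean f r) {0..1}"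
  unfolding circle_mean_def using circle_mean_integrable[OF assms] by blast

lemma circle_mean_poly:
  fixes a :: "nat \<Rightarrow> complex"
  assumes "0 \<le> r" "r < 1"
  shows "circle_mean (\<lambda>z. \<Sum>n<N. a n * z ^ n) r = (\<Sum>n<N. (cmod (a n))\<^sup>2 * r ^ (2 * n))"
proof (induction N)
  case 0
  then show ?case by (simp add: circle_mean_def)
next
  case (Suc N)
  let ?s = "\<lambda>z. \<Sum>n<N. a n * z ^ n" and ?c = "circlepath 0 r"
  \<comment> \<open>On the circle cnj z * z = r^2, so the cross term between the partial sum and the
    new top term agrees there with this polynomial. All its exponents N - n are positive, hence its
    mean \<open>p 0\<close> vanishes, which is the orthogonality behind Parseval.\<close>
  define p where "p z = (\<Sum>n<N. cnj (a n) * a N * of_real (r ^ (2 * n)) * z ^ (N - n))" for z :: complex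
  have hs: "?s holomorphic_on ball 0 1" and hp: "p holomorphic_on cball 0 r"
    unfolding p_def by (auto intro!: holomorphic_intros)
  have p0: "p 0 = 0" by (auto simp: p_def intro!: sum.neutral)
  have cross: "cnj (?s z) * (a N * z ^ N) = p z" if "z = ?c t" for z t
  proof -
    have "cnj z * z = of_real ((cmod z)\<^sup>2)"
      by (simp only: complex_norm_square mult.commute)
    then have zz: "cnj z * z = of_real (r\<^sup>2)"
      using that by (simp only: norm_circlepath_0 power2_abs)
    have "cnj z ^ n * z ^ N = of_real (r ^ (2 * n)) * z ^ (N - n)" if "n < N" for n
    proof -
      have "cnj z ^ n * z ^ N = (cnj z * z) ^ n * z ^ (N - n)"
        using that by (simp add: power_mult_distrib power_add[symmetric] mult.assoc)
      then show ?thesis by (simp add: zz power_mult)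
    qed
    then show ?thesis
      unfolding p_def by (simp add: sum_distrib_right, intro sum.cong) (simp_all add: mult_ac)
  qed
  have pt: "(cmod (\<Sum>n<Suc N. a n * z ^ n))\<^sup>2 = (cmod (?s z))\<^sup>2 + (cmod (a N))\<^sup>2 * r ^ (2*N) + 2 * Re (p z)"
    if "z = ?c t" for z t
  proof -
    have "(cmod (x + y))\<^sup>2 = (cmod x)\<^sup>2 + (cmod y)\<^sup>2 + 2 * Re (cnj x * y)" for x y :: complex
      by (simp only: cmod_power2) (simp add: power2_eq_square algebra_simps)
    note this[of "?s z" "a N * z ^ N", unfolded cross[OF that]]
    moreover have "(cmod (a N * z ^ N))\<^sup>2 = (cmod (a N))\<^sup>2 * r ^ (2*N)"
      using that assms
      by (simp add: norm_mult norm_power power_mult_distrib power_mult[symmetric] mult.commute)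
    ultimately show ?thesis by simp
  qed
  have const: "((\<lambda>t::real. (cmod (a N))\<^sup>2 * r ^ (2*N)) has_integral (cmod (a N))\<^sup>2 * r ^ (2*N)) {0..1}"
    using has_integral_const_real[of "(cmod (a N))\<^sup>2 * r ^ (2*N)" 0 1] by simp
  have "((\<lambda>t. Re (p (?c t))) has_integral 0) {0..1}"
    using has_integral_Re[OF circle_mean_value[OF hp assms(1)]] p0 by simp
  then have "((\<lambda>t. (cmod (?s (?c t)))\<^sup>2 + (cmod (a N))\<^sup>2 * r ^ (2*N) + 2 * Re (p (?c t)))
      has_integral (circle_mean ?s r + (cmod (a N))\<^sup>2 * r ^ (2*N) + 2 * 0)) {0..1}"
    by (intro has_integral_add[OF has_integral_add[OF circle_mean_has_integral[OF hs assms] const]]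
          has_integral_mult_right)
  then have "((\<lambda>t. (cmod (\<Sum>n<Suc N. a n * ?c t ^ n))\<^sup>2)
      has_integral (circle_mean ?s r + (cmod (a N))\<^sup>2 * r ^ (2*N))) {0..1}"
    by (subst pt[OF refl]) simp
  then show ?case
    unfolding circle_mean_def[of "\<lambda>z. \<Sum>n<Suc N. a n * z ^ n"]
    using Suc by (simp add: integral_unique)
qed

lemma taylor_sums:
  assumes "f holomorphic_on ball 0 1" "z \<in> ball 0 1"
  shows "(\<lambda>n. taylor_coeff f n * z ^ n) sums f z"
  using holomorphic_power_series[OF assms] by (simp add: taylor_coeff_def)

lemma circle_mean_sums:
  assumes f: "f holomorphic_on ball 0 1" and r: "0 \<le> r" "r < 1"
  shows "(\<lambda>n. (cmod (taylor_coeff f n))\<^sup>2 * r ^ (2 * n)) sums circle_mean f r"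
proof -
  let ?s = "\<lambda>N z. \<Sum>n<N. taylor_coeff f n * z ^ n"
  have "uniform_limit (cball 0 r) ?s (\<lambda>z. \<Sum>n. taylor_coeff f n * z ^ n) sequentially"
  proof (rule powser_uniform_limit[where \<xi> = 0, simplified])
    have "ereal r < 1" using r by simp
    also have "1 \<le> conv_radius (taylor_coeff f)"
    proof (rule conv_radius_geI_ex')
      fix q :: real assume "0 < q" "ereal q < 1"
      then show "summable (\<lambda>n. taylor_coeff f n * of_real q ^ n)"
        by (intro sums_summable[OF taylor_sums[OF f]]) auto
    qed
    finally show "ereal r < conv_radius (taylor_coeff f)" .
  qed
  then have "uniform_limit (cball 0 r) ?s f sequentially"
    by (rule uniform_limit_cong'[THEN iffD1, rotated -1])
       (use r in \<open>auto intro!: sums_unique[symmetric] taylor_sums[OF f]\<close>)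
  then have u: "uniform_limit {0..1} (\<lambda>N t. ?s N (circlepath 0 r t)) (\<lambda>t. f (circlepath 0 r t)) sequentially"
    by (rule uniform_limit_compose') (use r in auto)
  have bf: "bounded ((\<lambda>t. f (circlepath 0 r t)) ` {0..1})"
    by (intro compact_imp_bounded compact_continuous_image continuous_on_comp_circlepath f r) auto
  have un: "uniform_limit {0..1} (\<lambda>N t. cmod (?s N (circlepath 0 r t)))
     (\<lambda>t. cmod (f (circlepath 0 r t))) sequentially"
    using uniform_limit_norm[OF u] by simp
  have "uniform_limit {0..1} (\<lambda>N t. cmod (?s N (circlepath 0 r t)) * cmod (?s N (circlepath 0 r t)))
     (\<lambda>t. cmod (f (circlepath 0 r t)) * cmod (f (circlepath 0 r t))) sequentially"
    by (rule uniform_lim_mult[OF un un]) (use bf in \<open>auto simp: bounded_iff\<close>)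
  then have "uniform_limit {0..1} (\<lambda>N t. (cmod (?s N (circlepath 0 r t)))\<^sup>2)
     (\<lambda>t. (cmod (f (circlepath 0 r t)))\<^sup>2) sequentially"
    by (simp only: power2_eq_square)
  then obtain I J where I: "\<And>N. ((\<lambda>t. (cmod (?s N (circlepath 0 r t)))\<^sup>2) has_integral I N) {0..1}"
      and J: "((\<lambda>t. (cmod (f (circlepath 0 r t)))\<^sup>2) has_integral J) {0..1}" and IJ: "I \<longlonglongrightarrow> J"
    by (rule uniform_limit_integral) (auto intro!: continuous_intros)
  have "I = (\<lambda>N. \<Sum>n<N. (cmod (taylor_coeff f n))\<^sup>2 * r ^ (2 * n))"
    using integral_unique[OF I] circle_mean_poly[OF r, of "taylor_coeff f"]
    unfolding circle_mean_def by (intro ext) simp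
  moreover have "J = circle_mean f r"
    using J unfolding circle_mean_def by (simp add: integral_unique)
  ultimately show ?thesis using IJ by (simp add: sums_def)
qed

lemma H2_holomorphic: "f \<in> H2 \<Longrightarrow> f holomorphic_on ball 0 1"
  and H2_summable: "f \<in> H2 \<Longrightarrow> summable (\<lambda>n. (cmod (taylor_coeff f n))\<^sup>2)"
  by (auto simp: H2_def)

lemma H2_norm_nonneg: "f \<in> H2 \<Longrightarrow> 0 \<le> H2_norm f"
  by (simp add: H2_norm_def suminf_nonneg H2_summable)

lemma H2_norm_square: "f \<in> H2 \<Longrightarrow> (H2_norm f)\<^sup>2 = (\<Sum>n. (cmod (taylor_coeff f n))\<^sup>2)"
  by (simp add: H2_norm_def suminf_nonneg H2_summable)

lemma circle_mean_le_H2_norm: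
  assumes "f \<in> H2" "0 \<le> r" "r < 1"
  shows "circle_mean f r \<le> (H2_norm f)\<^sup>2"
proof -
  have s: "(\<lambda>n. (cmod (taylor_coeff f n))\<^sup>2 * r ^ (2 * n)) sums circle_mean f r"
    using assms by (intro circle_mean_sums H2_holomorphic)
  have "circle_mean f r \<le> (\<Sum>n. (cmod (taylor_coeff f n))\<^sup>2)"
    unfolding sums_unique[OF s]
    using assms sums_summable[OF s]
    by (intro suminf_le H2_summable) (auto intro!: mult_left_le power_le_one)
  then show ?thesis using assms by (simp add: H2_norm_square)
qed

text \<open>Parseval bounds each partial sum by a circle mean, and r can tend to 1 in a finite sum.
  Membership in \<open>H2\<close> and norm bounds can therefore be obtained by integrating pointwise
  inequalities over circles.\<close>

lemma H2_I_circle_mean: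
  assumes f: "f holomorphic_on ball 0 1" and M: "0 \<le> M"
    and le: "\<And>r. 0 < r \<Longrightarrow> r < 1 \<Longrightarrow> circle_mean f r \<le> M\<^sup>2"
  shows "f \<in> H2" "H2_norm f \<le> M"
proof -
  let ?a = "\<lambda>n. (cmod (taylor_coeff f n))\<^sup>2"
  have part: "(\<Sum>n<N. ?a n) \<le> M\<^sup>2" for N
  proof (rule tendsto_upperbound)
    show "((\<lambda>r. \<Sum>n<N. ?a n * r ^ (2 * n)) \<longlongrightarrow> (\<Sum>n<N. ?a n)) (at_left 1)"
      by (auto intro!: tendsto_eq_intros)
    have "eventually (\<lambda>r. r \<in> {0<..<1}) (at_left (1::real))"
      by (rule eventually_at_left_real) simp
    then show "\<forall>\<^sub>F r in at_left 1. (\<Sum>n<N. ?a n * r ^ (2 * n)) \<le> M\<^sup>2"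
    proof eventually_elim
      case (elim r)
      have s: "(\<lambda>n. ?a n * r ^ (2 * n)) sums circle_mean f r"
        using elim f by (intro circle_mean_sums) auto
      have "(\<Sum>n<N. ?a n * r ^ (2 * n)) \<le> circle_mean f r"
        unfolding sums_unique[OF s] using elim
        by (intro sum_le_suminf sums_summable[OF s]) auto
      then show ?case using le[of r] elim by auto
    qed
  qed simp
  have sm: "summable ?a"
    by (rule summableI_nonneg_bounded[of _ "M\<^sup>2"]) (use part in auto)
  then show H: "f \<in> H2" using f by (simp add: H2_def)
  have "(\<Sum>n. ?a n) \<le> M\<^sup>2" by (rule suminf_le_const[OF sm part])
  then show "H2_norm f \<le> M" unfolding H2_norm_def by (rule real_le_lsqrt[OF M])
qed

section \<open>Littlewood subordination\<close>

text \<open>A pointwise estimate by an integral over a parameter is integrated and the order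
  exchanged. In the subordination bound the parameter runs over the outer circle; in the comparison
  of \<open>qmap\<close> with a translation it runs over a circle of translation parameters.\<close>

lemma integral_le_swap_bound:
  fixes H :: "real \<Rightarrow> real \<Rightarrow> real"
  assumes F: "F integrable_on {0..1}"
    and H: "continuous_on ({0..1} \<times> {0..1}) (\<lambda>(x, y). H x y)"
    and le: "\<And>x. x \<in> {0..1} \<Longrightarrow> F x \<le> integral {0..1} (H x)"
    and G: "G integrable_on {0..1}"
    and bd: "\<And>y. y \<in> {0..1} \<Longrightarrow> integral {0..1} (\<lambda>x. H x y) \<le> G y"
  shows "integral {0..1} F \<le> integral {0..1} G"
proof -
  have box: "continuous_on (cbox (0, 0) (1, 1)) (\<lambda>(x, y). H x y)"
    using H by (simp add: cbox_Pair_eq)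
  have "integral {0..1} F \<le> integral {0..1} (\<lambda>x. integral {0..1} (H x))"
  proof (rule integral_le[OF F])
    show "(\<lambda>x. integral {0..1} (H x)) integrable_on {0..1}"
      using integral_integrable_2dim[OF box[unfolded case_prod_unfold]] by simp
  qed (use le in auto)
  also have "\<dots> = integral {0..1} (\<lambda>y. integral {0..1} (\<lambda>x. H x y))"
    using integral_swap_continuous[OF box] by simp
  also have "\<dots> \<le> integral {0..1} G"
  proof (rule integral_le[OF _ G])
    have "continuous_on (cbox (0, 0) (1, 1)) (\<lambda>(x, y). H y x)"
      using swap_continuous[OF box] by simp
    then show "(\<lambda>y. integral {0..1} (\<lambda>x. H x y)) integrable_on {0..1}"
      using integral_integrable_2dim[where f = "\<lambda>(x, y). H y x" and a = "0::real" and b = "1::real" and c = "0::real" and d = "1::real"] by simp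
  qed (use bd in auto)
  finally show ?thesis .
qed

definition poisson :: "real \<Rightarrow> complex \<Rightarrow> complex \<Rightarrow> real" where
  "poisson R w \<zeta> = (R\<^sup>2 - (cmod w)\<^sup>2) / (cmod (\<zeta> - w))\<^sup>2"

lemma poisson_eq_Re:
  assumes "cmod \<zeta> = R"
  shows "poisson R w \<zeta> = Re ((\<zeta> + w) / (\<zeta> - w))"
proof -
  have "Re ((\<zeta> + w) * cnj (\<zeta> - w)) = (cmod \<zeta>)\<^sup>2 - (cmod w)\<^sup>2"
    by (simp add: cmod_power2) (simp add: power2_eq_square algebra_simps)
  then show ?thesis
    using assms by (simp add: poisson_def complex_div_cnj[of "\<zeta> + w"])
qed

lemma poisson_integral_ge:
  assumes f: "f holomorphic_on ball 0 1" and R: "0 < R" "R < 1" and w: "cmod w < R"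
  shows "(cmod (f w))\<^sup>2 \<le> integral {0..1}
     (\<lambda>t. (cmod (f (circlepath 0 R t)))\<^sup>2 * poisson R w (circlepath 0 R t))"
    (is "_ \<le> integral _ ?P")
proof -
  let ?c = "circlepath 0 R"
  \<comment> \<open>Cauchy's formula at \<open>w\<close> for \<open>f\<^sup>2 (R\<^sup>2 - |w|\<^sup>2) / (R\<^sup>2 - z cnj w)\<close>, whose Cauchy kernel has modulus
    the Poisson kernel on the circle\<close>
  define F where "F z = (f z)\<^sup>2 * (of_real (R\<^sup>2 - (cmod w)\<^sup>2) / (of_real (R\<^sup>2) - z * cnj w))" for z
  have nz: "of_real (R\<^sup>2) - z * cnj w \<noteq> 0" if "cmod z \<le> R" for z
  proof
    assume "of_real (R\<^sup>2) - z * cnj w = 0"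
    then have "cmod (of_real (R\<^sup>2)) = cmod (z * cnj w)" by simp
    then have "R\<^sup>2 = cmod z * cmod w" by (simp only: norm_of_real norm_mult complex_mod_cnj) simp
    also have "\<dots> \<le> R * cmod w" using that by (intro mult_right_mono) auto
    also have "\<dots> < R * R" using w R by simp
    finally show False by (simp add: power2_eq_square)
  qed
  have sub: "cball 0 R \<subseteq> ball (0::complex) 1" using R by auto
  have hF: "F holomorphic_on cball 0 R"
    unfolding F_def using nz by (intro holomorphic_intros holomorphic_on_subset[OF f sub]) auto
  have wpos: "R\<^sup>2 - (cmod w)\<^sup>2 > 0" using w R by (simp add: power_strict_mono)
  have Fw: "F w = (f w)\<^sup>2"
    using wpos by (simp add: F_def complex_norm_square[symmetric] del: of_real_power)
  have I: "((\<lambda>t. F (?c t) * (?c t / (?c t - w))) has_integral F w) {0..1}"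
    using hF w by (intro Cauchy_circle_mean holomorphic_on_imp_continuous_on)
       (auto intro: holomorphic_on_subset)
  have ne: "?c t - w \<noteq> 0" for t using w R by (metis abs_of_pos eq_iff_diff_eq_0 less_irrefl norm_circlepath_0)
  have "(cmod (f w))\<^sup>2 = cmod (integral {0..1} (\<lambda>t. F (?c t) * (?c t / (?c t - w))))"
    using I by (simp add: integral_unique Fw norm_power)
  also have "\<dots> \<le> integral {0..1} ?P"
  proof (rule integral_norm_bound_integral)
    show "?P integrable_on {0..1}"
      unfolding poisson_def using ne R
      by (intro integrable_continuous_real continuous_intros continuous_on_comp_circlepath[OF f]) auto
    fix t :: real
    have "of_real (R\<^sup>2) - ?c t * cnj w = ?c t * cnj (?c t - w)"
      using complex_norm_square[of "?c t"] R by (simp add: algebra_simps)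
    then have "cmod (of_real (R\<^sup>2) - ?c t * cnj w) = R * cmod (?c t - w)"
      using R by (simp only: norm_mult complex_mod_cnj norm_circlepath_0 abs_of_pos)
    then have "cmod (F (?c t) * (?c t / (?c t - w))) = ?P t"
      using R wpos ne[of t] unfolding F_def norm_mult norm_divide norm_power norm_of_real
      by (simp add: poisson_def power2_eq_square field_simps)
    then show "norm (F (?c t) * (?c t / (?c t - w))) \<le> ?P t" by simp
  qed (use I in blast)
  finally show ?thesis .
qed

text \<open>The square of |f| at \<open>\<omega> z\<close> is at most its Poisson integral over
  |\<zeta>| = R. After the exchange of integrals the Poisson kernel is averaged over z; it is the
  real part of a holomorphic function of z, so the mean is its value at z = 0, which is bounded by
  the stated quotient for every \<zeta>.\<close>

lemma circle_mean_compose_le: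
  assumes f: "f holomorphic_on ball 0 1" and \<omega>: "\<omega> holomorphic_on ball 0 1"
    and r: "0 \<le> r" "r < 1" and R: "R < 1"
    and im: "\<And>z. cmod z \<le> r \<Longrightarrow> cmod (\<omega> z) < R"
  shows "circle_mean (\<lambda>z. f (\<omega> z)) r \<le> (R + cmod (\<omega> 0)) / (R - cmod (\<omega> 0)) * circle_mean f R"
proof -
  let ?c = "circlepath 0 r" and ?d = "circlepath 0 R"
  have chi0: "cmod (\<omega> 0) < R" using im[of 0] r by simp
  then have Rpos: "0 < R" using norm_ge_zero le_less_trans by blast
  have imball: "cmod (\<omega> z) < 1" if "cmod z \<le> r" for z using im[OF that] R by simp
  have im1: "\<omega> z \<noteq> \<zeta>" if "cmod z \<le> r" "cmod \<zeta> = R" for z \<zeta> using im[OF that(1)] that(2) by auto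
  define Q where "Q = (R + cmod (\<omega> 0)) / (R - cmod (\<omega> 0))"
  have mean: "integral {0..1} (\<lambda>t. poisson R (\<omega> (?c t)) \<zeta>) \<le> Q" if \<zeta>: "cmod \<zeta> = R" for \<zeta>
  proof -
    let ?F = "\<lambda>z. (\<zeta> + \<omega> z) / (\<zeta> - \<omega> z)"
    have sub: "cball 0 r \<subseteq> ball (0::complex) 1" using r by auto
    have "?F holomorphic_on cball 0 r"
      using im1 \<zeta> by (intro holomorphic_intros holomorphic_on_subset[OF \<omega> sub]) auto
    from has_integral_Re[OF circle_mean_value[OF this r(1)]]
    have "integral {0..1} (\<lambda>t. poisson R (\<omega> (?c t)) \<zeta>) = poisson R (\<omega> 0) \<zeta>"
      by (simp add: poisson_eq_Re[OF \<zeta>] integral_unique)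
    also have "\<dots> \<le> (R\<^sup>2 - (cmod (\<omega> 0))\<^sup>2) / (R - cmod (\<omega> 0))\<^sup>2"
      unfolding poisson_def using chi0 Rpos norm_triangle_ineq2[of \<zeta> "\<omega> 0"] \<zeta>
      by (intro divide_left_mono power_mono mult_pos_pos zero_less_power)
         (auto intro: power_mono)
    also have "R\<^sup>2 - (cmod (\<omega> 0))\<^sup>2 = (R + cmod (\<omega> 0)) * (R - cmod (\<omega> 0))"
      by (simp add: power2_eq_square algebra_simps)
    also have "\<dots> / (R - cmod (\<omega> 0))\<^sup>2 = Q"
      using chi0 unfolding Q_def by (simp add: power2_eq_square)
    finally show ?thesis .
  qed
  have cont: "continuous_on ({0..1} \<times> {0..1})
      (\<lambda>(x, y). (cmod (f (?d y)))\<^sup>2 * poisson R (\<omega> (?c x)) (?d y))"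
    unfolding poisson_def case_prod_unfold
    using im1 r Rpos R
    by (intro continuous_intros continuous_on_compose2[OF holomorphic_on_imp_continuous_on[OF f]]
          continuous_on_compose2[OF holomorphic_on_imp_continuous_on[OF \<omega>]])
       (auto simp: eq_commute[of "circlepath 0 R _"])
  have "circle_mean (\<lambda>z. f (\<omega> z)) r \<le> integral {0..1} (\<lambda>y. Q * (cmod (f (?d y)))\<^sup>2)"
    unfolding circle_mean_def
  proof (rule integral_le_swap_bound[OF _ cont])
    show "(\<lambda>t. (cmod (f (\<omega> (?c t))))\<^sup>2) integrable_on {0..1}"
      using imball r
      by (intro integrable_continuous_real continuous_intros
          continuous_on_compose2[OF holomorphic_on_imp_continuous_on[OF f]]
          continuous_on_compose2[OF holomorphic_on_imp_continuous_on[OF \<omega>]])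
         auto
    show "(\<lambda>y. Q * (cmod (f (?d y)))\<^sup>2) integrable_on {0..1}"
      using circle_mean_integrable[OF f, of R] Rpos R by (intro integrable_on_mult_right) auto
    fix x :: real
    show "(cmod (f (\<omega> (?c x))))\<^sup>2
       \<le> integral {0..1} (\<lambda>y. (cmod (f (?d y)))\<^sup>2 * poisson R (\<omega> (?c x)) (?d y))"
      using im r by (intro poisson_integral_ge f Rpos R) auto
    have "(cmod (f (?d x)))\<^sup>2 * integral {0..1} (\<lambda>t. poisson R (\<omega> (?c t)) (?d x)) \<le> (cmod (f (?d x)))\<^sup>2 * Q"
      using mean[of "?d x"] Rpos by (intro mult_left_mono) auto
    then show "integral {0..1} (\<lambda>t. (cmod (f (?d x)))\<^sup>2 * poisson R (\<omega> (?c t)) (?d x)) \<le> Q * (cmod (f (?d x)))\<^sup>2"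
      by (simp add: mult.commute)
  qed
  then show ?thesis unfolding Q_def circle_mean_def by simp
qed

theorem littlewood_subordination:
  assumes f: "f \<in> H2" and \<omega>: "\<omega> holomorphic_on ball 0 1" "\<And>z. z \<in> ball 0 1 \<Longrightarrow> \<omega> z \<in> ball 0 1"
  shows "(\<lambda>z. f (\<omega> z)) \<in> H2"
    "H2_norm (\<lambda>z. f (\<omega> z)) \<le> sqrt ((1 + cmod (\<omega> 0)) / (1 - cmod (\<omega> 0))) * H2_norm f"
proof -
  note hf = H2_holomorphic[OF f]
  define M where "M = H2_norm f"
  define Q where "Q = (1 + cmod (\<omega> 0)) / (1 - cmod (\<omega> 0))"
  have chi0: "cmod (\<omega> 0) < 1" using \<omega>(2)[of 0] by simp
  have Q0: "0 \<le> Q" using chi0 unfolding Q_def by (intro divide_nonneg_pos) auto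
  have M0: "0 \<le> M" using H2_norm_nonneg[OF f] by (simp add: M_def)
  have hol: "(\<lambda>z. f (\<omega> z)) holomorphic_on ball 0 1"
    using holomorphic_on_compose_gen[OF \<omega>(1) hf image_subsetI, OF \<omega>(2)] by (simp add: o_def)
  have "circle_mean (\<lambda>z. f (\<omega> z)) r \<le> (sqrt Q * M)\<^sup>2" if r: "0 < r" "r < 1" for r
  proof -
    \<comment> \<open>For fixed r the image lies in a closed disc of radius |w| < 1, so every R
      between |w| and 1 is admissible. Letting R tend to 1 gives a constant that no longer depends
      on r.\<close>
    have "compact (\<omega> ` cball 0 r)"
      using r by (intro compact_continuous_image holomorphic_on_imp_continuous_on
          holomorphic_on_subset[OF \<omega>(1)]) auto
    moreover have "\<omega> ` cball 0 r \<noteq> {}" using r by auto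
    ultimately obtain w where w: "w \<in> \<omega> ` cball 0 r" "\<And>w'. w' \<in> \<omega> ` cball 0 r \<Longrightarrow> cmod w' \<le> cmod w"
      using continuous_attains_sup[of "\<omega> ` cball 0 r" cmod] continuous_on_norm_id by blast
    have w1: "cmod w < 1" using w(1) \<omega>(2) r by fastforce
    have bound: "circle_mean (\<lambda>z. f (\<omega> z)) r \<le> (R + cmod (\<omega> 0)) / (R - cmod (\<omega> 0)) * M\<^sup>2"
      if R: "cmod w < R" "R < 1" for R
    proof -
      have im: "cmod (\<omega> z) < R" if "cmod z \<le> r" for z
        using w(2)[of "\<omega> z"] that R(1) by auto
      have c0: "cmod (\<omega> 0) < R" using im[of 0] r by simp
      have R0: "0 \<le> R" using R(1) norm_ge_zero[of w] by linarith
      have "circle_mean (\<lambda>z. f (\<omega> z)) r \<le> (R + cmod (\<omega> 0)) / (R - cmod (\<omega> 0)) * circle_mean f R"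
        using r R im by (intro circle_mean_compose_le hf \<omega>) auto
      also have "\<dots> \<le> (R + cmod (\<omega> 0)) / (R - cmod (\<omega> 0)) * M\<^sup>2"
        unfolding M_def using c0 R R0
        by (intro mult_left_mono circle_mean_le_H2_norm f divide_nonneg_pos) auto
      finally show ?thesis .
    qed
    have "circle_mean (\<lambda>z. f (\<omega> z)) r \<le> Q * M\<^sup>2"
    proof (rule tendsto_lowerbound)
      show "((\<lambda>R. (R + cmod (\<omega> 0)) / (R - cmod (\<omega> 0)) * M\<^sup>2) \<longlongrightarrow> Q * M\<^sup>2) (at_left 1)"
        unfolding Q_def using chi0 by (auto intro!: tendsto_intros)
      have "\<forall>\<^sub>F R in at_left 1. R \<in> {cmod w<..<1}"
        using w1 by (rule eventually_at_left_real)
      then show "\<forall>\<^sub>F R in at_left 1. circle_mean (\<lambda>z. f (\<omega> z)) r \<le> (R + cmod (\<omega> 0)) / (R - cmod (\<omega> 0)) * M\<^sup>2"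
        by eventually_elim (use bound in auto)
    qed simp
    then show ?thesis using Q0 by (simp add: power_mult_distrib)
  qed
  then show "(\<lambda>z. f (\<omega> z)) \<in> H2" "H2_norm (\<lambda>z. f (\<omega> z)) \<le> sqrt ((1 + cmod (\<omega> 0)) / (1 - cmod (\<omega> 0))) * H2_norm f"
    using H2_I_circle_mean[OF hol, of "sqrt Q * M"] Q0 M0 unfolding Q_def M_def by auto
qed

section \<open>Norm bounds from pointwise bounds\<close>

lemma circle_mean_le_pointwise:
  assumes f: "f holomorphic_on ball 0 1" and G: "G holomorphic_on ball 0 1" and r: "0 \<le> r" "r < 1"
    and le: "\<And>z. z \<in> ball 0 1 \<Longrightarrow> (cmod (f z))\<^sup>2 \<le> A * (cmod (G z))\<^sup>2 + B"
  shows "circle_mean f r \<le> A * circle_mean G r + B"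
proof (rule has_integral_le[OF circle_mean_has_integral[OF f r]])
  have "((\<lambda>t::real. B) has_integral B) {0..1}" using has_integral_const_real[of B 0 1] by simp
  then show "((\<lambda>t. A * (cmod (G (circlepath 0 r t)))\<^sup>2 + B) has_integral A * circle_mean G r + B) {0..1}"
    by (intro has_integral_add has_integral_mult_right circle_mean_has_integral[OF G r])
qed (use le r in auto)

text \<open>The circle has total mass 1, so an additive constant passes through unchanged. It serves
  functions dominated by a multiple of G near one point and merely bounded elsewhere, such as the
  residuals of approximate eigenvectors.\<close>

lemma H2_I_pointwise:
  assumes f: "f holomorphic_on ball 0 1" and G: "G \<in> H2" and AB: "0 \<le> A" "0 \<le> B"
    and le: "\<And>z. z \<in> ball 0 1 \<Longrightarrow> (cmod (f z))\<^sup>2 \<le> A * (cmod (G z))\<^sup>2 + B"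
  shows "f \<in> H2" "(H2_norm f)\<^sup>2 \<le> A * (H2_norm G)\<^sup>2 + B"
proof -
  define M where "M = sqrt (A * (H2_norm G)\<^sup>2 + B)"
  have M2: "M\<^sup>2 = A * (H2_norm G)\<^sup>2 + B" and M0: "0 \<le> M"
    using AB by (simp_all add: M_def)
  have "circle_mean f r \<le> M\<^sup>2" if r: "0 < r" "r < 1" for r
  proof -
    have "circle_mean f r \<le> A * circle_mean G r + B"
      using r by (intro circle_mean_le_pointwise f H2_holomorphic[OF G] le) auto
    also have "\<dots> \<le> A * (H2_norm G)\<^sup>2 + B"
      using r AB by (intro add_mono mult_left_mono circle_mean_le_H2_norm G) auto
    finally show ?thesis by (simp add: M2)
  qed
  note H = H2_I_circle_mean[OF f M0 this]
  show "f \<in> H2" by (rule H(1))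
  have "(H2_norm f)\<^sup>2 \<le> M\<^sup>2"
    by (rule power_mono[OF H(2) H2_norm_nonneg[OF H(1)]])
  then show "(H2_norm f)\<^sup>2 \<le> A * (H2_norm G)\<^sup>2 + B" by (simp only: M2)
qed

lemma H2_mult_bounded:
  assumes m: "m holomorphic_on ball 0 1" "0 \<le> C" "\<And>z. z \<in> ball 0 1 \<Longrightarrow> cmod (m z) \<le> C" and f: "f \<in> H2"
  shows "(\<lambda>z. m z * f z) \<in> H2" "H2_norm (\<lambda>z. m z * f z) \<le> C * H2_norm f"
proof -
  have le: "(cmod (m z * f z))\<^sup>2 \<le> C\<^sup>2 * (cmod (f z))\<^sup>2 + 0" if "z \<in> ball 0 1" for z
    using m(3)[OF that] by (auto simp: norm_mult power_mult_distrib intro!: mult_right_mono power_mono)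
  have hol: "(\<lambda>z. m z * f z) holomorphic_on ball 0 1"
    by (intro holomorphic_intros m H2_holomorphic f)
  show mem: "(\<lambda>z. m z * f z) \<in> H2" by (rule H2_I_pointwise(1)[OF hol f _ _ le]) auto
  have "(H2_norm (\<lambda>z. m z * f z))\<^sup>2 \<le> C\<^sup>2 * (H2_norm f)\<^sup>2 + 0"
    by (rule H2_I_pointwise(2)[OF hol f _ _ le]) auto
  then have "(H2_norm (\<lambda>z. m z * f z))\<^sup>2 \<le> (C * H2_norm f)\<^sup>2"
    by (simp only: power_mult_distrib add_0_right)
  then show "H2_norm (\<lambda>z. m z * f z) \<le> C * H2_norm f"
    by (rule power2_le_imp_le) (simp add: m(2) H2_norm_nonneg[OF f])
qed

section \<open>The Hilbert space of coefficients\<close>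

lemma summable_norm_square_add:
  fixes a b :: "nat \<Rightarrow> complex"
  assumes "summable (\<lambda>n. (cmod (a n))\<^sup>2)" "summable (\<lambda>n. (cmod (b n))\<^sup>2)"
  shows "summable (\<lambda>n. (cmod (a n + b n))\<^sup>2)"
proof (rule summable_comparison_test')
  show "summable (\<lambda>n. 2 * (cmod (a n))\<^sup>2 + 2 * (cmod (b n))\<^sup>2)"
    using assms by (intro summable_add summable_mult)
  fix n :: nat
  have "(cmod (a n + b n))\<^sup>2 \<le> (cmod (a n) + cmod (b n))\<^sup>2"
    by (intro power_mono norm_triangle_ineq) auto
  also have "\<dots> \<le> 2 * (cmod (a n))\<^sup>2 + 2 * (cmod (b n))\<^sup>2"
    using sum_squares_bound[of "cmod (a n)" "cmod (b n)"] by (simp add: power2_sum)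
  finally show "norm ((cmod (a n + b n))\<^sup>2) \<le> 2 * (cmod (a n))\<^sup>2 + 2 * (cmod (b n))\<^sup>2" by simp
qed

lemma summable_norm_square_scale:
  fixes a :: "nat \<Rightarrow> complex"
  assumes "summable (\<lambda>n. (cmod (a n))\<^sup>2)"
  shows "summable (\<lambda>n. (cmod (c * a n))\<^sup>2)"
  using summable_mult[OF assms, of "(cmod c)\<^sup>2"] by (simp add: norm_mult power_mult_distrib)

lemma summable_mult_cnj:
  fixes a b :: "nat \<Rightarrow> complex"
  assumes "summable (\<lambda>n. (cmod (a n))\<^sup>2)" "summable (\<lambda>n. (cmod (b n))\<^sup>2)"
  shows "summable (\<lambda>n. Re (a n * cnj (b n)))"
proof (rule summable_comparison_test')
  show "summable (\<lambda>n. (cmod (a n))\<^sup>2 + (cmod (b n))\<^sup>2)"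
    using assms by (rule summable_add)
  fix n :: nat
  have "\<bar>Re (a n * cnj (b n))\<bar> \<le> cmod (a n) * cmod (b n)"
    using abs_Re_le_cmod[of "a n * cnj (b n)"] by (simp add: norm_mult)
  also have "\<dots> \<le> (cmod (a n))\<^sup>2 + (cmod (b n))\<^sup>2"
    using sum_squares_bound[of "cmod (a n)" "cmod (b n)"] mult_nonneg_nonneg[OF norm_ge_zero norm_ge_zero, of "a n" "b n"]
    by linarith
  finally show "norm (Re (a n * cnj (b n))) \<le> (cmod (a n))\<^sup>2 + (cmod (b n))\<^sup>2" by simp
qed

text \<open>Elements of \<open>H2\<close> matter only on the disc, so distinct functions may
  represent the same vector; coefficient sequences are a faithful model. It is made a real Hilbert
  space with the real part of the usual inner product, which is all that coercivity involves;
  complex scalars act through \<open>cscale\<close>.\<close>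

typedef l2 = "{a :: nat \<Rightarrow> complex. summable (\<lambda>n. (cmod (a n))\<^sup>2)}"
  morphisms coef Abs_l2
  by (rule exI[of _ "\<lambda>_. 0"]) simp

setup_lifting type_definition_l2

lemma summable_coef: "summable (\<lambda>n. (cmod (coef x n))\<^sup>2)"
  using coef by simp

lemma l2_eqI: "(\<And>n. coef x n = coef y n) \<Longrightarrow> x = y"
  using coef_inject by blast

instantiation l2 :: real_vector
begin

lift_definition zero_l2 :: l2 is "\<lambda>_. 0" by simp

lift_definition plus_l2 :: "l2 \<Rightarrow> l2 \<Rightarrow> l2" is "\<lambda>a b n. a n + b n"
  by (rule summable_norm_square_add)

lift_definition uminus_l2 :: "l2 \<Rightarrow> l2" is "\<lambda>a n. - a n" by simp

lift_definition minus_l2 :: "l2 \<Rightarrow> l2 \<Rightarrow> l2" is "\<lambda>a b n. a n - b n"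
  subgoal for a b using summable_norm_square_add[of a "\<lambda>n. - b n"] by simp
  done

lift_definition scaleR_l2 :: "real \<Rightarrow> l2 \<Rightarrow> l2" is "\<lambda>c a n. of_real c * a n"
  by (rule summable_norm_square_scale)

instance
proof
  fix x y z :: l2 and r s :: real
  show "x + y + z = x + (y + z)" by (transfer, simp add: add.assoc)
  show "x + y = y + x" by (transfer, simp add: add.commute)
  show "0 + x = x" by (transfer, simp)
  show "- x + x = 0" by (transfer, simp)
  show "x - y = x + - y" by (transfer, simp)
  show "r *\<^sub>R (x + y) = r *\<^sub>R x + r *\<^sub>R y" by (transfer, simp add: algebra_simps)
  show "(r + s) *\<^sub>R x = r *\<^sub>R x + s *\<^sub>R x" by (transfer, simp add: algebra_simps)
  show "r *\<^sub>R s *\<^sub>R x = (r * s) *\<^sub>R x" by (transfer, simp add: mult.assoc)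
  show "1 *\<^sub>R x = x" by (transfer, simp)
qed

end

instantiation l2 :: real_inner
begin

definition inner_l2 :: "l2 \<Rightarrow> l2 \<Rightarrow> real" where
  "inner_l2 x y = (\<Sum>n. Re (coef x n * cnj (coef y n)))"

definition norm_l2 :: "l2 \<Rightarrow> real" where "norm_l2 x = sqrt (inner x x)"
definition dist_l2 :: "l2 \<Rightarrow> l2 \<Rightarrow> real" where "dist_l2 x y = norm (x - y)"
definition sgn_l2 :: "l2 \<Rightarrow> l2" where "sgn_l2 x = x /\<^sub>R norm x"
definition uniformity_l2 :: "(l2 \<times> l2) filter" where
  "uniformity_l2 = (INF e\<in>{0<..}. principal {(x, y). dist x y < e})"
definition open_l2 :: "l2 set \<Rightarrow> bool" where
  "open_l2 U \<longleftrightarrow> (\<forall>x\<in>U. eventually (\<lambda>(x', y). x' = x \<longrightarrow> y \<in> U) uniformity)"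

instance
proof
  note sm = summable_mult_cnj[OF summable_coef summable_coef]
  fix x y z :: l2 and r s :: real
  show "inner x y = inner y x"
    unfolding inner_l2_def by (rule suminf_cong) (simp add: algebra_simps)
  show "inner (x + y) z = inner x z + inner y z"
    unfolding inner_l2_def by (subst suminf_add[OF sm sm]) (simp add: plus_l2.rep_eq algebra_simps)
  show "inner (r *\<^sub>R x) y = r * inner x y"
    unfolding inner_l2_def by (subst suminf_mult[OF sm, symmetric]) (simp add: scaleR_l2.rep_eq algebra_simps)
  have sq: "Re (coef x n * cnj (coef x n)) = (cmod (coef x n))\<^sup>2" for n
    unfolding cmod_power2 by (simp add: power2_eq_square)
  show "0 \<le> inner x x"
    unfolding inner_l2_def sq by (intro suminf_nonneg summable_coef) simp
  show "inner x x = 0 \<longleftrightarrow> x = 0"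
  proof
    assume "inner x x = 0"
    then have "\<forall>n. (cmod (coef x n))\<^sup>2 = 0"
      unfolding inner_l2_def sq by (subst (asm) suminf_eq_zero_iff[OF summable_coef]) auto
    then show "x = 0" by (intro l2_eqI) (simp add: zero_l2.rep_eq)
  qed (simp add: inner_l2_def zero_l2.rep_eq)
qed (rule dist_l2_def sgn_l2_def uniformity_l2_def open_l2_def norm_l2_def)+

end

lemma norm_l2_square: "(norm x)\<^sup>2 = (\<Sum>n. (cmod (coef x n))\<^sup>2)" for x :: l2
proof -
  have sq: "Re (coef x n * cnj (coef x n)) = (cmod (coef x n))\<^sup>2" for n
    unfolding cmod_power2 by (simp add: power2_eq_square)
  show ?thesis unfolding power2_norm_eq_inner inner_l2_def sq ..
qed

lemma partial_sum_le_norm_l2: "(\<Sum>n<N. (cmod (coef x n))\<^sup>2) \<le> (norm x)\<^sup>2" for x :: l2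
  unfolding norm_l2_square by (intro sum_le_suminf summable_coef) auto

lemma norm_coef_le: "cmod (coef x n) \<le> norm x" for x :: l2
proof -
  have "(cmod (coef x n))\<^sup>2 \<le> (\<Sum>k<Suc n. (cmod (coef x k))\<^sup>2)"
    by (rule member_le_sum) auto
  also have "\<dots> \<le> (norm x)\<^sup>2" by (rule partial_sum_le_norm_l2)
  finally show ?thesis by (rule power2_le_imp_le) simp
qed

instance l2 :: complete_space
proof
  fix X :: "nat \<Rightarrow> l2"
  assume X: "Cauchy X"
  have "Cauchy (\<lambda>k. coef (X k) n)" for n
  proof (rule metric_CauchyI)
    fix e :: real assume "0 < e"
    then obtain M where M: "\<And>k l. k \<ge> M \<Longrightarrow> l \<ge> M \<Longrightarrow> dist (X k) (X l) < e"
      using metric_CauchyD[OF X] by blast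
    have "dist (coef (X k) n) (coef (X l) n) < e" if "k \<ge> M" "l \<ge> M" for k l
      using norm_coef_le[of "X k - X l" n] M[OF that] by (simp add: dist_norm minus_l2.rep_eq)
    then show "\<exists>M. \<forall>m\<ge>M. \<forall>n'\<ge>M. dist (coef (X m) n) (coef (X n') n) < e" by blast
  qed
  then have "convergent (\<lambda>k. coef (X k) n)" for n by (rule Cauchy_convergent)
  then have "\<exists>a. \<forall>n. (\<lambda>k. coef (X k) n) \<longlonglongrightarrow> a n"
    unfolding convergent_def by (intro choice) blast
  then obtain a where a: "\<And>n. (\<lambda>k. coef (X k) n) \<longlonglongrightarrow> a n" by blast
  \<comment> \<open>Finite sums pass to the limit in l, so the Cauchy bound on
    \<open>X k - X l\<close> carries over to the coordinatewise limit. The same estimate yields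
    square summability of \<open>a\<close> and convergence in norm.\<close>
  have tail: "summable (\<lambda>n. (cmod (coef (X k) n - a n))\<^sup>2) \<and> (\<Sum>n. (cmod (coef (X k) n - a n))\<^sup>2) \<le> e\<^sup>2"
    if e: "0 < e" and k: "\<And>l. l \<ge> k \<Longrightarrow> dist (X k) (X l) < e" for e k
  proof -
    have part: "(\<Sum>n<N. (cmod (coef (X k) n - a n))\<^sup>2) \<le> e\<^sup>2" for N
    proof (rule tendsto_upperbound)
      show "(\<lambda>l. \<Sum>n<N. (cmod (coef (X k) n - coef (X l) n))\<^sup>2) \<longlonglongrightarrow> (\<Sum>n<N. (cmod (coef (X k) n - a n))\<^sup>2)"
        by (intro tendsto_intros a)
      show "\<forall>\<^sub>F l in sequentially. (\<Sum>n<N. (cmod (coef (X k) n - coef (X l) n))\<^sup>2) \<le> e\<^sup>2"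
      proof (rule eventually_sequentiallyI[of k])
        fix l assume "l \<ge> k"
        have "(\<Sum>n<N. (cmod (coef (X k) n - coef (X l) n))\<^sup>2) \<le> (norm (X k - X l))\<^sup>2"
          using partial_sum_le_norm_l2[of "X k - X l" N] by (simp add: minus_l2.rep_eq)
        also have "\<dots> \<le> e\<^sup>2"
          using k[OF \<open>l \<ge> k\<close>] by (intro power_mono) (auto simp: dist_norm)
        finally show "(\<Sum>n<N. (cmod (coef (X k) n - coef (X l) n))\<^sup>2) \<le> e\<^sup>2" .
      qed
    qed simp
    have "summable (\<lambda>n. (cmod (coef (X k) n - a n))\<^sup>2)"
      by (rule summableI_nonneg_bounded[of _ "e\<^sup>2"]) (use part in auto)
    then show ?thesis using part by (auto intro: suminf_le_const)
  qed
  obtain k0 where "\<And>l. l \<ge> k0 \<Longrightarrow> dist (X k0) (X l) < 1"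
    using metric_CauchyD[OF X, of 1] by (metis order_refl zero_less_one)
  then have "summable (\<lambda>n. (cmod (coef (X k0) n - a n))\<^sup>2)" using tail[of 1 k0] by simp
  then have "summable (\<lambda>n. (cmod (- 1 * (coef (X k0) n - a n)))\<^sup>2)"
    by (rule summable_norm_square_scale)
  from summable_norm_square_add[OF summable_coef[of "X k0"] this]
  have "summable (\<lambda>n. (cmod (a n))\<^sup>2)" by simp
  then have ca: "coef (Abs_l2 a) = a" by (simp add: Abs_l2_inverse)
  have "X \<longlonglongrightarrow> Abs_l2 a"
  proof (rule metric_LIMSEQ_I)
    fix e :: real assume "0 < e"
    then obtain M where M: "\<And>k l. k \<ge> M \<Longrightarrow> l \<ge> M \<Longrightarrow> dist (X k) (X l) < e / 2"
      using metric_CauchyD[OF X, of "e / 2"] by auto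
    have "dist (X k) (Abs_l2 a) < e" if k: "k \<ge> M" for k
    proof -
      have "(norm (X k - Abs_l2 a))\<^sup>2 \<le> (e / 2)\<^sup>2"
        unfolding norm_l2_square using tail[of "e / 2" k] M k \<open>0 < e\<close> by (simp add: minus_l2.rep_eq ca)
      then have "norm (X k - Abs_l2 a) \<le> e / 2" using \<open>0 < e\<close> by (auto intro: power2_le_imp_le)
      then show ?thesis using \<open>0 < e\<close> by (simp add: dist_norm)
    qed
    then show "\<exists>no. \<forall>n\<ge>no. dist (X n) (Abs_l2 a) < e" by blast
  qed
  then show "convergent X" by (auto simp: convergent_def)
qed

section \<open>Coercive operators\<close>

lemma coercive_norm_le:
  fixes x y :: "'a::real_inner"
  assumes "d * (norm x)\<^sup>2 \<le> inner y x"
  shows "d * norm x \<le> norm y"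
proof -
  have "d * norm x * norm x \<le> norm y * norm x"
    using assms norm_cauchy_schwarz[of y x] by (simp add: power2_eq_square)
  then show ?thesis by (cases "x = 0") auto
qed

theorem lax_milgram:
  fixes A :: "'a::{real_inner, complete_space} \<Rightarrow> 'a"
  assumes A: "bounded_linear A" and d: "0 < d" and coercive: "\<And>x. d * (norm x)\<^sup>2 \<le> inner (A x) x"
  shows "\<exists>x. A x = y"
proof -
  interpret A: bounded_linear A by (rule A)
  obtain M where M: "0 < M" "\<And>x. norm (A x) \<le> norm x * M" using A.pos_bounded by blast
  define k where "k = d / M\<^sup>2"
  \<comment> \<open>In a nonzero space coercivity forces d \<le> M, so 1 - d k is nonnegative. The
    maximum with 0 covers the zero space, where d may exceed M.\<close>
  define c where "c = sqrt (max 0 (1 - d * k))"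
  have k: "0 < k" using d M by (simp add: k_def)
  have c: "0 \<le> c" "c < 1" using d k by (auto simp: c_def max_def)
  \<comment> \<open>\<open>k\<close> minimises the bound \<open>1 - 2 d k + M\<^sup>2 k\<^sup>2\<close> for the square of the norm of \<open>1 - k A\<close>\<close>
  have contr: "norm (x - k *\<^sub>R A x) \<le> c * norm x" for x
  proof (rule power2_le_imp_le)
    have "(norm (x - k *\<^sub>R A x))\<^sup>2 = (norm x)\<^sup>2 - 2 * k * inner (A x) x + k\<^sup>2 * (norm (A x))\<^sup>2"
      unfolding power2_norm_eq_inner
      by (simp add: inner_commute power2_eq_square algebra_simps)
    also have "\<dots> \<le> (norm x)\<^sup>2 - 2 * k * (d * (norm x)\<^sup>2) + k\<^sup>2 * (norm x * M)\<^sup>2"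
      using k coercive[of x] M(2)[of x] by (intro add_mono diff_mono mult_left_mono power_mono) auto
    also have "\<dots> = (1 - d * k) * (norm x)\<^sup>2"
      using M(1) by (simp add: k_def power2_eq_square field_simps)
    also have "\<dots> \<le> max 0 (1 - d * k) * (norm x)\<^sup>2" by (intro mult_right_mono) auto
    also have "\<dots> = (c * norm x)\<^sup>2" by (simp add: c_def power_mult_distrib)
    finally show "(norm (x - k *\<^sub>R A x))\<^sup>2 \<le> (c * norm x)\<^sup>2" .
  qed (use c in simp)
  define f where "f x = x - k *\<^sub>R A x + k *\<^sub>R y" for x
  have "\<exists>!x. f x = x"
  proof (rule banach_fix_type[OF c], intro allI)
    fix u v
    have "f u - f v = (u - v) - k *\<^sub>R A (u - v)" by (simp add: f_def A.diff algebra_simps)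
    then show "dist (f u) (f v) \<le> c * dist u v" using contr[of "u - v"] by (simp add: dist_norm)
  qed
  then obtain x where "f x = x" by blast
  then have "A x = y" using k by (simp add: f_def)
  then show ?thesis by blast
qed

section \<open>Coefficient vectors as functions on the disc\<close>

lemma power_series_unique:
  fixes f :: "complex \<Rightarrow> complex"
  assumes a: "\<And>z. z \<in> ball 0 1 \<Longrightarrow> (\<lambda>n. a n * z ^ n) sums f z"
    and b: "\<And>z. z \<in> ball 0 1 \<Longrightarrow> (\<lambda>n. b n * z ^ n) sums f z"
  shows "a n = b n"
proof (rule ccontr)
  assume ne: "a n \<noteq> b n"
  have d: "(\<lambda>n. (a n - b n) * z ^ n) sums 0" if "z \<in> ball 0 1" for z
    using sums_diff[OF a[OF that] b[OF that]] by (simp only: left_diff_distrib diff_self)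
  \<comment> \<open>Isolation of zeros is applied below to a nonzero coefficient of positive index,
    so the constant terms are compared first, by evaluation at 0.\<close>
  have "(\<lambda>n. (a n - b n) * 0 ^ n) sums (a 0 - b 0)" by (rule powser_sums_zero)
  moreover have "(\<lambda>n. (a n - b n) * 0 ^ n) sums 0" by (rule d) simp
  ultimately have "a 0 - b 0 = 0" by (rule sums_unique2)
  then have "0 < n" using ne by (cases n) auto
  show False
  proof (rule powser_0_nonzero[where f = "\<lambda>_. 0" and a = "\<lambda>n. a n - b n" and m = n and \<xi> = 0 and r = 1])
    show "(\<lambda>n. (a n - b n) * (z - 0) ^ n) sums 0" if "cmod (z - 0) < 1" for z
      using d[of z] that by (simp only: diff_zero mem_ball_0)
    show "a n - b n \<noteq> 0" using ne by simp
    fix s :: real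
    assume s: "0 < s" "\<And>z::complex. z \<in> cball 0 s - {0} \<Longrightarrow> (0::complex) \<noteq> 0"
    have "complex_of_real s \<in> cball 0 s - {0}" using s(1) by simp
    from s(2)[OF this] show False by (rule notE) (rule refl)
  qed (rule zero_less_one refl \<open>0 < n\<close>)+
qed

lemma taylor_coeff_eqI:
  assumes "\<And>z. z \<in> ball 0 1 \<Longrightarrow> (\<lambda>n. a n * z ^ n) sums f z"
  shows "taylor_coeff f = a"
proof
  fix n
  have "f holomorphic_on ball 0 1"
    by (rule power_series_holomorphic[of 0 1 a]) (use assms in simp)
  from power_series_unique[OF taylor_sums[OF this] assms] show "taylor_coeff f n = a n" .
qed

lemma taylor_coeff_cong:
  assumes "f holomorphic_on ball 0 1" "\<And>z. z \<in> ball 0 1 \<Longrightarrow> f z = g z"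
  shows "taylor_coeff g = taylor_coeff f"
  using taylor_sums[OF assms(1)] assms(2) by (intro taylor_coeff_eqI) auto

lemma H2_cong:
  assumes "f \<in> H2" "\<And>z. z \<in> ball 0 1 \<Longrightarrow> f z = g z"
  shows "g \<in> H2" "H2_norm g = H2_norm f"
proof -
  have "g holomorphic_on ball 0 1"
    using H2_holomorphic[OF assms(1)] assms(2) holomorphic_transform by blast
  moreover have "taylor_coeff g = taylor_coeff f"
    using assms by (intro taylor_coeff_cong H2_holomorphic)
  ultimately show "g \<in> H2" "H2_norm g = H2_norm f"
    using assms(1) by (simp_all add: H2_def H2_norm_def)
qed

definition ev :: "l2 \<Rightarrow> complex \<Rightarrow> complex" where
  "ev x z = (\<Sum>n. coef x n * z ^ n)"

definition of_fun :: "(complex \<Rightarrow> complex) \<Rightarrow> l2" where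
  "of_fun f = Abs_l2 (taylor_coeff f)"

lemma ev_sums:
  assumes "z \<in> ball 0 1"
  shows "(\<lambda>n. coef x n * z ^ n) sums ev x z"
  unfolding ev_def
proof (rule summable_sums, rule summable_comparison_test')
  show "summable (\<lambda>n. norm x * cmod z ^ n)"
    using assms by (intro summable_mult summable_geometric) simp
  show "norm (coef x n * z ^ n) \<le> norm x * cmod z ^ n" for n
    by (auto simp: norm_mult norm_power intro!: mult_right_mono norm_coef_le)
qed

lemma ev_eqI: "(\<And>z. z \<in> ball 0 1 \<Longrightarrow> ev x z = ev y z) \<Longrightarrow> x = y"
proof (rule l2_eqI, rule power_series_unique[of _ "ev x"])
  fix z :: complex
  assume eq: "\<And>z. z \<in> ball 0 1 \<Longrightarrow> ev x z = ev y z" and z: "z \<in> ball 0 1"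
  show "(\<lambda>n. coef x n * z ^ n) sums ev x z" by (rule ev_sums[OF z])
  show "(\<lambda>n. coef y n * z ^ n) sums ev x z" unfolding eq[OF z] by (rule ev_sums[OF z])
qed

lemma taylor_coeff_ev: "taylor_coeff (ev x) = coef x"
  by (rule taylor_coeff_eqI) (rule ev_sums)

lemma ev_in_H2: "ev x \<in> H2"
  unfolding H2_def using power_series_holomorphic[of 0 1 "coef x" "ev x"] ev_sums[of _ x]
  by (simp add: taylor_coeff_ev summable_coef)

lemma H2_norm_ev: "H2_norm (ev x) = norm x"
  unfolding H2_norm_def taylor_coeff_ev norm_l2_square[symmetric] by simp

lemma coef_of_fun: "f \<in> H2 \<Longrightarrow> coef (of_fun f) = taylor_coeff f"
  unfolding of_fun_def by (intro Abs_l2_inverse) (simp add: H2_summable)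

lemma ev_of_fun: "f \<in> H2 \<Longrightarrow> z \<in> ball 0 1 \<Longrightarrow> ev (of_fun f) z = f z"
  unfolding ev_def coef_of_fun by (rule sums_unique[symmetric]) (intro taylor_sums H2_holomorphic)

lemma norm_of_fun: "f \<in> H2 \<Longrightarrow> norm (of_fun f) = H2_norm f"
  by (rule power2_eq_imp_eq) (simp_all add: norm_l2_square coef_of_fun H2_norm_square H2_norm_nonneg)

lemma ev_add: "z \<in> ball 0 1 \<Longrightarrow> ev (x + y) z = ev x z + ev y z"
  using sums_add[OF ev_sums[of z x] ev_sums[of z y]] ev_sums[of z "x + y"]
  by (simp add: plus_l2.rep_eq distrib_right sums_unique2)

lemma ev_scaleR: "z \<in> ball 0 1 \<Longrightarrow> ev (r *\<^sub>R x) z = of_real r * ev x z"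
  using sums_mult[OF ev_sums[of z x], of "of_real r"] ev_sums[of z "r *\<^sub>R x"]
  by (simp add: scaleR_l2.rep_eq mult.assoc sums_unique2)

lift_definition cscale :: "complex \<Rightarrow> l2 \<Rightarrow> l2" is "\<lambda>c a n. c * a n"
  by (rule summable_norm_square_scale)

lemma ev_cscale: "z \<in> ball 0 1 \<Longrightarrow> ev (cscale c x) z = c * ev x z"
  using sums_mult[OF ev_sums[of z x], of c] ev_sums[of z "cscale c x"]
  by (simp add: cscale.rep_eq mult.assoc sums_unique2)

lemma norm_cscale: "norm (cscale c x) = cmod c * norm x"
proof -
  have "(norm (cscale c x))\<^sup>2 = (cmod c * norm x)\<^sup>2"
    unfolding power_mult_distrib norm_l2_square cscale.rep_eq norm_mult
    by (rule suminf_mult[OF summable_coef])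
  then show ?thesis by simp
qed

lemma bounded_linear_cscale: "bounded_linear (cscale c)"
  by (rule bounded_linear_intro[where K = "cmod c"])
     (auto intro!: l2_eqI simp: cscale.rep_eq plus_l2.rep_eq scaleR_l2.rep_eq algebra_simps norm_cscale)

lemma inner_cscale_self: "inner (cscale c x) x = Re c * (norm x)\<^sup>2"
proof -
  have "Re (c * z * cnj z) = Re c * (cmod z)\<^sup>2" for z
    by (simp only: mult.assoc complex_norm_square[symmetric] times_complex.sel Re_complex_of_real Im_complex_of_real)
  then show ?thesis
    unfolding inner_l2_def norm_l2_square cscale.rep_eq by (simp add: suminf_mult[OF summable_coef])
qed

section \<open>Basis vectors and symmetric operators\<close>

definition basis :: "nat \<Rightarrow> complex \<Rightarrow> l2" where
  "basis n c = Abs_l2 (\<lambda>k. if k = n then c else 0)"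

lemma coef_basis: "coef (basis n c) k = (if k = n then c else 0)"
proof -
  have "summable (\<lambda>k. (cmod (if k = n then c else 0))\<^sup>2)"
    by (rule summable_finite[of "{n}"]) auto
  then show ?thesis unfolding basis_def by (subst Abs_l2_inverse) auto
qed

lemma ev_basis: "z \<in> ball 0 1 \<Longrightarrow> ev (basis n c) z = c * z ^ n"
proof -
  have "(\<lambda>k. coef (basis n c) k * z ^ k) = (\<lambda>k. if k = n then c * z ^ k else 0)"
    by (auto simp: coef_basis)
  then show ?thesis unfolding ev_def
    using sums_unique[OF sums_single[of n "\<lambda>k. c * z ^ k"]] by simp
qed

lemma inner_basis: "inner (basis n c) y = Re (c * cnj (coef y n))"
proof -
  have "(\<lambda>k. Re (coef (basis n c) k * cnj (coef y k))) = (\<lambda>k. if k = n then Re (c * cnj (coef y k)) else 0)"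
    by (auto simp: coef_basis)
  then show ?thesis unfolding inner_l2_def
    using sums_unique[OF sums_single[of n "\<lambda>k. Re (c * cnj (coef y k))"]] by simp
qed

lemma basis_expansion: "(\<lambda>N. \<Sum>n<N. basis n (coef x n)) \<longlonglongrightarrow> x"
proof -
  let ?S = "\<lambda>N. \<Sum>n<N. basis n (coef x n)"
  have cS: "coef (?S N) k = (if k < N then coef x k else 0)" for N k
  proof (induction N)
    case (Suc N)
    have "coef (?S (Suc N)) k = coef (?S N) k + coef (basis N (coef x N)) k"
      by (simp only: sum.lessThan_Suc plus_l2.rep_eq)
    also have "\<dots> = (if k < Suc N then coef x k else 0)"
      by (subst Suc, subst coef_basis) (auto simp: less_Suc_eq)
    finally show ?case .
  qed (simp add: zero_l2.rep_eq)
  have n2: "(norm (?S N - x))\<^sup>2 = (\<Sum>k. (cmod (coef x k))\<^sup>2) - (\<Sum>k<N. (cmod (coef x k))\<^sup>2)" for N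
  proof -
    have "(\<lambda>k. (cmod (coef x k))\<^sup>2 - (if k \<in> {..<N} then (cmod (coef x k))\<^sup>2 else 0)) sums
        ((\<Sum>k. (cmod (coef x k))\<^sup>2) - (\<Sum>k<N. (cmod (coef x k))\<^sup>2))"
      by (rule sums_diff[OF summable_sums[OF summable_coef] sums_If_finite_set]) simp
    also have "(\<lambda>k. (cmod (coef x k))\<^sup>2 - (if k \<in> {..<N} then (cmod (coef x k))\<^sup>2 else 0))
       = (\<lambda>k. (cmod (coef (?S N - x) k))\<^sup>2)"
      unfolding minus_l2.rep_eq cS by auto
    finally show ?thesis unfolding norm_l2_square by (rule sums_unique[symmetric])
  qed
  have "(\<lambda>N. (norm (?S N - x))\<^sup>2) \<longlonglongrightarrow> (\<Sum>k. (cmod (coef x k))\<^sup>2) - (\<Sum>k. (cmod (coef x k))\<^sup>2)"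
    unfolding n2 by (rule tendsto_diff[OF tendsto_const summable_LIMSEQ[OF summable_coef]])
  then have "(\<lambda>N. sqrt ((norm (?S N - x))\<^sup>2)) \<longlonglongrightarrow> sqrt 0"
    by (intro tendsto_real_sqrt) (simp only: diff_self)
  then have "(\<lambda>N. norm (?S N - x)) \<longlonglongrightarrow> 0"
    by (simp only: real_sqrt_abs abs_norm_cancel real_sqrt_zero)
  then show ?thesis by (simp only: tendsto_norm_zero_iff LIM_zero_iff)
qed

lemma bounded_linear_zero_on_basis:
  assumes F: "bounded_linear F" and z: "\<And>n c. F (basis n c) = 0"
  shows "F x = 0"
proof -
  interpret bounded_linear F by (rule F)
  have "(\<lambda>N. F (\<Sum>n<N. basis n (coef x n))) \<longlonglongrightarrow> F x"
    by (intro tendsto basis_expansion)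
  then have "(\<lambda>N. 0) \<longlonglongrightarrow> F x" by (simp add: sum z)
  then show ?thesis by (simp add: LIMSEQ_const_iff)
qed

text \<open>T is real-linear, so \<open>lin\<close> has to supply complex homogeneity on the basis
  vectors. A Hermitian matrix then gives symmetry on all vectors \<open>basis n c\<close>, and
  density extends it in one argument after the other.\<close>

lemma symmetric_operatorI:
  assumes T: "bounded_linear T"
    and lin: "\<And>n c. T (basis n c) = cscale c (T (basis n 1))"
    and herm: "\<And>n k. coef (T (basis n 1)) k = cnj (coef (T (basis k 1)) n)"
  shows "inner (T x) y = inner x (T y)"
proof -
  interpret T: bounded_linear T by (rule T)
  have cT: "coef (T (basis n c)) k = c * coef (T (basis n 1)) k" for n c k
    by (subst lin) (simp add: cscale.rep_eq)
  have b: "inner (T (basis n c)) (basis k d) = inner (basis n c) (T (basis k d))" for n c k d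
    by (subst inner_commute) (simp add: inner_basis cT[of _ c] cT[of _ d] herm[of n k], simp add: algebra_simps)
  have z: "inner (T x) (basis k d) - inner x (T (basis k d)) = 0" for k d
  proof (rule bounded_linear_zero_on_basis[of "\<lambda>x. inner (T x) (basis k d) - inner x (T (basis k d))"])
    show "bounded_linear (\<lambda>x. inner (T x) (basis k d) - inner x (T (basis k d)))"
      by (intro bounded_linear_sub bounded_linear_compose[OF bounded_linear_inner_left T]
          bounded_linear_inner_left)
  qed (simp add: b)
  have "inner (T x) y - inner x (T y) = 0"
  proof (rule bounded_linear_zero_on_basis[of "\<lambda>y. inner (T x) y - inner x (T y)"])
    show "bounded_linear (\<lambda>y. inner (T x) y - inner x (T y))"
      by (intro bounded_linear_sub bounded_linear_compose[OF bounded_linear_inner_right T]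
          bounded_linear_inner_right)
  qed (rule z)
  then show ?thesis by simp
qed

section \<open>Weighted composition operators\<close>

lemma wcomp_H2:
  assumes m: "m holomorphic_on ball 0 1" "0 \<le> C" "\<And>z. z \<in> ball 0 1 \<Longrightarrow> cmod (m z) \<le> C"
    and \<omega>: "\<omega> holomorphic_on ball 0 1" "\<And>z. z \<in> ball 0 1 \<Longrightarrow> \<omega> z \<in> ball 0 1"
    and f: "f \<in> H2"
  shows "wcomp m \<omega> f \<in> H2"
    "H2_norm (wcomp m \<omega> f) \<le> C * sqrt ((1 + cmod (\<omega> 0)) / (1 - cmod (\<omega> 0))) * H2_norm f"
proof -
  note L = littlewood_subordination[OF f \<omega>]
  show "wcomp m \<omega> f \<in> H2" unfolding wcomp_def by (rule H2_mult_bounded(1)[OF m L(1)])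
  have "H2_norm (wcomp m \<omega> f) \<le> C * H2_norm (\<lambda>z. f (\<omega> z))"
    unfolding wcomp_def by (rule H2_mult_bounded(2)[OF m L(1)])
  also have "\<dots> \<le> C * (sqrt ((1 + cmod (\<omega> 0)) / (1 - cmod (\<omega> 0))) * H2_norm f)"
    by (intro mult_left_mono L m)
  finally show "H2_norm (wcomp m \<omega> f) \<le> C * sqrt ((1 + cmod (\<omega> 0)) / (1 - cmod (\<omega> 0))) * H2_norm f"
    by (simp add: mult.assoc)
qed

definition wop :: "(complex \<Rightarrow> complex) \<Rightarrow> (complex \<Rightarrow> complex) \<Rightarrow> l2 \<Rightarrow> l2" where
  "wop m \<omega> x = of_fun (wcomp m \<omega> (ev x))"

lemma wop:
  assumes m: "m holomorphic_on ball 0 1" "0 \<le> C" "\<And>z. z \<in> ball 0 1 \<Longrightarrow> cmod (m z) \<le> C"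
    and \<omega>: "\<omega> holomorphic_on ball 0 1" "\<And>z. z \<in> ball 0 1 \<Longrightarrow> \<omega> z \<in> ball 0 1"
  shows ev_wop: "\<And>z. z \<in> ball 0 1 \<Longrightarrow> ev (wop m \<omega> x) z = m z * ev x (\<omega> z)"
    and norm_wop_le: "norm (wop m \<omega> x) \<le> C * sqrt ((1 + cmod (\<omega> 0)) / (1 - cmod (\<omega> 0))) * norm x"
    and bounded_linear_wop: "bounded_linear (wop m \<omega>)"
proof -
  note W = wcomp_H2[OF m \<omega> ev_in_H2]
  have ev: "ev (wop m \<omega> x) z = m z * ev x (\<omega> z)" if "z \<in> ball 0 1" for z x
    using ev_of_fun[OF W(1) that] by (simp add: wop_def wcomp_def)
  have nrm: "norm (wop m \<omega> x) \<le> C * sqrt ((1 + cmod (\<omega> 0)) / (1 - cmod (\<omega> 0))) * norm x" for x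
    unfolding wop_def using norm_of_fun[OF W(1)[of x]] W(2)[of x] by (simp add: H2_norm_ev)
  show "ev (wop m \<omega> x) z = m z * ev x (\<omega> z)" if "z \<in> ball 0 1" for z using ev[OF that] .
  show "norm (wop m \<omega> x) \<le> C * sqrt ((1 + cmod (\<omega> 0)) / (1 - cmod (\<omega> 0))) * norm x" by (rule nrm)
  show "bounded_linear (wop m \<omega>)"
  proof (rule bounded_linear_intro)
    show "wop m \<omega> (x + y) = wop m \<omega> x + wop m \<omega> y" for x y
      by (rule ev_eqI) (simp only: ev ev_add \<omega>(2) distrib_left)
    show "wop m \<omega> (r *\<^sub>R x) = r *\<^sub>R wop m \<omega> x" for r x
      by (rule ev_eqI) (simp only: ev ev_scaleR \<omega>(2) mult.left_commute)
    show "norm (wop m \<omega> x) \<le> norm x * (C * sqrt ((1 + cmod (\<omega> 0)) / (1 - cmod (\<omega> 0))))" for x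
      using nrm[of x] by (simp add: mult.commute)
  qed
qed

section \<open>Translations of the half-plane\<close>

lemma mem_disc_iff_Re:
  assumes "z \<noteq> 1"
  shows "z \<in> ball 0 1 \<longleftrightarrow> 1 / 2 < Re (1 / (1 - z))"
proof -
  have pos: "0 < (cmod (1 - z))\<^sup>2" using assms by simp
  have "Re (1 / (1 - z)) = Re (1 - z) / (cmod (1 - z))\<^sup>2"
    by (simp add: Re_divide cmod_power2)
  then have "1 / 2 < Re (1 / (1 - z)) \<longleftrightarrow> (cmod (1 - z))\<^sup>2 < 2 * Re (1 - z)"
    by (simp only: pos_less_divide_eq[OF pos]) auto
  also have "\<dots> \<longleftrightarrow> (cmod z)\<^sup>2 < 1"
    unfolding cmod_power2 by (simp add: power2_eq_square algebra_simps)
  also have "\<dots> \<longleftrightarrow> z \<in> ball 0 1"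
    by (simp add: power_less_one_iff abs_square_less_1)
  finally show ?thesis ..
qed

lemma disc_ne_one: "z \<in> ball 0 1 \<Longrightarrow> z \<noteq> (1::complex)"
  by auto

lemma disc_Re_gt: "z \<in> ball 0 1 \<Longrightarrow> 1 / 2 < Re (1 / (1 - z))"
  using mem_disc_iff_Re[OF disc_ne_one] by simp

text \<open>In the coordinate \<open>v = 1 / (1 - z)\<close>, \<open>par \<kappa>\<close> is \<open>v \<mapsto> v + \<kappa>\<close>.\<close>

definition par :: "complex \<Rightarrow> complex \<Rightarrow> complex" where
  "par \<kappa> z = 1 - (1 - z) / (1 + \<kappa> * (1 - z))"

lemma par_denom:
  assumes "z \<in> ball 0 1" "0 \<le> Re \<kappa>"
  shows "1 + \<kappa> * (1 - z) \<noteq> 0"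
proof
  assume "1 + \<kappa> * (1 - z) = 0"
  then have "1 / (1 - z) + \<kappa> = 0" using disc_ne_one[OF assms(1)] by (simp add: field_simps)
  then have "Re (1 / (1 - z)) + Re \<kappa> = 0" by (metis plus_complex.sel(1) zero_complex.sel(1))
  then show False using disc_Re_gt[OF assms(1)] assms(2) by linarith
qed

lemma inverse_one_minus_par:
  assumes "z \<in> ball 0 1" "0 \<le> Re \<kappa>"
  shows "1 / (1 - par \<kappa> z) = 1 / (1 - z) + \<kappa>"
  using par_denom[OF assms] disc_ne_one[OF assms(1)] by (simp add: par_def field_simps)

lemma par_in_disc:
  assumes "z \<in> ball 0 1" "0 \<le> Re \<kappa>"
  shows "par \<kappa> z \<in> ball 0 1"
proof -
  have "par \<kappa> z \<noteq> 1"
    using par_denom[OF assms] disc_ne_one[OF assms(1)] by (simp add: par_def)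
  moreover have "1 / 2 < Re (1 / (1 - par \<kappa> z))"
    unfolding inverse_one_minus_par[OF assms] using disc_Re_gt[OF assms(1)] assms(2) by simp
  ultimately show ?thesis using mem_disc_iff_Re by blast
qed

lemma par_holomorphic: "0 \<le> Re \<kappa> \<Longrightarrow> par \<kappa> holomorphic_on ball 0 1"
  unfolding par_def[abs_def] using par_denom by (intro holomorphic_intros) auto

lemma par_zero: "1 + \<kappa> \<noteq> 0 \<Longrightarrow> par \<kappa> 0 = \<kappa> / (1 + \<kappa>)"
  by (simp add: par_def field_simps)

text \<open>In the coordinate v this is v / (v + s). The map sending f to f / v leads to the Hardy
  space of the half-plane, and there the weighted operator becomes the plain translation by s; this
  is the origin of its symmetry.\<close>

definition transl_weight :: "real \<Rightarrow> complex \<Rightarrow> complex" where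
  "transl_weight s z = 1 / (1 + of_real s * (1 - z))"

lemma transl_weight_holomorphic: "0 \<le> s \<Longrightarrow> transl_weight s holomorphic_on ball 0 1"
  unfolding transl_weight_def[abs_def] using par_denom[of _ "of_real s"]
  by (intro holomorphic_intros) auto

lemma norm_transl_weight_le:
  assumes "0 \<le> s" "z \<in> ball 0 1"
  shows "cmod (transl_weight s z) \<le> 1"
proof -
  have "Re z \<le> 1" using assms(2) complex_Re_le_cmod[of z] by simp
  then have "1 \<le> Re (1 + of_real s * (1 - z))" using assms(1) by simp
  also have "\<dots> \<le> cmod (1 + of_real s * (1 - z))" by (rule complex_Re_le_cmod)
  finally have ge: "1 \<le> cmod (1 + of_real s * (1 - z))" .
  then show ?thesis
    unfolding transl_weight_def norm_divide norm_one by (subst divide_le_eq_1_pos) linarith+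
qed

definition transl :: "real \<Rightarrow> l2 \<Rightarrow> l2" where
  "transl s = wop (transl_weight s) (par (of_real s))"

lemma transl:
  assumes "0 \<le> s"
  shows ev_transl: "\<And>z. z \<in> ball 0 1 \<Longrightarrow> ev (transl s x) z = transl_weight s z * ev x (par (of_real s) z)"
    and norm_transl_le: "(norm (transl s x))\<^sup>2 \<le> (1 + 2 * s) * (norm x)\<^sup>2"
    and bounded_linear_transl: "bounded_linear (transl s)"
proof -
  note W = wop[OF transl_weight_holomorphic[OF assms] zero_le_one norm_transl_weight_le[OF assms]
      par_holomorphic par_in_disc, of "of_real s", folded transl_def]
  show "ev (transl s x) z = transl_weight s z * ev x (par (of_real s) z)" if "z \<in> ball 0 1" for z
    using W(1)[of z x] that assms by simp
  show "bounded_linear (transl s)" using W(3) assms by simp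
  have "1 + of_real s \<noteq> (0::complex)" using assms by (simp add: complex_eq_iff)
  then have "par (of_real s) 0 = of_real (s / (1 + s))" by (simp add: par_zero)
  then have c: "cmod (par (of_real s) 0) = s / (1 + s)" using assms by (simp only: norm_of_real) simp
  \<comment> \<open>Subordination gives a contraction up to the excess 2 s, which the coercivity
    estimate absorbs for small s.\<close>
  have "(1 + cmod (par (of_real s) 0)) / (1 - cmod (par (of_real s) 0)) = 1 + 2 * s"
    unfolding c using assms by (simp add: field_simps)
  then have "norm (transl s x) \<le> sqrt (1 + 2 * s) * norm x"
    using W(2)[of x] assms by simp
  from power_mono[OF this norm_ge_zero, of 2]
  show "(norm (transl s x))\<^sup>2 \<le> (1 + 2 * s) * (norm x)\<^sup>2"
    using assms by (simp add: power_mult_distrib)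
qed

lemma transl_cscale:
  assumes "0 \<le> s"
  shows "transl s (cscale c x) = cscale c (transl s x)"
proof (rule ev_eqI)
  fix z :: complex assume z: "z \<in> ball 0 1"
  then have "par (of_real s) z \<in> ball 0 1" using assms by (intro par_in_disc) auto
  then show "ev (transl s (cscale c x)) z = ev (cscale c (transl s x)) z"
    by (simp only: ev_transl[OF assms] ev_cscale z mult.left_commute)
qed

lemma transl_transl:
  assumes "0 \<le> s" "0 \<le> t"
  shows "transl s (transl t x) = transl (s + t) x"
proof (rule ev_eqI)
  fix z :: complex assume z: "z \<in> ball 0 1"
  have pz: "par (of_real s) z \<in> ball 0 1" using z assms by (intro par_in_disc) auto
  have d: "1 + of_real s * (1 - z) \<noteq> 0" "1 + of_real (s + t) * (1 - z) \<noteq> 0"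
    using par_denom[OF z, of "of_real s"] par_denom[OF z, of "of_real (s + t)"] assms by auto
  have e: "1 + of_real t * (1 - par (of_real s) z) = (1 + of_real (s + t) * (1 - z)) / (1 + of_real s * (1 - z))"
    using d(1) by (simp add: par_def field_simps)
  have w: "transl_weight s z * transl_weight t (par (of_real s) z) = transl_weight (s + t) z"
    unfolding transl_weight_def e using d by simp
  have p: "par (of_real t) (par (of_real s) z) = par (of_real (s + t)) z"
    unfolding par_def[of "of_real t"] e unfolding par_def using d by simp
  have "ev (transl s (transl t x)) z
      = transl_weight s z * transl_weight t (par (of_real s) z) * ev x (par (of_real t) (par (of_real s) z))"
    using assms z pz by (simp add: ev_transl)
  then show "ev (transl s (transl t x)) z = ev (transl (s + t) x) z"
    using assms z by (simp add: w p ev_transl)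
qed

text \<open>Multiplication by p + q z acts on coefficients as p plus q times the shift. This clears
  the denominators of the matrix columns of \<open>transl\<close>.\<close>

lemma sums_mult_linear:
  fixes f :: "nat \<Rightarrow> complex"
  assumes "(\<lambda>n. f n * z ^ n) sums S"
  shows "(\<lambda>n. (p * f n + q * (case n of 0 \<Rightarrow> 0 | Suc k \<Rightarrow> f k)) * z ^ n) sums ((p + q * z) * S)"
proof -
  have "(\<lambda>n. (case Suc n of 0 \<Rightarrow> 0 | Suc k \<Rightarrow> f k) * z ^ Suc n) sums (z * S)"
    using sums_mult[OF assms, of z] by (simp add: mult_ac)
  then have "(\<lambda>n. (case n of 0 \<Rightarrow> 0 | Suc k \<Rightarrow> f k) * z ^ n) sums (z * S)"
    by (subst (asm) sums_Suc_iff) simp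
  from sums_add[OF sums_mult[OF assms, of p] sums_mult[OF this, of q]] show ?thesis
    by (simp add: algebra_simps)
qed

text \<open>The matrix of \<open>transl s\<close> has the generating function
  \<open>1 / (1 + s - s z - s w - (1 - s) z w)\<close>, which is symmetric; the recursion below expresses this.\<close>

lemma transl_matrix:
  fixes s :: real and M :: "nat \<Rightarrow> nat \<Rightarrow> complex"
  assumes s: "0 \<le> s"
  defines "M \<equiv> \<lambda>n k. coef (transl s (basis n 1)) k"
  shows transl_matrix_0_0: "(1 + s) * M 0 0 = 1"
    and transl_matrix_0_Suc: "(1 + s) * M 0 (Suc k) = s * M 0 k"
    and transl_matrix_Suc_0: "(1 + s) * M (Suc n) 0 = s * M n 0"
    and transl_matrix_Suc_Suc: "(1 + s) * M (Suc n) (Suc k) = s * M (Suc n) k + s * M n (Suc k) + (1 - s) * M n k"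
proof -
  let ?m = "transl_weight s" and ?\<tau> = "par (of_real s)"
  have ev: "ev (transl s (basis n 1)) z = ?m z * ?\<tau> z ^ n" if "z \<in> ball 0 1" for n z
  proof -
    have "?\<tau> z \<in> ball 0 1" using that s by (intro par_in_disc) auto
    then show ?thesis by (simp only: ev_transl[OF s that] ev_basis mult_1_left)
  qed
  have sums: "(\<lambda>k. M n k * z ^ k) sums (?m z * ?\<tau> z ^ n)" if "z \<in> ball 0 1" for n z
    unfolding M_def ev[OF that, symmetric] by (rule ev_sums[OF that])
  have d: "1 + of_real s * (1 - z) \<noteq> 0" if "z \<in> ball 0 1" for z :: complex
    using par_denom[OF that, of "of_real s"] s by simp
  \<comment> \<open>The factor 1 + s - s z is the common denominator of the weight and of
    \<open>par\<close>. It turns the weight into 1 and \<open>par\<close> into s + (1 - s) z, so the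
    column n + 1 times this factor is the column n times that linear function.\<close>
  have lin: "((1 + of_real s) + (- of_real s) * z) * ?m z = 1"
    and lin\<tau>: "((1 + of_real s) + (- of_real s) * z) * ?\<tau> z = of_real s + of_real (1 - s) * z"
    if "z \<in> ball 0 1" for z :: complex
    using d[OF that] by (simp_all add: transl_weight_def par_def field_simps)
  let ?N = "\<lambda>n k. (1 + of_real s) * M n k + (- of_real s) * (case k of 0 \<Rightarrow> 0 | Suc j \<Rightarrow> M n j)"
  let ?R = "\<lambda>n k. of_real s * M n k + of_real (1 - s) * (case k of 0 \<Rightarrow> 0 | Suc j \<Rightarrow> M n j)"
  have N0: "?N 0 k = (if k = 0 then 1 else 0)" for k
  proof (rule power_series_unique[of "?N 0" "\<lambda>_. 1"])
    fix z :: complex assume z: "z \<in> ball 0 1"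
    have "(\<lambda>k. ?N 0 k * z ^ k) sums (((1 + of_real s) + (- of_real s) * z) * (?m z * ?\<tau> z ^ 0))"
      by (rule sums_mult_linear[OF sums[OF z]])
    then show "(\<lambda>k. ?N 0 k * z ^ k) sums 1" unfolding power_0 mult_1_right lin[OF z] .
    have "(\<lambda>k. if k = 0 then z ^ k else 0) sums z ^ 0" by (rule sums_single)
    moreover have "(\<lambda>k. (if k = 0 then 1 else 0) * z ^ k) = (\<lambda>k. if k = 0 then z ^ k else 0)" by auto
    ultimately show "(\<lambda>k. (if k = 0 then 1 else 0) * z ^ k) sums 1" by simp
  qed
  have NS: "?N (Suc n) k = ?R n k" for n k
  proof (rule power_series_unique)
    fix z :: complex assume z: "z \<in> ball 0 1"
    show "(\<lambda>k. ?N (Suc n) k * z ^ k) sums (((1 + of_real s) + (- of_real s) * z) * (?m z * ?\<tau> z ^ Suc n))"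
      by (rule sums_mult_linear[OF sums[OF z]])
    have eq: "((1 + of_real s) + (- of_real s) * z) * (?m z * ?\<tau> z ^ Suc n)
        = (of_real s + of_real (1 - s) * z) * (?m z * ?\<tau> z ^ n)"
      unfolding lin\<tau>[OF z, symmetric] by (simp only: power_Suc mult_ac)
    show "(\<lambda>k. ?R n k * z ^ k) sums (((1 + of_real s) + (- of_real s) * z) * (?m z * ?\<tau> z ^ Suc n))"
      unfolding eq by (rule sums_mult_linear[OF sums[OF z]])
  qed
  show "(1 + s) * M 0 0 = 1" using N0[of 0] by simp
  show "(1 + s) * M 0 (Suc k) = s * M 0 k" using N0[of "Suc k"] by (simp add: algebra_simps)
  show "(1 + s) * M (Suc n) 0 = s * M n 0" using NS[of n 0] by simp
  show "(1 + s) * M (Suc n) (Suc k) = s * M (Suc n) k + s * M n (Suc k) + (1 - s) * M n k"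
    using NS[of n "Suc k"] by (simp add: algebra_simps)
qed

text \<open>The recursion and its boundary cases have real coefficients and are invariant under
  exchanging n and k. The matrix and its conjugate transpose therefore obey the same recursion,
  which determines every entry because 1 + s is nonzero.\<close>

lemma transl_matrix_hermitian:
  assumes s: "0 \<le> s"
  shows "coef (transl s (basis n 1)) k = cnj (coef (transl s (basis k 1)) n)"
proof -
  let ?M = "\<lambda>n k. coef (transl s (basis n 1)) k"
  note M = transl_matrix[OF s]
  have cancel: "x = y" if "(1 + s) * x = (1 + s) * y" for x y :: complex
  proof -
    have "1 + complex_of_real s \<noteq> 0" using s by (simp add: complex_eq_iff)
    then show ?thesis using that by simp
  qed
  have cM: "(1 + s) * cnj (?M n k) = cnj ((1 + s) * ?M n k)" for n k by simp
  have 1: "?M 0 0 = cnj (?M 0 0)"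
    by (rule cancel) (simp only: cM M(1) complex_cnj_one)
  have 2: "?M 0 k = cnj (?M k 0)" for k
  proof (induction k)
    case (Suc k)
    show ?case
    proof (rule cancel)
      have "(1 + s) * cnj (?M (Suc k) 0) = cnj (s * ?M k 0)" unfolding cM M(3) ..
      also have "\<dots> = s * cnj (?M k 0)" by simp
      also have "\<dots> = (1 + s) * ?M 0 (Suc k)" unfolding M(2) Suc ..
      finally show "(1 + s) * ?M 0 (Suc k) = (1 + s) * cnj (?M (Suc k) 0)" ..
    qed
  qed (rule 1)
  show ?thesis
  proof (induction n arbitrary: k)
    case 0
    show ?case by (rule 2)
  next
    case (Suc n)
    note IHn = Suc
    show ?case
    proof (induction k)
      case 0
      show ?case using 2[of "Suc n"] by simp
    next
      case (Suc k)
      show ?case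
      proof (rule cancel)
        have "(1 + s) * cnj (?M (Suc k) (Suc n)) = cnj (s * ?M (Suc k) n + s * ?M k (Suc n) + (1 - s) * ?M k n)"
          unfolding cM M(4) ..
        also have "\<dots> = s * cnj (?M k (Suc n)) + s * cnj (?M (Suc k) n) + (1 - s) * cnj (?M k n)" by simp
        also have "\<dots> = (1 + s) * ?M (Suc n) (Suc k)"
          unfolding M(4) Suc IHn[of "Suc k"] IHn[of k] ..
        finally show "(1 + s) * ?M (Suc n) (Suc k) = (1 + s) * cnj (?M (Suc k) (Suc n))" ..
      qed
    qed
  qed
qed

lemma transl_symmetric:
  assumes "0 \<le> s"
  shows "inner (transl s x) y = inner x (transl s y)"
proof (rule symmetric_operatorI)
  show "transl s (basis n c) = cscale c (transl s (basis n 1))" for n c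
    unfolding transl_cscale[OF assms, symmetric]
    by (rule arg_cong[where f = "transl s"]) (auto intro!: l2_eqI simp: cscale.rep_eq coef_basis)
qed (rule bounded_linear_transl[OF assms] transl_matrix_hermitian[OF assms])+

text \<open>By the semigroup law the translation by 2 s is the square of the symmetric operator
  \<open>transl s\<close>, which commutes with c. The quadratic form is thus Re c times a
  nonnegative number, so the numerical range of the translation lies on the nonnegative real
  axis.\<close>

lemma inner_cscale_transl:
  assumes "0 \<le> s"
  shows "inner (cscale c (transl (2 * s) x)) x = Re c * (norm (transl s x))\<^sup>2"
proof -
  have "cscale c (transl (2 * s) x) = transl s (cscale c (transl s x))"
    unfolding transl_cscale[OF assms] transl_transl[OF assms assms] mult_2 ..
  then have "inner (cscale c (transl (2 * s) x)) x = inner (cscale c (transl s x)) (transl s x)"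
    using transl_symmetric[OF assms] by simp
  then show ?thesis by (simp add: inner_cscale_self)
qed

section \<open>The rescaled operator\<close>

lemma square_integral_le:
  fixes f :: "real \<Rightarrow> real"
  assumes "continuous_on {0..1} f"
  shows "(integral {0..1} f)\<^sup>2 \<le> integral {0..1} (\<lambda>t. (f t)\<^sup>2)"
proof -
  define m where "m = integral {0..1} f"
  have f: "(f has_integral m) {0..1}"
    unfolding m_def using assms by (intro integrable_integral integrable_continuous_real)
  have f2: "((\<lambda>t. (f t)\<^sup>2) has_integral integral {0..1} (\<lambda>t. (f t)\<^sup>2)) {0..1}"
    using assms by (intro integrable_integral integrable_continuous_real continuous_intros)
  have c: "((\<lambda>t::real. m\<^sup>2) has_integral m\<^sup>2) {0..1}"
    using has_integral_const_real[of "m\<^sup>2" 0 1] by simp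
  \<comment> \<open>The claim is the nonnegativity of the variance of f.\<close>
  have "((\<lambda>t. (f t)\<^sup>2 - 2 * m * f t + m\<^sup>2) has_integral
      integral {0..1} (\<lambda>t. (f t)\<^sup>2) - 2 * m * m + m\<^sup>2) {0..1}"
    by (intro has_integral_add has_integral_diff f2 c has_integral_mult_right f)
  moreover have "(\<lambda>t. (f t)\<^sup>2 - 2 * m * f t + m\<^sup>2) = (\<lambda>t. (f t - m)\<^sup>2)"
    by (simp add: fun_eq_iff power2_eq_square algebra_simps)
  ultimately have "((\<lambda>t. (f t - m)\<^sup>2) has_integral
      integral {0..1} (\<lambda>t. (f t)\<^sup>2) - 2 * m * m + m\<^sup>2) {0..1}" by (simp only:)
  from has_integral_nonneg[OF this zero_le_power2]
  show ?thesis by (simp add: m_def power2_eq_square)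
qed

text \<open>The normalised Cauchy kernels for \<open>\<delta>\<close> and for 0 differ by \<delta> /
  (\<zeta> - \<delta>), of modulus at most 2 |\<delta>| / r because |\<delta>| \<le> r / 2. The
  squared form is kept since the bound is integrated over circles afterwards.\<close>

lemma holomorphic_increment_le:
  assumes g: "g holomorphic_on cball 0 r" and r: "0 < r" and \<delta>: "cmod \<delta> \<le> r / 2"
  shows "(cmod (g \<delta> - g 0))\<^sup>2 \<le> (2 * cmod \<delta> / r)\<^sup>2 * integral {0..1} (\<lambda>t. (cmod (g (circlepath 0 r t)))\<^sup>2)"
proof -
  let ?c = "circlepath 0 r" and ?k = "2 * cmod \<delta> / r"
  have cg: "continuous_on (cball 0 r) g" and hg: "g holomorphic_on ball 0 r"
    using g by (auto intro: holomorphic_on_imp_continuous_on elim: holomorphic_on_subset)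
  have cont: "continuous_on {0..1} (\<lambda>t. g (?c t))"
    using r by (intro continuous_on_compose2[OF cg] continuous_intros) auto
  have ne: "?c t \<noteq> 0" "?c t - \<delta> \<noteq> 0" for t
  proof -
    have n: "cmod (?c t) = r" using r by simp
    show "?c t \<noteq> 0" by (metis n norm_zero r less_irrefl)
    have "cmod \<delta> < r" using r \<delta> by simp
    then show "?c t - \<delta> \<noteq> 0" by (metis n eq_iff_diff_eq_0 less_irrefl)
  qed
  have "((\<lambda>t. g (?c t) * (?c t / (?c t - \<delta>)) - g (?c t) * (?c t / (?c t - 0))) has_integral g \<delta> - g 0) {0..1}"
    using r \<delta> by (intro has_integral_diff Cauchy_circle_mean cg hg) auto
  then have I: "integral {0..1} (\<lambda>t. g (?c t) * (?c t / (?c t - \<delta>)) - g (?c t) * (?c t / (?c t - 0))) = g \<delta> - g 0"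
    and int: "(\<lambda>t. g (?c t) * (?c t / (?c t - \<delta>)) - g (?c t) * (?c t / (?c t - 0))) integrable_on {0..1}"
    by (auto simp: integral_unique)
  have "cmod (g \<delta> - g 0) \<le> integral {0..1} (\<lambda>t. ?k * cmod (g (?c t)))"
    unfolding I[symmetric]
  proof (rule integral_norm_bound_integral[OF int])
    show "(\<lambda>t. ?k * cmod (g (?c t))) integrable_on {0..1}"
      by (intro integrable_continuous_real continuous_intros cont)
    fix t :: real
    have e: "g (?c t) * (?c t / (?c t - \<delta>)) - g (?c t) * (?c t / (?c t - 0)) = g (?c t) * (\<delta> / (?c t - \<delta>))"
      using ne[of t] by (simp add: field_simps)
    have "r / 2 \<le> cmod (?c t - \<delta>)" using norm_triangle_ineq2[of "?c t" \<delta>] r \<delta> by simp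
    then have "cmod \<delta> / cmod (?c t - \<delta>) \<le> cmod \<delta> / (r / 2)"
      using r by (intro divide_left_mono mult_pos_pos) auto
    also have "\<dots> = ?k" by simp
    finally have "cmod (g (?c t)) * (cmod \<delta> / cmod (?c t - \<delta>)) \<le> ?k * cmod (g (?c t))"
      by (subst mult.commute[of ?k]) (intro mult_left_mono norm_ge_zero)
    then show "norm (g (?c t) * (?c t / (?c t - \<delta>)) - g (?c t) * (?c t / (?c t - 0))) \<le> ?k * cmod (g (?c t))"
      unfolding e norm_mult norm_divide .
  qed
  then have "cmod (g \<delta> - g 0) \<le> ?k * integral {0..1} (\<lambda>t. cmod (g (?c t)))" by simp
  from power_mono[OF this norm_ge_zero, of 2]
  have "(cmod (g \<delta> - g 0))\<^sup>2 \<le> ?k\<^sup>2 * (integral {0..1} (\<lambda>t. cmod (g (?c t))))\<^sup>2"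
    by (simp only: power_mult_distrib)
  also have "\<dots> \<le> ?k\<^sup>2 * integral {0..1} (\<lambda>t. (cmod (g (?c t)))\<^sup>2)"
    by (intro mult_left_mono square_integral_le continuous_intros cont) auto
  finally show ?thesis .
qed

text \<open>The conjugate of \<open>z \<mapsto> z\<^sup>2 / 2 + 1 / 2\<close> by the contraction \<open>z \<mapsto> 1 - 2 s (1 - z)\<close>.\<close>

definition qmap :: "real \<Rightarrow> complex \<Rightarrow> complex" where
  "qmap s z = z + of_real s * (1 - z)\<^sup>2"

lemma qmap_holomorphic: "qmap s holomorphic_on A"
  unfolding qmap_def[abs_def] by (intro holomorphic_intros)

text \<open>With u = 1 - z one has 1 - \<open>qmap s z\<close> = u (1 - s u), and partial fractions
  give 1 / (u (1 - s u)) = 1 / u + s / (1 - s u). So \<open>qmap\<close> is a translation whose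
  parameter s + \<open>\<delta>\<close> depends on z, with \<open>\<delta>\<close> of order s^2 as
  |u| \<le> 2.\<close>

lemma qmap_eq_par:
  assumes s: "0 < s" "s \<le> 1 / 16" and z: "z \<in> ball 0 1"
  defines "\<delta> \<equiv> of_real s * (of_real s * (1 - z)) / (1 - of_real s * (1 - z))"
  shows "qmap s z = par (of_real s + \<delta>) z" "cmod \<delta> \<le> 4 * s\<^sup>2"
proof -
  have u: "cmod (1 - z) \<le> 2" using norm_triangle_ineq4[of 1 z] z by simp
  have su: "cmod (of_real s * (1 - z)) \<le> 2 * s"
    using u s by (simp add: norm_mult)
  then have low: "1 / 2 \<le> cmod (1 - of_real s * (1 - z))"
    using norm_triangle_ineq2[of 1 "of_real s * (1 - z)"] s by simp
  then have ne: "1 - of_real s * (1 - z) \<noteq> 0" by auto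
  have "1 + (of_real s + \<delta>) * (1 - z) = 1 / (1 - of_real s * (1 - z))"
    unfolding \<delta>_def using ne by (simp add: field_simps)
  then have "par (of_real s + \<delta>) z = 1 - (1 - z) * (1 - of_real s * (1 - z))"
    by (simp add: par_def)
  then show "qmap s z = par (of_real s + \<delta>) z"
    by (simp add: qmap_def power2_eq_square algebra_simps)
  have "cmod \<delta> = s * cmod (of_real s * (1 - z)) / cmod (1 - of_real s * (1 - z))"
    unfolding \<delta>_def using s by (simp add: norm_mult norm_divide)
  also have "\<dots> \<le> s * (2 * s) / (1 / 2)"
    using su low s by (intro frac_le mult_left_mono mult_nonneg_nonneg) auto
  finally show "cmod \<delta> \<le> 4 * s\<^sup>2" by (simp add: power2_eq_square)
qed

lemma Re_add_nonneg:
  assumes "cmod \<delta> \<le> s" shows "0 \<le> Re (of_real s + \<delta>)"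
  using assms abs_Re_le_cmod[of \<delta>] by simp

lemma four_square_le:
  fixes s :: real
  assumes "0 < s" "s \<le> 1 / 16" shows "4 * s\<^sup>2 \<le> s / 4"
  using mult_left_mono[of s "1 / 16" s] assms by (simp add: power2_eq_square)

lemma qmap_in_disc:
  assumes "0 < s" "s \<le> 1 / 16" "z \<in> ball 0 1" shows "qmap s z \<in> ball 0 1"
proof -
  have "cmod (of_real s * (of_real s * (1 - z)) / (1 - of_real s * (1 - z))) \<le> s"
    using qmap_eq_par(2)[OF assms] four_square_le[OF assms(1,2)] assms(1) by linarith
  from Re_add_nonneg[OF this] show ?thesis
    unfolding qmap_eq_par(1)[OF assms] by (rule par_in_disc[OF assms(3)])
qed

text \<open>The parameter error \<open>\<delta>\<close> varies with z, so the difference is not one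
  of two fixed translations. For fixed z, f(par (s + \<zeta>) z) is holomorphic in \<zeta> on
  |\<zeta>| \<le> s / 2, and |\<delta>| \<le> 4 s^2 \<le> s / 4. The increment estimate costs a
  factor at most 16 s and leaves a mean over fixed parameters on the circle |\<zeta>| = s / 2, each
  of which is covered by subordination.\<close>

lemma H2_norm_qmap_diff_le:
  assumes f: "f \<in> H2" and s: "0 < s" "s \<le> 1 / 16"
  shows "(\<lambda>z. f (qmap s z) - f (par (of_real s) z)) \<in> H2"
    "H2_norm (\<lambda>z. f (qmap s z) - f (par (of_real s) z)) \<le> 32 * s * H2_norm f"
proof -
  let ?h = "\<lambda>z. f (qmap s z) - f (par (of_real s) z)" and ?d = "circlepath 0 (s / 2)"
  define N where "N = H2_norm f"
  have N: "0 \<le> N" using H2_norm_nonneg[OF f] by (simp add: N_def)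
  note hf = H2_holomorphic[OF f]
  have comp: "(\<lambda>z. f (w z)) holomorphic_on ball 0 1"
    if "w holomorphic_on ball 0 1" "\<And>z. z \<in> ball 0 1 \<Longrightarrow> w z \<in> ball 0 1" for w
    using holomorphic_on_compose_gen[OF that(1) hf image_subsetI, OF that(2)] by (simp add: o_def)
  have hh: "?h holomorphic_on ball 0 1"
    using s by (intro holomorphic_intros comp qmap_holomorphic par_holomorphic qmap_in_disc par_in_disc) auto
  have Re: "0 \<le> Re (of_real s + \<zeta>)" if "cmod \<zeta> \<le> s / 2" for \<zeta>
    using that s by (intro Re_add_nonneg) auto
  have pt: "(cmod (?h z))\<^sup>2 \<le> integral {0..1} (\<lambda>y. 256 * s\<^sup>2 * (cmod (f (par (of_real s + ?d y) z)))\<^sup>2)"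
    if z: "z \<in> ball 0 1" for z
  proof -
    define \<delta> where "\<delta> = of_real s * (of_real s * (1 - z)) / (1 - of_real s * (1 - z))"
    define g where "g \<zeta> = f (par (of_real s + \<zeta>) z)" for \<zeta>
    have q: "qmap s z = par (of_real s + \<delta>) z" and \<delta>: "cmod \<delta> \<le> 4 * s\<^sup>2"
      using qmap_eq_par[OF s z] by (simp_all add: \<delta>_def)
    have "(\<lambda>\<zeta>. par (of_real s + \<zeta>) z) holomorphic_on cball 0 (s / 2)"
      unfolding par_def using par_denom[OF z Re] by (intro holomorphic_intros) auto
    moreover have "(\<lambda>\<zeta>. par (of_real s + \<zeta>) z) ` cball 0 (s / 2) \<subseteq> ball 0 1"
      by (intro image_subsetI par_in_disc[OF z Re]) (simp only: mem_cball_0)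
    ultimately have hg: "g holomorphic_on cball 0 (s / 2)"
      using holomorphic_on_compose_gen[OF _ hf] unfolding g_def by (simp only: o_def)
    from holomorphic_increment_le[OF this, of \<delta>]
    have "(cmod (g \<delta> - g 0))\<^sup>2 \<le> (2 * cmod \<delta> / (s / 2))\<^sup>2 * integral {0..1} (\<lambda>t. (cmod (g (?d t)))\<^sup>2)"
      using s \<delta> four_square_le[OF s] by auto
    also have "\<dots> \<le> (16 * s)\<^sup>2 * integral {0..1} (\<lambda>t. (cmod (g (?d t)))\<^sup>2)"
    proof (intro mult_right_mono power_mono)
      show "2 * cmod \<delta> / (s / 2) \<le> 16 * s"
        using \<delta> s by (simp add: field_simps power2_eq_square)
      show "0 \<le> integral {0..1} (\<lambda>t. (cmod (g (?d t)))\<^sup>2)"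
        by (rule Henstock_Kurzweil_Integration.integral_nonneg)
           (use s in \<open>auto intro!: integrable_continuous_real continuous_intros
             continuous_on_compose2[OF holomorphic_on_imp_continuous_on[OF hg]]\<close>)
    qed (use s in auto)
    finally show ?thesis by (simp add: g_def q power_mult_distrib)
  qed
  have cont: "continuous_on ({0..1} \<times> {0..1})
      (\<lambda>(x, y). 256 * s\<^sup>2 * (cmod (f (par (of_real s + ?d y) (circlepath 0 r x))))\<^sup>2)"
    if r: "0 < r" "r < 1" for r
  proof -
    have b: "circlepath 0 r x \<in> ball 0 1" for x using r by simp
    have D: "0 \<le> Re (of_real s + ?d y)" for y using s by (intro Re) simp
    show ?thesis
      unfolding case_prod_unfold
    proof (intro continuous_intros continuous_on_compose2[OF holomorphic_on_imp_continuous_on[OF hf]])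
      show "continuous_on ({0..1} \<times> {0..1}) (\<lambda>p. par (of_real s + ?d (snd p)) (circlepath 0 r (fst p)))"
        unfolding par_def using par_denom[OF b D] by (intro continuous_intros) auto
      show "(\<lambda>p. par (of_real s + ?d (snd p)) (circlepath 0 r (fst p))) ` ({0..1} \<times> {0..1}) \<subseteq> ball 0 1"
        using par_in_disc[OF b D] by blast
    qed
  qed
  have inner_bd: "circle_mean (\<lambda>z. f (par (of_real s + ?d y) z)) r \<le> 2 * N\<^sup>2"
    if r: "0 < r" "r < 1" for r y
  proof -
    let ?\<kappa> = "of_real s + ?d y"
    have D: "0 \<le> Re ?\<kappa>" using s by (intro Re) simp
    note L = littlewood_subordination[OF f par_holomorphic[OF D] par_in_disc[OF _ D]]
    \<comment> \<open>As s \<le> 1/16, the parameter has modulus at most 3 s / 2 \<le> 3/32. This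
      keeps the value of \<open>par\<close> at 0 below 1/3, where the subordination factor is (1 +
      1/3) / (1 - 1/3) = 2.\<close>
    have k1: "cmod ?\<kappa> \<le> 3 / 32" using norm_triangle_ineq[of "of_real s" "?d y"] s by simp
    then have k2: "29 / 32 \<le> cmod (1 + ?\<kappa>)" using norm_diff_ineq[of 1 ?\<kappa>] by simp
    then have "1 + ?\<kappa> \<noteq> 0" by auto
    then have "cmod (par ?\<kappa> 0) = cmod ?\<kappa> / cmod (1 + ?\<kappa>)" by (simp add: par_zero norm_divide)
    also have "\<dots> \<le> (3 / 32) / (29 / 32)" using k1 k2 by (intro frac_le) auto
    finally have c: "cmod (par ?\<kappa> 0) \<le> 1 / 3" by simp
    then have "(1 + cmod (par ?\<kappa> 0)) / (1 - cmod (par ?\<kappa> 0)) \<le> 2"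
      by (subst pos_divide_le_eq) auto
    then have sq: "sqrt ((1 + cmod (par ?\<kappa> 0)) / (1 - cmod (par ?\<kappa> 0))) \<le> sqrt 2" by simp
    have "H2_norm (\<lambda>z. f (par ?\<kappa> z)) \<le> sqrt 2 * N"
      using L(2) mult_right_mono[OF sq N] unfolding N_def by linarith
    from power_mono[OF this H2_norm_nonneg[OF L(1)], of 2]
    have "(H2_norm (\<lambda>z. f (par ?\<kappa> z)))\<^sup>2 \<le> 2 * N\<^sup>2" by (simp add: power_mult_distrib)
    then show ?thesis using circle_mean_le_H2_norm[OF L(1), of r] r by simp
  qed
  have "circle_mean ?h r \<le> (32 * s * N)\<^sup>2" if r: "0 < r" "r < 1" for r
  proof -
    have b: "circlepath 0 r x \<in> ball 0 1" for x using r by simp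
    have "circle_mean ?h r \<le> integral {0..1} (\<lambda>y::real. 512 * s\<^sup>2 * N\<^sup>2)"
      unfolding circle_mean_def
    proof (rule integral_le_swap_bound[OF _ cont[OF r]])
      show "(\<lambda>t. (cmod (?h (circlepath 0 r t)))\<^sup>2) integrable_on {0..1}"
        using r by (intro circle_mean_integrable[OF hh]) auto
      show "(cmod (?h (circlepath 0 r x)))\<^sup>2
         \<le> integral {0..1} (\<lambda>y. 256 * s\<^sup>2 * (cmod (f (par (of_real s + ?d y) (circlepath 0 r x))))\<^sup>2)" for x
        by (rule pt[OF b])
      show "integral {0..1} (\<lambda>x. 256 * s\<^sup>2 * (cmod (f (par (of_real s + ?d y) (circlepath 0 r x))))\<^sup>2)
         \<le> 512 * s\<^sup>2 * N\<^sup>2" for y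
        using mult_left_mono[OF inner_bd[OF r, of y], of "256 * s\<^sup>2"]
        unfolding circle_mean_def by simp
    qed auto
    also have "\<dots> = 512 * s\<^sup>2 * N\<^sup>2" by simp
    also have "\<dots> \<le> (32 * s * N)\<^sup>2"
      using mult_nonneg_nonneg[OF zero_le_power2 zero_le_power2, of s N] by (simp add: power_mult_distrib)
    finally show ?thesis .
  qed
  from H2_I_circle_mean[OF hh _ this] show "?h \<in> H2" "H2_norm ?h \<le> 32 * s * H2_norm f"
    using s N unfolding N_def by auto
qed

text \<open>With q = \<open>qmap s\<close>, p = \<open>par s\<close> and w the translation weight,
  the difference m (x o q) - a w (x o p) splits into (m - a) (x o q), a (x o q - x o p) and a (1 -
  w) (x o p). They contribute 2 e, 32 |a| s and 4 |a| s.\<close>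

lemma wop_qmap_near_transl:
  assumes m: "m holomorphic_on ball 0 1" "\<And>z. z \<in> ball 0 1 \<Longrightarrow> cmod (m z - a) \<le> e"
    and s: "0 < s" "s \<le> 1 / 16"
  shows "norm (wop m (qmap s) x - cscale a (transl s x)) \<le> (2 * e + 36 * cmod a * s) * norm x"
proof -
  let ?p = "par (of_real s)" and ?w = "transl_weight s"
  have s0: "0 \<le> s" using s by simp
  have e0: "0 \<le> e" using order_trans[OF norm_ge_zero m(2)[of 0]] by simp
  have q: "qmap s holomorphic_on ball 0 1" "\<And>z. z \<in> ball 0 1 \<Longrightarrow> qmap s z \<in> ball 0 1"
    by (rule qmap_holomorphic, rule qmap_in_disc[OF s])
  have p: "?p holomorphic_on ball 0 1" "\<And>z. z \<in> ball 0 1 \<Longrightarrow> ?p z \<in> ball 0 1"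
    using s by (auto intro!: par_holomorphic par_in_disc[unfolded mem_ball_0])
  have mb: "cmod (m z) \<le> cmod a + e" if "z \<in> ball 0 1" for z
    using norm_triangle_ineq[of "m z - a" a] m(2)[OF that] by simp
  have u: "cmod (1 - ?w z) \<le> 2 * s" if z: "z \<in> ball 0 1" for z
  proof -
    have d: "1 + of_real s * (1 - z) \<noteq> 0" using par_denom[OF z, of "of_real s"] s by simp
    then have "1 - ?w z = of_real s * (1 - z) * ?w z"
      by (simp add: transl_weight_def field_simps)
    then have "cmod (1 - ?w z) = s * cmod (1 - z) * cmod (?w z)"
      using s by (simp add: norm_mult)
    also have "\<dots> \<le> s * 2 * 1"
      using norm_transl_weight_le[OF s0 z] norm_triangle_ineq4[of 1 z] z s
      by (intro mult_mono) auto
    finally show ?thesis by simp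
  qed
  have qn: "sqrt ((1 + cmod (qmap s 0)) / (1 - cmod (qmap s 0))) \<le> 2"
  proof -
    have "(1 + s) / (1 - s) \<le> 4" using s by (simp add: field_simps)
    then have "sqrt ((1 + s) / (1 - s)) \<le> sqrt (2\<^sup>2)" by (intro real_sqrt_le_mono) simp
    then show ?thesis using s by (simp add: qmap_def)
  qed
  have pn: "sqrt ((1 + cmod (?p 0)) / (1 - cmod (?p 0))) \<le> 2"
  proof -
    have "1 + of_real s \<noteq> (0::complex)" using s by (simp add: complex_eq_iff)
    then have "?p 0 = of_real (s / (1 + s))" by (simp add: par_zero)
    then have c: "cmod (?p 0) = s / (1 + s)" using s by (simp only: norm_of_real) simp
    have "(1 + cmod (?p 0)) / (1 - cmod (?p 0)) = 1 + 2 * s"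
      unfolding c using s by (simp add: field_simps)
    also have "\<dots> \<le> 2\<^sup>2" using s by simp
    finally have "sqrt ((1 + cmod (?p 0)) / (1 - cmod (?p 0))) \<le> sqrt (2\<^sup>2)" by (rule real_sqrt_le_mono)
    then show ?thesis by simp
  qed
  define X1 where "X1 = wop (\<lambda>z. m z - a) (qmap s) x"
  define X2 where "X2 = of_fun (\<lambda>z. ev x (qmap s z) - ev x (?p z))"
  define X3 where "X3 = wop (\<lambda>z. 1 - ?w z) ?p x"
  note D = H2_norm_qmap_diff_le[OF ev_in_H2 s, of x]
  have m1: "(\<lambda>z. m z - a) holomorphic_on ball 0 1" by (intro holomorphic_intros m)
  have w1: "(\<lambda>z. 1 - ?w z) holomorphic_on ball 0 1"
    by (intro holomorphic_intros transl_weight_holomorphic s0)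
  have s2: "0 \<le> 2 * s" using s by simp
  have ae0: "0 \<le> cmod a + e" using e0 by simp
  have eq: "wop m (qmap s) x - cscale a (transl s x) = X1 + cscale a X2 + cscale a X3"
  proof -
    have "wop m (qmap s) x = X1 + cscale a X2 + cscale a X3 + cscale a (transl s x)"
    proof (rule ev_eqI)
      fix z :: complex assume z: "z \<in> ball 0 1"
      have E1: "ev (wop m (qmap s) x) z = m z * ev x (qmap s z)"
        by (rule ev_wop[OF m(1) ae0 mb q z])
      have E2: "ev X1 z = (m z - a) * ev x (qmap s z)"
        unfolding X1_def by (rule ev_wop[OF m1 e0 m(2) q z])
      have E3: "ev X3 z = (1 - ?w z) * ev x (?p z)"
        unfolding X3_def by (rule ev_wop[OF w1 s2 u p z])
      have E4: "ev X2 z = ev x (qmap s z) - ev x (?p z)"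
        unfolding X2_def by (rule ev_of_fun[OF D(1) z])
      show "ev (wop m (qmap s) x) z = ev (X1 + cscale a X2 + cscale a X3 + cscale a (transl s x)) z"
        unfolding ev_add[OF z] ev_cscale[OF z] ev_transl[OF s0 z] E1 E2 E3 E4
        by (simp add: algebra_simps)
    qed
    then show ?thesis by (simp add: algebra_simps)
  qed
  have n1: "norm X1 \<le> e * 2 * norm x"
    using norm_wop_le[OF m1 e0 m(2) q, of x] mult_right_mono[OF mult_left_mono[OF qn e0] norm_ge_zero[of x]]
    unfolding X1_def by linarith
  have n2: "norm X2 \<le> 32 * s * norm x"
    unfolding X2_def norm_of_fun[OF D(1)] using D(2) by (simp only: H2_norm_ev)
  have n3: "norm X3 \<le> 2 * s * 2 * norm x"
    using norm_wop_le[OF w1 s2 u p, of x] mult_right_mono[OF mult_left_mono[OF pn s2] norm_ge_zero[of x]]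
    unfolding X3_def by linarith
  have "norm (X1 + cscale a X2 + cscale a X3) \<le> norm X1 + norm (cscale a X2) + norm (cscale a X3)"
    using norm_triangle_ineq[of "X1 + cscale a X2" "cscale a X3"] norm_triangle_ineq[of X1 "cscale a X2"]
    by linarith
  also have "\<dots> \<le> e * 2 * norm x + cmod a * (32 * s * norm x) + cmod a * (2 * s * 2 * norm x)"
    unfolding norm_cscale by (intro add_mono mult_left_mono n1 n2 n3) auto
  also have "\<dots> = (2 * e + 36 * cmod a * s) * norm x" by (simp add: algebra_simps)
  finally show ?thesis unfolding eq .
qed

section \<open>Coercivity off the segment\<close>

lemma disc_contract:
  assumes "0 < \<epsilon>" "\<epsilon> \<le> 1" "z \<in> ball 0 1"
  shows "1 - of_real \<epsilon> * (1 - z) \<in> ball (0::complex) 1"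
proof -
  have "1 - of_real \<epsilon> * (1 - z) = of_real (1 - \<epsilon>) + of_real \<epsilon> * z" by (simp add: algebra_simps)
  then have "cmod (1 - of_real \<epsilon> * (1 - z)) \<le> cmod (of_real (1 - \<epsilon>)) + cmod (of_real \<epsilon> * z)"
    by (simp only: norm_triangle_ineq)
  also have "\<dots> = (1 - \<epsilon>) + \<epsilon> * cmod z"
    unfolding norm_mult norm_of_real using assms by simp
  also have "\<dots> < (1 - \<epsilon>) + \<epsilon> * 1" using assms by (intro add_strict_left_mono mult_strict_left_mono) auto
  finally show ?thesis by simp
qed

text \<open>A line separates l from the compact convex segment, and b is the conjugate of its
  normal. Real parts are affine along the segment, so the margin e needs to be recorded only at the
  endpoints 0 and a.\<close>

lemma segment_separation:
  assumes "\<And>t. 0 \<le> t \<Longrightarrow> t \<le> 1 \<Longrightarrow> l \<noteq> a * complex_of_real t"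
  obtains b e where "0 < e" "e \<le> - Re (b * l)" "e \<le> Re (b * a) - Re (b * l)"
proof -
  have "l \<notin> closed_segment 0 a"
    using assms by (auto simp: closed_segment_def scaleR_conv_of_real mult.commute)
  then obtain c \<beta> where c: "c \<bullet> l < \<beta>" "\<And>x. x \<in> closed_segment 0 a \<Longrightarrow> \<beta> < c \<bullet> x"
    using separating_hyperplane_closed_point[of "closed_segment 0 a" l] by auto
  have i: "c \<bullet> x = Re (cnj c * x)" for x by (simp add: inner_complex_def)
  show thesis
    by (rule that[of "\<beta> - c \<bullet> l" "cnj c"])
       (use c(1) c(2)[of 0] c(2)[of a] in \<open>simp_all add: i\<close>)
qed

text \<open>Multiplied by b, the operator has quadratic form Re (b a) P - Re (b l) N up to small
  errors, where N is the squared norm of x and 0 \<le> P \<le> (1 + s) N; separation makes it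
  coercive. The conclusions are phrased as functional equations on the disc, so that they can be
  transplanted to functions on the horodisc.\<close>

theorem scaled_resolvent:
  fixes \<psi> :: "complex \<Rightarrow> complex"
  assumes \<psi>: "\<psi> \<in> Hinf" "continuous_on (ball 0 1 \<union> {1}) \<psi>"
    and l: "\<And>t. 0 \<le> t \<Longrightarrow> t \<le> 1 \<Longrightarrow> l \<noteq> \<psi> 1 * complex_of_real t"
  obtains s d where "0 < s" "s \<le> 1 / 16" "0 < d"
    "\<And>y. \<exists>x. \<forall>z\<in>ball 0 1. \<psi> (1 - of_real (2 * s) * (1 - z)) * ev x (qmap s z) - l * ev x z = ev y z"
    "\<And>x y. (\<And>z. z \<in> ball 0 1 \<Longrightarrow> \<psi> (1 - of_real (2 * s) * (1 - z)) * ev x (qmap s z) - l * ev x z = ev y z)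
        \<Longrightarrow> d * norm x \<le> norm y"
proof -
  define a where "a = \<psi> 1"
  obtain b e where be: "0 < e" "e \<le> - Re (b * l)" "e \<le> Re (b * a) - Re (b * l)"
    using segment_separation[of l a] l unfolding a_def by blast
  have b0: "b \<noteq> 0" using be by auto
  define B where "B = cmod b"
  have B: "0 < B" using b0 by (simp add: B_def)
  define \<eta> where "\<eta> = e / (8 * B)"
  have \<eta>: "0 < \<eta>" using be(1) B by (simp add: \<eta>_def)
  have hol: "\<psi> holomorphic_on ball 0 1" using \<psi>(1) by (simp add: Hinf_def)
  obtain \<delta> where \<delta>: "0 < \<delta>" "\<And>z. z \<in> ball 0 1 \<Longrightarrow> cmod (z - 1) < \<delta> \<Longrightarrow> cmod (\<psi> z - a) < \<eta>"
    using \<psi>(2) \<eta> unfolding continuous_on_iff a_def dist_norm by (metis UnI1 UnI2 singletonI)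
  \<comment> \<open>The bound \<open>\<delta> / 5\<close> makes 4 s < \<open>\<delta>\<close>, so
    all points 1 - 2 s (1 - z) lie where \<open>\<psi>\<close> is within \<open>\<eta>\<close> of a.
    In 37, the part 36 comes from the comparison with the translation and 1 from the excess in P
    \<le> (1 + s) N. This error and the one from \<open>\<eta>\<close> take e / 4 each, leaving e /
    2; the summand 1 in \<open>cmod a + 1\<close> covers a = 0.\<close>
  define s where "s = min (1 / 16) (min (\<delta> / 5) (e / (4 * (37 * B * (cmod a + 1)))))"
  have den: "0 < 4 * (37 * B * (cmod a + 1))" using B norm_ge_zero[of a] by (intro mult_pos_pos) linarith+
  have s: "0 < s" "s \<le> 1 / 16" "s \<le> \<delta> / 5" "s \<le> e / (4 * (37 * B * (cmod a + 1)))"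
    using \<delta>(1) be(1) den unfolding s_def by auto
  have s0: "0 \<le> s" using s by simp
  define m where "m z = \<psi> (1 - of_real (2 * s) * (1 - z))" for z
  have con: "1 - of_real (2 * s) * (1 - z) \<in> ball (0::complex) 1" if "z \<in> ball 0 1" for z
    using disc_contract[OF _ _ that, of "2 * s"] s by simp
  have hm: "m holomorphic_on ball 0 1"
  proof -
    have "(\<lambda>z. 1 - of_real (2 * s) * (1 - z)) holomorphic_on ball (0::complex) 1" by (intro holomorphic_intros)
    from holomorphic_on_compose_gen[OF this hol image_subsetI, OF con]
    show ?thesis unfolding m_def[abs_def] by (simp only: o_def)
  qed
  have near: "cmod (m z - a) \<le> \<eta>" if z: "z \<in> ball 0 1" for z
  proof -
    have "cmod (1 - of_real (2 * s) * (1 - z) - 1) = 2 * s * cmod (1 - z)"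
      using s by (simp add: norm_mult)
    also have "\<dots> \<le> 2 * s * 2" using norm_triangle_ineq4[of 1 z] z s by (intro mult_left_mono) auto
    also have "\<dots> < \<delta>" using s by simp
    finally show ?thesis using \<delta>(2)[OF con[OF z]] unfolding m_def by (intro less_imp_le)
  qed
  have mb: "cmod (m z) \<le> cmod a + \<eta>" if "z \<in> ball 0 1" for z
    using norm_triangle_ineq[of "m z - a" a] near[OF that] by simp
  have an0: "0 \<le> cmod a + \<eta>" using \<eta> by simp
  note W = wop[OF hm an0 mb qmap_holomorphic qmap_in_disc[OF s(1,2)]]
  define A where "A x = cscale b (wop m (qmap s) x - cscale l x)" for x
  have bA: "bounded_linear A"
    unfolding A_def[abs_def]
    by (intro bounded_linear_compose[OF bounded_linear_cscale] bounded_linear_sub W(3) bounded_linear_cscale)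
  have coercive: "e / 2 * (norm x)\<^sup>2 \<le> inner (A x) x" for x
  proof -
    define N where "N = (norm x)\<^sup>2"
    define P where "P = (norm (transl (s / 2) x))\<^sup>2"
    have N: "0 \<le> N" and P0: "0 \<le> P" by (simp_all add: N_def P_def)
    have P: "P \<le> (1 + s) * N"
      using norm_transl_le[of "s / 2" x] s by (simp add: P_def N_def)
    interpret c: bounded_linear "cscale b" by (rule bounded_linear_cscale)
    let ?E = "wop m (qmap s) x - cscale a (transl s x)"
    have cc: "cscale b (cscale c x) = cscale (b * c) x" for c x
      by (rule l2_eqI) (simp add: cscale.rep_eq mult.assoc)
    have "A x = cscale b ?E + cscale (b * a) (transl s x) - cscale (b * l) x"
      unfolding A_def c.diff cc by simp
    then have I: "inner (A x) x = inner (cscale b ?E) x + Re (b * a) * P - Re (b * l) * N"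
      using inner_cscale_transl[of "s / 2" "b * a" x] s
      by (simp only: inner_add_left inner_diff_left inner_cscale_self N_def P_def) simp
    have "\<bar>inner (cscale b ?E) x\<bar> \<le> norm (cscale b ?E) * norm x" by (rule Cauchy_Schwarz_ineq2)
    also have "\<dots> \<le> B * ((2 * \<eta> + 36 * cmod a * s) * norm x) * norm x"
      unfolding norm_cscale B_def
      by (intro mult_right_mono mult_left_mono wop_qmap_near_transl[OF hm near s(1,2)]) auto
    also have "\<dots> = (2 * B * \<eta> + 36 * B * cmod a * s) * N"
      by (simp add: N_def power2_eq_square algebra_simps)
    finally have err: "- ((2 * B * \<eta> + 36 * B * cmod a * s) * N) \<le> inner (cscale b ?E) x" by linarith
    have AB: "\<bar>Re (b * a)\<bar> \<le> B * cmod a"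
      using abs_Re_le_cmod[of "b * a"] by (simp only: norm_mult B_def)
    \<comment> \<open>If Re (b a) \<ge> 0, only P \<ge> 0 and the margin at the endpoint 0 enter.
      Otherwise the upper bound on P and the margin at the endpoint a do.\<close>
    have main: "Re (b * a) * P \<ge> (Re (b * l) + e) * N - B * cmod a * s * N"
    proof (cases "0 \<le> Re (b * a)")
      case True
      have "(Re (b * l) + e) * N \<le> 0" using be(2) N by (intro mult_nonpos_nonneg) auto
      moreover have "0 \<le> Re (b * a) * P" using True P0 by simp
      moreover have "0 \<le> B * cmod a * s * N" using B s N by simp
      ultimately show ?thesis by linarith
    next
      case False
      have "Re (b * a) * ((1 + s) * N) \<le> Re (b * a) * P"
        using P False by (intro mult_left_mono_neg) auto
      moreover have "(Re (b * l) + e) * N \<le> Re (b * a) * N" using be(3) N by (intro mult_right_mono) auto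
      moreover have "- (B * cmod a) * (s * N) \<le> Re (b * a) * (s * N)"
        using AB s N by (intro mult_right_mono) auto
      ultimately show ?thesis by (simp add: algebra_simps)
    qed
    have "2 * B * \<eta> = e / 4" using B by (simp add: \<eta>_def)
    moreover have "37 * B * cmod a * s \<le> e / 4"
    proof -
      have "37 * B * cmod a * s \<le> 37 * B * (cmod a + 1) * s" using B s by (intro mult_right_mono mult_left_mono) auto
      also have "\<dots> \<le> e / 4" using s(4) den by (simp add: field_simps)
      finally show ?thesis .
    qed
    ultimately have "(2 * B * \<eta> + 37 * B * cmod a * s) * N \<le> (e / 2) * N"
      using N by (intro mult_right_mono) auto
    then show ?thesis
      using I err main unfolding N_def[symmetric] by (simp add: algebra_simps)
  qed
  show thesis
  proof (rule that[of s "e / (2 * B)"])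
    show "0 < s" "s \<le> 1 / 16" by (rule s)+
    show "0 < e / (2 * B)" using be(1) B by simp
    have ev_W: "ev (wop m (qmap s) x) z = m z * ev x (qmap s z)" if z: "z \<in> ball 0 1" for x z
      by (rule ev_wop[OF hm an0 mb qmap_holomorphic qmap_in_disc[OF s(1,2)] z])
    have ev_A: "ev (A x) z = b * (m z * ev x (qmap s z) - l * ev x z)" if z: "z \<in> ball 0 1" for x z
    proof -
      have "A x + cscale b (cscale l x) = cscale b (wop m (qmap s) x)"
        unfolding A_def by (rule l2_eqI) (simp add: cscale.rep_eq plus_l2.rep_eq minus_l2.rep_eq algebra_simps)
      from arg_cong[OF this, of "\<lambda>x. ev x z"]
      show ?thesis unfolding ev_add[OF z] ev_cscale[OF z] ev_W[OF z] by (simp add: algebra_simps)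
    qed
    show "\<exists>x. \<forall>z\<in>ball 0 1. \<psi> (1 - of_real (2 * s) * (1 - z)) * ev x (qmap s z) - l * ev x z = ev y z" for y
    proof -
      obtain x where x: "A x = cscale b y"
        using lax_milgram[OF bA _ coercive, of "cscale b y"] be(1) by auto
      have "b * (m z * ev x (qmap s z) - l * ev x z) = b * ev y z" if z: "z \<in> ball 0 1" for z
        using ev_A[OF z, of x] unfolding x ev_cscale[OF z] ..
      then show ?thesis using b0 unfolding m_def[symmetric] mult_cancel_left by blast
    qed
    fix x y
    assume eq: "\<And>z. z \<in> ball 0 1 \<Longrightarrow> \<psi> (1 - of_real (2 * s) * (1 - z)) * ev x (qmap s z) - l * ev x z = ev y z"
    have "A x = cscale b y"
      by (rule ev_eqI) (simp only: ev_A ev_cscale m_def eq)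
    with coercive_norm_le[OF coercive[of x]] show "e / (2 * B) * norm x \<le> norm y"
      using B by (simp add: norm_cscale B_def[symmetric] field_simps)
  qed
qed

section \<open>Extension from a horodisc to the disc\<close>

lemma H2_lincomb:
  assumes f: "f \<in> H2" and g: "g \<in> H2"
  shows "(\<lambda>z. a * f z + b * g z) \<in> H2"
    "H2_norm (\<lambda>z. a * f z + b * g z) \<le> cmod a * H2_norm f + cmod b * H2_norm g"
proof -
  let ?x = "cscale a (of_fun f) + cscale b (of_fun g)"
  have eq: "ev ?x z = a * f z + b * g z" if "z \<in> ball 0 1" for z
    by (simp only: ev_add[OF that] ev_cscale[OF that] ev_of_fun[OF f that] ev_of_fun[OF g that])
  show "(\<lambda>z. a * f z + b * g z) \<in> H2" by (rule H2_cong(1)[OF ev_in_H2[of ?x] eq])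
  have "H2_norm (\<lambda>z. a * f z + b * g z) = norm ?x"
    using H2_cong(2)[OF ev_in_H2[of ?x] eq] by (simp only: H2_norm_ev)
  also have "\<dots> \<le> norm (cscale a (of_fun f)) + norm (cscale b (of_fun g))" by (rule norm_triangle_ineq)
  finally show "H2_norm (\<lambda>z. a * f z + b * g z) \<le> cmod a * H2_norm f + cmod b * H2_norm g"
    by (simp only: norm_cscale norm_of_fun[OF f] norm_of_fun[OF g])
qed

text \<open>Solutions are chosen separately for each g, without any linearity. Injectivity of T on
  the disc makes the choice linear there and a left inverse.\<close>

lemma H2_invertibleI:
  assumes maps: "\<And>f. f \<in> H2 \<Longrightarrow> T f \<in> H2"
    and lin: "\<And>f g a b z. f \<in> H2 \<Longrightarrow> g \<in> H2 \<Longrightarrow> z \<in> ball 0 1 \<Longrightarrow>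
      T (\<lambda>w. a * f w + b * g w) z = a * T f z + b * T g z"
    and ex: "\<And>g. g \<in> H2 \<Longrightarrow> \<exists>f. f \<in> H2 \<and> H2_norm f \<le> C * H2_norm g \<and> (\<forall>z\<in>ball 0 1. T f z = g z)"
    and inj: "\<And>f z. f \<in> H2 \<Longrightarrow> (\<And>w. w \<in> ball 0 1 \<Longrightarrow> T f w = 0) \<Longrightarrow> z \<in> ball 0 1 \<Longrightarrow> f z = 0"
  shows "H2_invertible T"
proof -
  have "\<forall>g\<in>H2. \<exists>f. f \<in> H2 \<and> H2_norm f \<le> C * H2_norm g \<and> (\<forall>z\<in>ball 0 1. T f z = g z)"
    using ex by blast
  from bchoice[OF this] obtain S
    where S: "\<And>g. g \<in> H2 \<Longrightarrow> S g \<in> H2" "\<And>g. g \<in> H2 \<Longrightarrow> H2_norm (S g) \<le> C * H2_norm g"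
      "\<And>g z. g \<in> H2 \<Longrightarrow> z \<in> ball 0 1 \<Longrightarrow> T (S g) z = g z"
    by blast
  have uniq: "f z = h z" if "f \<in> H2" "h \<in> H2" "\<And>w. w \<in> ball 0 1 \<Longrightarrow> T f w = T h w" "z \<in> ball 0 1" for f h z
  proof -
    have "(\<lambda>w. 1 * f w + (- 1) * h w) \<in> H2" by (rule H2_lincomb(1)) fact+
    moreover have "T (\<lambda>w. 1 * f w + (- 1) * h w) w = 0" if "w \<in> ball 0 1" for w
      unfolding lin[OF \<open>f \<in> H2\<close> \<open>h \<in> H2\<close> that] using \<open>\<And>w. w \<in> ball 0 1 \<Longrightarrow> T f w = T h w\<close>[OF that] by simp
    ultimately have "1 * f z + (- 1) * h z = 0" using \<open>z \<in> ball 0 1\<close> by (rule inj)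
    then show ?thesis by simp
  qed
  show ?thesis
    unfolding H2_invertible_def
  proof (intro exI conjI ballI allI)
    fix f z assume f: "f \<in> H2"
    show "S f \<in> H2" "H2_norm (S f) \<le> C * H2_norm f" by (rule S[OF f])+
    assume z: "z \<in> ball (0::complex) 1"
    show "T (S f) z = f z" by (rule S(3)[OF f z])
    show "S (T f) z = f z"
      by (rule uniq[OF S(1)[OF maps[OF f]] f S(3)[OF maps[OF f]] z])
  next
    fix f g a b z assume f: "f \<in> H2" and g: "g \<in> H2" and z: "z \<in> ball (0::complex) 1"
    have mem: "(\<lambda>w. a * f w + b * g w) \<in> H2" by (rule H2_lincomb(1)[OF f g])
    show "S (\<lambda>w. a * f w + b * g w) z = a * S f z + b * S g z"
    proof (rule uniq[OF _ _ _ z])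
      show "S (\<lambda>w. a * f w + b * g w) \<in> H2" by (rule S(1)[OF mem])
      show "(\<lambda>z. a * S f z + b * S g z) \<in> H2" by (rule H2_lincomb(1)[OF S(1)[OF f] S(1)[OF g]])
      show "T (S (\<lambda>w. a * f w + b * g w)) w = T (\<lambda>z. a * S f z + b * S g z) w" if w: "w \<in> ball 0 1" for w
        unfolding lin[OF S(1)[OF f] S(1)[OF g] w] S(3)[OF mem w] S(3)[OF f w] S(3)[OF g w] ..
    qed
  qed
qed

section \<open>Dynamics of \<open>phi\<close> and extension of solutions\<close>

definition phi :: "complex \<Rightarrow> complex" where
  "phi z = z\<^sup>2 / 2 + 1 / 2"

text \<open>Partial fractions of 2 / ((1 - z) (1 + z)). In the coordinate v, \<open>phi\<close> adds
  1 / (1 + z), whose real part exceeds 1/2 because -z is in the disc as well.\<close>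

lemma inverse_one_minus_phi:
  assumes "z \<in> ball 0 1"
  shows "1 / (1 - phi z) = 1 / (1 - z) + 1 / (1 + z)"
proof -
  have "z \<noteq> 1" "z \<noteq> - 1" using assms by auto
  then have ne: "1 - z \<noteq> 0" "1 + z \<noteq> 0" by (auto simp: add_eq_0_iff)
  have "1 - phi z = (1 - z) * (1 + z) / 2" by (simp add: phi_def power2_eq_square field_simps)
  then show ?thesis using ne by (simp only:) (simp add: field_simps)
qed

lemma Re_inverse_one_plus: "z \<in> ball 0 1 \<Longrightarrow> 1 / 2 < Re (1 / (1 + z))"
  using disc_Re_gt[of "- z"] by simp

lemma phi_in_disc:
  assumes "z \<in> ball 0 1" shows "phi z \<in> ball 0 1"
proof -
  have "cmod (phi z) \<le> (cmod z)\<^sup>2 / 2 + 1 / 2"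
    using norm_triangle_ineq[of "z\<^sup>2 / 2" "1 / 2"] by (simp add: phi_def norm_divide norm_power)
  also have "\<dots> < 1" using assms abs_square_less_1[of "cmod z"] unfolding mem_ball_0 abs_norm_cancel by linarith
  finally show ?thesis by simp
qed

lemma phi_holomorphic: "phi holomorphic_on A"
  unfolding phi_def[abs_def] by (intro holomorphic_intros) auto

lemma phi_iterate_in_disc: "z \<in> ball 0 1 \<Longrightarrow> (phi ^^ n) z \<in> ball 0 1"
proof (induction n)
  case (Suc n)
  then show ?case using phi_in_disc[of "(phi ^^ n) z"] by simp
qed simp

lemma phi_iterate_holomorphic: "(phi ^^ n) holomorphic_on A"
proof (induction n)
  case (Suc n)
  have "(phi \<circ> (phi ^^ n)) holomorphic_on A"
    by (rule holomorphic_on_compose[OF Suc phi_holomorphic])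
  then show ?case by (simp only: funpow.simps)
qed (simp add: holomorphic_on_ident id_def)

lemma Re_phi_iterate:
  assumes "z \<in> ball 0 1"
  shows "real n / 2 + 1 / 2 < Re (1 / (1 - (phi ^^ n) z))"
proof (induction n)
  case 0
  then show ?case using disc_Re_gt[OF assms] by simp
next
  case (Suc n)
  have w: "(phi ^^ n) z \<in> ball 0 1" by (rule phi_iterate_in_disc[OF assms])
  have "Re (1 / (1 - (phi ^^ Suc n) z)) = Re (1 / (1 - (phi ^^ n) z)) + Re (1 / (1 + (phi ^^ n) z))"
    using inverse_one_minus_phi[OF w] by simp
  moreover have "real (Suc n) / 2 = real n / 2 + 1 / 2" by (simp add: add_divide_distrib)
  ultimately show ?case using Suc Re_inverse_one_plus[OF w] by linarith
qed

text \<open>A solution \<open>F0\<close> of \<open>\<psi> (F \<circ> phi) - l F = g\<close> on a domain \<open>D\<close> that \<open>phi\<close> maps into itself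
  is extended successively to the preimages of \<open>D\<close> under the iterates of \<open>phi\<close>.\<close>

primrec extend_sol :: "(complex \<Rightarrow> complex) \<Rightarrow> complex \<Rightarrow> (complex \<Rightarrow> complex) \<Rightarrow> (complex \<Rightarrow> complex)
    \<Rightarrow> nat \<Rightarrow> complex \<Rightarrow> complex" where
  "extend_sol \<psi> l g F0 0 = F0"
| "extend_sol \<psi> l g F0 (Suc k) = (\<lambda>w. (\<psi> w * extend_sol \<psi> l g F0 k (phi w) - g w) / l)"

text \<open>One extension step replaces F by F o \<open>phi\<close>, so the induction must control
  all compositions with iterates; hence the extra parameter m, raised by one at each step. Only F0
  composed with an iterate that lands in its domain has to be in \<open>H2\<close>. The constant is
  independent of g and F0, which gives boundedness of the inverse.\<close>

lemma extend_sol_H2: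
  assumes \<psi>: "\<psi> holomorphic_on ball 0 1" "\<And>z. z \<in> ball 0 1 \<Longrightarrow> cmod (\<psi> z) \<le> M" "0 \<le> M"
  shows "\<exists>D\<ge>0. \<forall>g F0. g \<in> H2 \<and> (\<lambda>w. F0 ((phi ^^ (k + m)) w)) \<in> H2 \<longrightarrow>
    (\<lambda>w. extend_sol \<psi> l g F0 k ((phi ^^ m) w)) \<in> H2 \<and>
    H2_norm (\<lambda>w. extend_sol \<psi> l g F0 k ((phi ^^ m) w))
      \<le> D * (H2_norm g + H2_norm (\<lambda>w. F0 ((phi ^^ (k + m)) w)))"
proof (induction k arbitrary: m)
  case 0
  show ?case
    by (rule exI[of _ 1]) (use H2_norm_nonneg in auto)
next
  case (Suc k)
  obtain D where D: "0 \<le> D" "\<And>g F0. g \<in> H2 \<Longrightarrow> (\<lambda>w. F0 ((phi ^^ (k + Suc m)) w)) \<in> H2 \<Longrightarrow>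
    (\<lambda>w. extend_sol \<psi> l g F0 k ((phi ^^ Suc m) w)) \<in> H2 \<and>
    H2_norm (\<lambda>w. extend_sol \<psi> l g F0 k ((phi ^^ Suc m) w))
      \<le> D * (H2_norm g + H2_norm (\<lambda>w. F0 ((phi ^^ (k + Suc m)) w)))"
    using Suc[of "Suc m"] by blast
  define Q where "Q = sqrt ((1 + cmod ((phi ^^ m) 0)) / (1 - cmod ((phi ^^ m) 0)))"
  have Q: "0 \<le> Q"
    unfolding Q_def using phi_iterate_in_disc[of 0 m]
    by (intro real_sqrt_ge_zero divide_nonneg_pos) auto
  define D' where "D' = cmod (1 / l) * (M * D) + cmod (- 1 / l) * Q"
  have D': "0 \<le> D'" using D(1) \<psi>(3) Q by (auto simp: D'_def intro!: add_nonneg_nonneg mult_nonneg_nonneg)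
  show ?case
  proof (rule exI[of _ D'], intro conjI D' allI impI; elim conjE)
    fix g F0 :: "complex \<Rightarrow> complex"
    assume g: "g \<in> H2" and F: "(\<lambda>w. F0 ((phi ^^ (Suc k + m)) w)) \<in> H2"
    define N where "N = H2_norm g + H2_norm (\<lambda>w. F0 ((phi ^^ (Suc k + m)) w))"
    let ?h = "\<lambda>w. extend_sol \<psi> l g F0 k ((phi ^^ Suc m) w)"
    have h: "?h \<in> H2" "H2_norm ?h \<le> D * N"
      using D(2)[OF g, of F0] F unfolding N_def by auto
    note L = littlewood_subordination[OF g phi_iterate_holomorphic[of m] phi_iterate_in_disc[of _ m], folded Q_def]
    have hm: "(\<lambda>w. \<psi> ((phi ^^ m) w)) holomorphic_on ball 0 1"
      using holomorphic_on_compose_gen[OF phi_iterate_holomorphic[of m] \<psi>(1) image_subsetI, OF phi_iterate_in_disc[of _ m]]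
      by (simp only: o_def)
    have bm: "cmod (\<psi> ((phi ^^ m) w)) \<le> M" if "w \<in> ball 0 1" for w
      using \<psi>(2) phi_iterate_in_disc[OF that] by blast
    have p: "(\<lambda>w. \<psi> ((phi ^^ m) w) * ?h w) \<in> H2" by (rule H2_mult_bounded(1)[OF hm \<psi>(3) bm h(1)])
    have "H2_norm (\<lambda>w. \<psi> ((phi ^^ m) w) * ?h w) \<le> M * H2_norm ?h" by (rule H2_mult_bounded(2)[OF hm \<psi>(3) bm h(1)])
    also have "\<dots> \<le> M * (D * N)" by (intro mult_left_mono h \<psi>(3))
    finally have pn: "H2_norm (\<lambda>w. \<psi> ((phi ^^ m) w) * ?h w) \<le> M * (D * N)" .
    have N: "H2_norm g \<le> N" using H2_norm_nonneg[OF F] by (simp add: N_def)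
    have qn: "H2_norm (\<lambda>w. g ((phi ^^ m) w)) \<le> Q * N"
      using L(2) mult_left_mono[OF N Q] by linarith
    have eq: "(\<lambda>w. extend_sol \<psi> l g F0 (Suc k) ((phi ^^ m) w))
        = (\<lambda>w. (1 / l) * (\<psi> ((phi ^^ m) w) * ?h w) + (- 1 / l) * g ((phi ^^ m) w))"
      by (rule ext) (simp add: diff_divide_distrib)
    show "(\<lambda>w. extend_sol \<psi> l g F0 (Suc k) ((phi ^^ m) w)) \<in> H2"
      unfolding eq by (rule H2_lincomb(1)[OF p L(1)])
    have "H2_norm (\<lambda>w. extend_sol \<psi> l g F0 (Suc k) ((phi ^^ m) w))
       \<le> cmod (1 / l) * H2_norm (\<lambda>w. \<psi> ((phi ^^ m) w) * ?h w) + cmod (- 1 / l) * H2_norm (\<lambda>w. g ((phi ^^ m) w))"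
      unfolding eq by (rule H2_lincomb(2)[OF p L(1)])
    also have "\<dots> \<le> cmod (1 / l) * (M * (D * N)) + cmod (- 1 / l) * (Q * N)"
      by (intro add_mono mult_left_mono pn qn norm_ge_zero)
    also have "\<dots> = D' * N" by (simp add: D'_def algebra_simps)
    finally show "H2_norm (\<lambda>w. extend_sol \<psi> l g F0 (Suc k) ((phi ^^ m) w))
       \<le> D' * (H2_norm g + H2_norm (\<lambda>w. F0 ((phi ^^ (Suc k + m)) w)))" unfolding N_def .
  qed
qed

lemma extend_sol_eq_base:
  assumes l: "l \<noteq> 0" and D: "\<And>w. w \<in> D \<Longrightarrow> phi w \<in> D"
    and sol: "\<And>w. w \<in> D \<Longrightarrow> \<psi> w * F0 (phi w) - l * F0 w = g w"
    and w: "w \<in> D"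
  shows "extend_sol \<psi> l g F0 k w = F0 w"
  using w
proof (induction k arbitrary: w)
  case (Suc k)
  then show ?case using Suc.IH[OF D[OF Suc.prems]] sol[OF Suc.prems] l by (simp add: field_simps)
qed simp

text \<open>Equality of two consecutive steps at w says exactly that step k solves the equation at
  w. It holds once the k-th iterate of w has reached D, since further steps leave F0 unchanged
  there.\<close>

lemma extend_sol_stable:
  assumes l: "l \<noteq> 0" and D: "\<And>w. w \<in> D \<Longrightarrow> phi w \<in> D"
    and sol: "\<And>w. w \<in> D \<Longrightarrow> \<psi> w * F0 (phi w) - l * F0 w = g w"
    and w: "(phi ^^ k) w \<in> D"
  shows "extend_sol \<psi> l g F0 (Suc k) w = extend_sol \<psi> l g F0 k w"
  using w
proof (induction k arbitrary: w)
  case 0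
  then have "w \<in> D" by simp
  have "extend_sol \<psi> l g F0 (Suc 0) w = F0 w"
    by (rule extend_sol_eq_base[where D = D and \<psi> = \<psi> and g = g and ?F0.0 = F0]) (fact l D sol \<open>w \<in> D\<close>)+
  then show ?case by simp
next
  case (Suc k)
  then have "(phi ^^ k) (phi w) \<in> D" by (simp add: funpow_swap1)
  from Suc.IH[OF this]
  have "extend_sol \<psi> l g F0 (Suc (Suc k)) w = (\<psi> w * extend_sol \<psi> l g F0 k (phi w) - g w) / l"
    by (simp only: extend_sol.simps(2)[of _ _ _ _ "Suc k"])
  then show ?case by (simp only: extend_sol.simps(2)[of _ _ _ _ k])
qed

theorem invertible_off_segment:
  fixes \<psi> :: "complex \<Rightarrow> complex"
  assumes \<psi>: "\<psi> \<in> Hinf" "continuous_on (ball 0 1 \<union> {1}) \<psi>"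
    and l: "\<And>t. 0 \<le> t \<Longrightarrow> t \<le> 1 \<Longrightarrow> l \<noteq> \<psi> 1 * complex_of_real t"
  shows "H2_invertible (\<lambda>f z. wcomp \<psi> phi f z - l * f z)"
proof -
  obtain s d where s: "0 < s" "s \<le> 1 / 16" and d: "0 < d"
    and ex: "\<And>y. \<exists>x. \<forall>z\<in>ball 0 1. \<psi> (1 - of_real (2 * s) * (1 - z)) * ev x (qmap s z) - l * ev x z = ev y z"
    and bd: "\<And>x y. (\<And>z. z \<in> ball 0 1 \<Longrightarrow> \<psi> (1 - of_real (2 * s) * (1 - z)) * ev x (qmap s z) - l * ev x z = ev y z)
        \<Longrightarrow> d * norm x \<le> norm y"
    using scaled_resolvent[OF \<psi> l] by blast
  have l0: "l \<noteq> 0" using l[of 0] by simp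
  have hol: "\<psi> holomorphic_on ball 0 1" using \<psi>(1) by (simp add: Hinf_def)
  obtain M where M: "\<And>z. z \<in> ball 0 1 \<Longrightarrow> cmod (\<psi> z) \<le> M"
    using \<psi>(1) unfolding Hinf_def bounded_iff by blast
  have M0: "0 \<le> M" using order_trans[OF norm_ge_zero M[of 0]] by simp
  define \<epsilon> where "\<epsilon> = 2 * s"
  have \<epsilon>: "0 < \<epsilon>" "\<epsilon> \<le> 1" using s by (auto simp: \<epsilon>_def)
  define A where "A z = 1 - of_real \<epsilon> * (1 - z)" for z :: complex
  define B where "B w = 1 - (1 - w) / of_real \<epsilon>" for w :: complex
  have BA: "B (A z) = z" and AB: "A (B z) = z" for z using \<epsilon> by (simp_all add: A_def B_def)
  have A_disc: "A z \<in> ball 0 1" if "z \<in> ball 0 1" for z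
    unfolding A_def by (rule disc_contract[OF \<epsilon> that])
  have A_hol: "A holomorphic_on S" and B_hol: "B holomorphic_on S" for S
    unfolding A_def[abs_def] B_def[abs_def] using \<epsilon> by (auto intro!: holomorphic_intros)
  have phi_A: "phi (A z) = A (qmap s z)" for z
    by (simp add: phi_def A_def qmap_def \<epsilon>_def power2_eq_square field_simps)
  define D where "D = A ` ball 0 1"
  have D_phi: "phi w \<in> D" if "w \<in> D" for w
    using that qmap_in_disc[OF s] by (auto simp: D_def phi_A simp del: mem_ball_0)
  \<comment> \<open>D is the horodisc Re v > 1 / (2 \<open>\<epsilon>\<close>), and each application
    of \<open>phi\<close> adds more than 1/2 to Re v. So 1 / \<open>\<epsilon>\<close> steps bring
    every point of the disc into D.\<close>
  define n where "n = nat \<lceil>1 / \<epsilon>\<rceil>"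
  have n: "1 / \<epsilon> \<le> real n" unfolding n_def by (rule real_nat_ceiling_ge)
  have B_iter: "B ((phi ^^ n) w) \<in> ball 0 1" if w: "w \<in> ball 0 1" for w
  proof -
    let ?v = "(phi ^^ n) w"
    have "?v \<noteq> 1" using disc_ne_one[OF phi_iterate_in_disc[OF w]] .
    then have ne: "B ?v \<noteq> 1" using \<epsilon> by (simp add: B_def)
    have "1 / (1 - B ?v) = of_real \<epsilon> * (1 / (1 - ?v))" by (simp add: B_def)
    then have "Re (1 / (1 - B ?v)) = \<epsilon> * Re (1 / (1 - ?v))" by (simp only: Re_complex_of_real times_complex.sel Im_complex_of_real)
    moreover have "1 / 2 < \<epsilon> * Re (1 / (1 - ?v))"
    proof -
      have "1 / (2 * \<epsilon>) < Re (1 / (1 - ?v))" using Re_phi_iterate[OF w, of n] n by simp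
      then have "\<epsilon> * (1 / (2 * \<epsilon>)) < \<epsilon> * Re (1 / (1 - ?v))" using \<epsilon>(1) by (rule mult_strict_left_mono)
      then show ?thesis using \<epsilon>(1) by simp
    qed
    ultimately show ?thesis using mem_disc_iff_Re[OF ne] by simp
  qed
  have iter_D: "(phi ^^ n) w \<in> D" if "w \<in> ball 0 1" for w
    unfolding D_def using B_iter[OF that] AB[of "(phi ^^ n) w"] by (metis imageI)
  define QA where "QA = sqrt ((1 + cmod (A 0)) / (1 - cmod (A 0)))"
  define \<omega> where "\<omega> w = B ((phi ^^ n) w)" for w
  have \<omega>: "\<omega> holomorphic_on ball 0 1" "\<And>w. w \<in> ball 0 1 \<Longrightarrow> \<omega> w \<in> ball 0 1"
    using holomorphic_on_compose[OF phi_iterate_holomorphic[of n] B_hol] B_iter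
    unfolding \<omega>_def[abs_def] by (simp_all only: o_def)
  define Q\<omega> where "Q\<omega> = sqrt ((1 + cmod (\<omega> 0)) / (1 - cmod (\<omega> 0)))"
  have Q\<omega>: "0 \<le> Q\<omega>" unfolding Q\<omega>_def using \<omega>(2)[of 0] by (intro real_sqrt_ge_zero divide_nonneg_pos) auto
  obtain E where E: "0 \<le> E" "\<And>g F0. g \<in> H2 \<Longrightarrow> (\<lambda>w. F0 ((phi ^^ n) w)) \<in> H2 \<Longrightarrow>
    extend_sol \<psi> l g F0 n \<in> H2 \<and>
    H2_norm (extend_sol \<psi> l g F0 n) \<le> E * (H2_norm g + H2_norm (\<lambda>w. F0 ((phi ^^ n) w)))"
    using extend_sol_H2[OF hol M M0, of n 0 l] by auto
  show ?thesis
  proof (rule H2_invertibleI[where C = "E * (1 + Q\<omega> * (QA / d))"])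
    fix f assume f: "f \<in> H2"
    have "wcomp \<psi> phi f \<in> H2" by (rule wcomp_H2(1)[OF hol M0 M phi_holomorphic phi_in_disc f])
    from H2_lincomb(1)[OF this f, of 1 "- l"]
    show "(\<lambda>z. wcomp \<psi> phi f z - l * f z) \<in> H2" by simp
  next
    fix f g :: "complex \<Rightarrow> complex" and a b z :: complex
    show "wcomp \<psi> phi (\<lambda>w. a * f w + b * g w) z - l * (a * f z + b * g z)
        = a * (wcomp \<psi> phi f z - l * f z) + b * (wcomp \<psi> phi g z - l * g z)"
      by (simp add: wcomp_def algebra_simps)
  next
    fix g assume g: "g \<in> H2"
    have gA: "(\<lambda>z. g (A z)) \<in> H2" "H2_norm (\<lambda>z. g (A z)) \<le> QA * H2_norm g"
      unfolding QA_def by (rule littlewood_subordination[OF g A_hol A_disc], assumption)+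
    obtain x where x: "\<And>z. z \<in> ball 0 1 \<Longrightarrow>
        \<psi> (1 - of_real (2 * s) * (1 - z)) * ev x (qmap s z) - l * ev x z = ev (of_fun (\<lambda>z. g (A z))) z"
      using ex[of "of_fun (\<lambda>z. g (A z))"] by blast
    have "d * norm x \<le> QA * H2_norm g"
      using bd[of x "of_fun (\<lambda>z. g (A z))"] x gA(2) unfolding norm_of_fun[OF gA(1)] by (blast intro: order_trans)
    then have xn: "norm x \<le> QA / d * H2_norm g" using d by (simp add: field_simps)
    \<comment> \<open>This has meaning on D only, where B w lies in the disc. Elsewhere its values
      are irrelevant, since F0 is used on the whole disc only after composition with the n-th
      iterate.\<close>
    define F0 where "F0 w = ev x (B w)" for w
    have sol: "\<psi> w * F0 (phi w) - l * F0 w = g w" if w: "w \<in> D" for w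
    proof -
      obtain z where z: "z \<in> ball 0 1" "w = A z" using w unfolding D_def by blast
      show ?thesis
        using x[OF z(1)] ev_of_fun[OF gA(1) z(1)] unfolding F0_def z(2) phi_A BA
        by (simp add: A_def \<epsilon>_def)
    qed
    have "(\<lambda>w. ev x (\<omega> w)) \<in> H2" "H2_norm (\<lambda>w. ev x (\<omega> w)) \<le> Q\<omega> * H2_norm (ev x)"
      unfolding Q\<omega>_def by (rule littlewood_subordination[OF ev_in_H2 \<omega>], assumption)+
    then have F0: "(\<lambda>w. F0 ((phi ^^ n) w)) \<in> H2" "H2_norm (\<lambda>w. F0 ((phi ^^ n) w)) \<le> Q\<omega> * norm x"
      by (simp_all only: F0_def \<omega>_def H2_norm_ev)
    let ?F = "extend_sol \<psi> l g F0 n"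
    have F: "?F \<in> H2" "H2_norm ?F \<le> E * (H2_norm g + H2_norm (\<lambda>w. F0 ((phi ^^ n) w)))"
      using E(2)[OF g F0(1)] by auto
    note F(2)
    also have "E * (H2_norm g + H2_norm (\<lambda>w. F0 ((phi ^^ n) w))) \<le> E * (H2_norm g + Q\<omega> * (QA / d * H2_norm g))"
      using F0(2) mult_left_mono[OF xn Q\<omega>] E(1) by (intro mult_left_mono add_left_mono) auto
    also have "\<dots> = E * (1 + Q\<omega> * (QA / d)) * H2_norm g" by (simp add: algebra_simps)
    finally have Fn: "H2_norm ?F \<le> E * (1 + Q\<omega> * (QA / d)) * H2_norm g" .
    have "wcomp \<psi> phi ?F z - l * ?F z = g z" if z: "z \<in> ball 0 1" for z
    proof -
      have "extend_sol \<psi> l g F0 (Suc n) z = ?F z"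
        by (rule extend_sol_stable[where D = D and \<psi> = \<psi> and g = g and ?F0.0 = F0])
           (fact l0 D_phi sol iter_D[OF z])+
      then have "(\<psi> z * ?F (phi z) - g z) / l = ?F z" by simp
      then show ?thesis using l0 by (simp add: wcomp_def field_simps)
    qed
    with F(1) Fn show "\<exists>f. f \<in> H2 \<and> H2_norm f \<le> E * (1 + Q\<omega> * (QA / d)) * H2_norm g
        \<and> (\<forall>z\<in>ball 0 1. wcomp \<psi> phi f z - l * f z = g z)" by blast
  next
    fix f z assume f: "f \<in> H2" and zero: "\<And>w. w \<in> ball 0 1 \<Longrightarrow> wcomp \<psi> phi f w - l * f w = 0"
      and z: "z \<in> ball (0::complex) 1"
    have fA: "(\<lambda>z. f (A z)) \<in> H2" by (rule littlewood_subordination(1)[OF f A_hol A_disc])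
    have "\<psi> (1 - of_real (2 * s) * (1 - z)) * ev (of_fun (\<lambda>z. f (A z))) (qmap s z)
        - l * ev (of_fun (\<lambda>z. f (A z))) z = ev 0 z" if z: "z \<in> ball 0 1" for z
      using zero[OF A_disc[OF z]]
      unfolding wcomp_def phi_A ev_of_fun[OF fA z] ev_of_fun[OF fA qmap_in_disc[OF s z]]
      by (simp add: A_def \<epsilon>_def ev_def zero_l2.rep_eq)
    then have "d * norm (of_fun (\<lambda>z. f (A z))) \<le> norm (0::l2)" by (rule bd)
    then have "norm (of_fun (\<lambda>z. f (A z))) \<le> 0" using d by (simp add: mult_le_0_iff)
    then have "of_fun (\<lambda>z. f (A z)) = 0" by simp
    then have fA0: "f (A z) = 0" if "z \<in> ball 0 1" for z
      using ev_of_fun[OF fA that] by (simp add: ev_def zero_l2.rep_eq)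
    \<comment> \<open>The equation reads l f(w) = \<psi>(w) f(phi w), and l is nonzero. Vanishing
      therefore propagates backwards along orbits, from D to the whole disc.\<close>
    have "f w = 0" if "(phi ^^ k) w \<in> D" "w \<in> ball 0 1" for k w
      using that
    proof (induction k arbitrary: w)
      case 0
      then obtain z where "z \<in> ball 0 1" "w = A z" unfolding D_def by auto
      then show ?case using fA0 by simp
    next
      case (Suc k)
      have "f (phi w) = 0"
        using Suc.prems phi_in_disc by (intro Suc.IH) (simp_all add: funpow_swap1 del: mem_ball_0)
      then show ?case using zero[OF Suc.prems(2)] l0 by (simp add: wcomp_def)
    qed
    from this[OF iter_D[OF z] z] show "f z = 0" .
  qed
qed

section \<open>Approximate eigenvectors\<close>

definition kern :: "real \<Rightarrow> complex \<Rightarrow> complex" where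
  "kern r z = 1 / (1 - of_real r * z)"

lemma kern_H2:
  assumes "0 \<le> r" "r < 1"
  shows "kern r \<in> H2" "(H2_norm (kern r))\<^sup>2 \<le> 1 / (1 - r)"
proof -
  have "taylor_coeff (kern r) = (\<lambda>n. of_real r ^ n)"
  proof (rule taylor_coeff_eqI)
    fix z :: complex assume z: "z \<in> ball 0 1"
    have "cmod (of_real r * z) < 1"
      using z assms mult_left_le_one_le[of "cmod z" r] by (simp add: norm_mult) 
    from geometric_sums[OF this] show "(\<lambda>n. of_real r ^ n * z ^ n) sums kern r z"
      by (simp add: kern_def power_mult_distrib)
  qed
  then have t: "(\<lambda>n. (cmod (taylor_coeff (kern r) n))\<^sup>2) = (\<lambda>n. (r\<^sup>2) ^ n)"
    using assms by (simp add: norm_power power_mult[symmetric] mult.commute)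
  have r2: "r\<^sup>2 < 1" using assms abs_square_less_1[of r] by simp
  have hol: "kern r holomorphic_on ball 0 1"
  proof -
    have "1 - of_real r * z \<noteq> 0" if "z \<in> ball 0 1" for z :: complex
    proof
      assume "1 - of_real r * z = 0"
      then have "cmod (of_real r * z) = 1" by simp
      moreover have "cmod (of_real r * z) < 1"
        using that assms mult_left_le_one_le[of "cmod z" r] by (simp add: norm_mult)
      ultimately show False by simp
    qed
    then show ?thesis unfolding kern_def[abs_def] by (intro holomorphic_intros) auto
  qed
  have "summable (\<lambda>n. (cmod (taylor_coeff (kern r) n))\<^sup>2)"
    unfolding t using r2 by (simp add: summable_geometric)
  then show H: "kern r \<in> H2" using hol by (simp add: H2_def)
  have "(H2_norm (kern r))\<^sup>2 = 1 / (1 - r\<^sup>2)"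
    unfolding H2_norm_square[OF H] t using r2 by (intro suminf_geometric) simp
  also have "\<dots> \<le> 1 / (1 - r)"
    using assms r2 by (intro divide_left_mono mult_pos_pos) (auto simp: power2_eq_square mult_left_le)
  finally show "(H2_norm (kern r))\<^sup>2 \<le> 1 / (1 - r)" .
qed

lemma one_minus_phi: "1 - phi z = (1 - z) * (1 + z) / 2"
  by (simp add: phi_def power2_eq_square field_simps)

text \<open>The triangle inequality bounds |1 - z| by |1 - r z| + (1 - r), and 1 - r is itself at
  most |1 - r z|. The bound on the kernel is independent of r, so all kernels are uniformly bounded
  away from 1.\<close>

lemma norm_kern_le:
  assumes "0 \<le> r" "r < 1" "z \<in> ball 0 1"
  shows "cmod (kern r z) \<le> 2 / cmod (1 - z)" "cmod (1 - z) \<le> 2 * cmod (1 - of_real r * z)"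
proof -
  have z: "cmod z < 1" "0 < cmod (1 - z)" using assms(3) by auto
  have "1 - r \<le> cmod (1 - of_real r * z)"
  proof -
    have "r * cmod z \<le> r" using assms z by (intro mult_left_le) auto
    then show ?thesis
      using norm_triangle_ineq2[of 1 "of_real r * z"] assms by (simp add: norm_mult)
  qed
  moreover have "cmod (1 - z) \<le> cmod (1 - of_real r * z) + (1 - r)"
  proof -
    have "1 - z = (1 - of_real r * z) + of_real (r - 1) * z" by (simp add: algebra_simps)
    then have "cmod (1 - z) \<le> cmod (1 - of_real r * z) + cmod (of_real (r - 1) * z)"
      by (simp only: norm_triangle_ineq)
    also have "cmod (of_real (r - 1) * z) \<le> (1 - r) * 1"
      unfolding norm_mult norm_of_real using assms z by (intro mult_mono) auto
    finally show ?thesis by simp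
  qed
  ultimately show le: "cmod (1 - z) \<le> 2 * cmod (1 - of_real r * z)" by simp
  have "1 / cmod (1 - of_real r * z) = 2 / (2 * cmod (1 - of_real r * z))" by simp
  also have "\<dots> \<le> 2 / cmod (1 - z)"
    using le z by (intro divide_left_mono mult_pos_pos) linarith+
  finally show "cmod (kern r z) \<le> 2 / cmod (1 - z)"
    unfolding kern_def norm_divide norm_one .
qed

text \<open>Points \<open>phi z\<close> have positive real part, which keeps them away from -1. For
  w = \<open>phi z\<close> the factorisation 1 - phi w = (1 - w) (1 + w) / 2 then shows that
  \<open>phi w\<close> cannot be near 1 unless w is.\<close>

lemma phi_image_bounds:
  assumes "z \<in> ball 0 1"
  shows "1 \<le> cmod (1 + phi z)" "cmod (1 - phi z) \<le> 2 * cmod (1 - phi (phi z))"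
proof -
  have "(cmod z)\<^sup>2 < 1" using assms abs_square_less_1[of "cmod z"] unfolding mem_ball_0 abs_norm_cancel by linarith
  then have "cmod (z\<^sup>2 / 2) < 1 / 2" by (simp add: norm_divide norm_power)
  then have "- (1 / 2) < Re (z\<^sup>2 / 2)" using abs_Re_le_cmod[of "z\<^sup>2 / 2"] by linarith
  then have "1 \<le> Re (1 + phi z)" by (simp add: phi_def)
  also have "\<dots> \<le> cmod (1 + phi z)" by (rule complex_Re_le_cmod)
  finally show le: "1 \<le> cmod (1 + phi z)" .
  have "cmod (1 - phi (phi z)) = cmod (1 - phi z) * cmod (1 + phi z) / 2"
    unfolding one_minus_phi[of "phi z"] by (simp add: norm_mult norm_divide)
  then show "cmod (1 - phi z) \<le> 2 * cmod (1 - phi (phi z))"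
    using mult_left_mono[OF le norm_ge_zero[of "1 - phi z"]] by simp
qed

text \<open>The displacement phi w - w = (1 - w)^2 / 2 is quadratic at 1, while the kernel at
  \<open>phi w\<close> costs only one factor 1 / |1 - w|. The relative change of the kernel is thus
  of order |1 - w|, uniformly in r.\<close>

lemma norm_kern_phi_diff:
  assumes r: "0 \<le> r" "r < 1" and z: "z \<in> ball 0 1"
  defines "w \<equiv> phi z"
  shows "cmod (kern r (phi w) - kern r w) \<le> 2 * cmod (1 - w) * cmod (kern r w)"
    "cmod (kern r (phi w)) \<le> 4 / cmod (1 - w)"
proof -
  have w: "w \<in> ball 0 1" and pw: "phi w \<in> ball 0 1" using z by (simp_all only: w_def phi_in_disc)
  have u: "0 < cmod (1 - w)" "0 < cmod (1 - phi w)" using disc_ne_one[OF w] disc_ne_one[OF pw] by auto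
  have "cmod (kern r (phi w)) \<le> 2 / cmod (1 - phi w)" by (rule norm_kern_le(1)[OF r pw])
  also have "\<dots> = 4 / (2 * cmod (1 - phi w))" by simp
  also have "\<dots> \<le> 4 / cmod (1 - w)"
    using phi_image_bounds(2)[OF z] u unfolding w_def by (intro divide_left_mono mult_pos_pos) auto
  finally show k: "cmod (kern r (phi w)) \<le> 4 / cmod (1 - w)" .
  have ne: "1 - of_real r * w \<noteq> 0" "1 - of_real r * phi w \<noteq> 0"
    using norm_kern_le(2)[OF r w] norm_kern_le(2)[OF r pw] u by auto
  have d: "phi w - w = (1 - w)\<^sup>2 / 2" by (simp add: phi_def power2_eq_square field_simps)
  have "kern r (phi w) - kern r w = of_real r * (phi w - w) * kern r (phi w) * kern r w"
    unfolding kern_def using ne by (simp add: field_simps)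
  then have "cmod (kern r (phi w) - kern r w) = (r * ((cmod (1 - w))\<^sup>2 / 2) * cmod (kern r (phi w))) * cmod (kern r w)"
    unfolding d using r by (simp only: norm_mult norm_power norm_divide norm_of_real) simp
  also have "\<dots> \<le> (1 * ((cmod (1 - w))\<^sup>2 / 2) * (4 / cmod (1 - w))) * cmod (kern r w)"
    using r k by (intro mult_right_mono mult_mono) auto
  also have "\<dots> = 2 * cmod (1 - w) * cmod (kern r w)"
    using u by (simp add: power2_eq_square)
  finally show "cmod (kern r (phi w) - kern r w) \<le> 2 * cmod (1 - w) * cmod (kern r w)" .
qed

text \<open>\<open>exp (- t / (1 - z))\<close> is an eigenfunction of the translation \<open>v \<mapsto> v + 1/2\<close>,
  \<open>v = 1 / (1 - z)\<close>, with eigenvalue \<open>exp (- t / 2)\<close>; the kernel factor concentrates it at \<open>1\<close>.\<close>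

definition approx_eig :: "real \<Rightarrow> real \<Rightarrow> complex \<Rightarrow> complex" where
  "approx_eig t r z = exp (- of_real t / (1 - z)) * kern r z"

lemma norm_exp_disc:
  fixes z :: complex
  shows "cmod (exp (- of_real t / (1 - z))) = exp (- t * Re (1 / (1 - z)))"
proof -
  have "- of_real t / (1 - z) = of_real (- t) * (1 / (1 - z))" by simp
  then have "Re (- of_real t / (1 - z)) = - t * Re (1 / (1 - z))"
    by (simp only: times_complex.sel Re_complex_of_real Im_complex_of_real)
  then show ?thesis by (simp only: norm_exp_eq_Re)
qed

lemma norm_exp_disc_le:
  assumes "0 \<le> t" "z \<in> ball 0 1"
  shows "cmod (exp (- of_real t / (1 - z))) \<le> 1"
  using mult_nonneg_nonneg[OF assms(1), of "Re (1 / (1 - z))"] disc_Re_gt[OF assms(2)]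
  unfolding norm_exp_disc by simp

lemma approx_eig_H2:
  assumes "0 \<le> t" "0 \<le> r" "r < 1"
  shows "approx_eig t r \<in> H2"
proof -
  have "(\<lambda>z. exp (- of_real t / (1 - z))) holomorphic_on ball 0 1"
    using disc_ne_one by (intro holomorphic_intros) auto
  from H2_mult_bounded(1)[OF this zero_le_one norm_exp_disc_le[OF assms(1)] kern_H2(1)[OF assms(2,3)]]
  show ?thesis unfolding approx_eig_def[abs_def] by simp
qed

text \<open>At w = \<open>phi z\<close> the exponential factors combine to exp(- t / (1 - w)), of
  modulus at most 1, times \<open>\<Psi> w\<close>, which is continuous at 1 with value l. Near 1
  the residual is small relative to the kernel; elsewhere it is bounded by a constant K. That K does
  not depend on r is decisive, because the kernels have norms tending to infinity as r tends to
  1.\<close>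

lemma approx_eig_residual:
  fixes \<psi> :: "complex \<Rightarrow> complex"
  assumes cont: "continuous_on (ball 0 1 \<union> {1}) \<psi>" and M: "\<And>z. z \<in> ball 0 1 \<Longrightarrow> cmod (\<psi> z) \<le> M"
    and t: "0 \<le> t" and e: "0 < e"
  defines "l \<equiv> \<psi> 1 * complex_of_real (exp (- t / 2))"
  shows "\<exists>K. 0 \<le> K \<and> (\<forall>r z. 0 \<le> r \<longrightarrow> r < 1 \<longrightarrow> z \<in> ball 0 1 \<longrightarrow>
      cmod (\<psi> (phi z) * approx_eig t r (phi (phi z)) - l * approx_eig t r (phi z)) \<le> e * cmod (kern r (phi z)) + K)"
proof -
  define \<Psi> where "\<Psi> w = \<psi> w * exp (- of_real t / (1 + w))" for w
  have M0: "0 \<le> M" using order_trans[OF norm_ge_zero M[of 0]] by simp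
  have ne: "1 + w \<noteq> 0" if "w \<in> ball 0 1 \<union> {1}" for w :: complex
    using that by (auto simp: add_eq_0_iff)
  have "continuous_on (ball 0 1 \<union> {1}) \<Psi>"
    unfolding \<Psi>_def[abs_def] using ne by (intro continuous_intros cont) auto
  moreover have \<Psi>1: "\<Psi> 1 = l" by (simp add: \<Psi>_def l_def exp_of_real[symmetric])
  ultimately obtain \<delta>0 where \<delta>0: "0 < \<delta>0" "\<And>w. w \<in> ball 0 1 \<Longrightarrow> cmod (w - 1) < \<delta>0 \<Longrightarrow> cmod (\<Psi> w - l) < e / 6"
    using e unfolding continuous_on_iff dist_norm by (metis UnI1 UnI2 singletonI divide_pos_pos zero_less_numeral)
  \<comment> \<open>The bound by 1 makes the kernel at \<open>phi w\<close> at most 3 times the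
    kernel at w, so the variation of \<open>\<Psi>\<close> contributes 3 e / 6 = e / 2. The last
    bound makes the change of the kernel contribute at most e / 2.\<close>
  define \<delta> where "\<delta> = min \<delta>0 (min 1 (e / (4 * (cmod l + 1))))"
  have l1: "0 < 4 * (cmod l + 1)" by (simp add: add_nonneg_pos)
  have \<delta>: "0 < \<delta>" "\<delta> \<le> \<delta>0" "\<delta> \<le> 1" "\<delta> \<le> e / (4 * (cmod l + 1))"
    using \<delta>0(1) e l1 by (auto simp: \<delta>_def)
  define K where "K = M * (4 / \<delta>) + cmod l * (2 / \<delta>)"
  show ?thesis
  proof (intro exI[of _ K] conjI allI impI)
    show K0: "0 \<le> K" using M0 \<delta> by (simp add: K_def)
    fix r :: real and z :: complex assume r: "0 \<le> r" "r < 1" and z: "z \<in> ball 0 1"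
    define w where "w = phi z"
    have w: "w \<in> ball 0 1" unfolding w_def by (rule phi_in_disc[OF z])
    have u: "0 < cmod (1 - w)" using disc_ne_one[OF w] by simp
    note kd = norm_kern_phi_diff[OF r z, folded w_def]
    let ?E = "exp (- of_real t / (1 - w))"
    have "- of_real t / (1 - phi w) = - of_real t * (1 / (1 - phi w))" by simp
    also have "\<dots> = - of_real t / (1 - w) + - of_real t / (1 + w)"
      unfolding inverse_one_minus_phi[OF w] by (simp add: distrib_left)
    finally have "exp (- of_real t / (1 - phi w)) = ?E * exp (- of_real t / (1 + w))"
      by (simp only: exp_add)
    then have "\<psi> w * approx_eig t r (phi w) - l * approx_eig t r w = ?E * (\<Psi> w * kern r (phi w) - l * kern r w)"
      by (simp add: approx_eig_def \<Psi>_def algebra_simps)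
    then have "cmod (\<psi> w * approx_eig t r (phi w) - l * approx_eig t r w) = cmod ?E * cmod (\<Psi> w * kern r (phi w) - l * kern r w)"
      by (simp only: norm_mult)
    also have "\<dots> \<le> 1 * cmod (\<Psi> w * kern r (phi w) - l * kern r w)"
      by (intro mult_right_mono norm_exp_disc_le[OF t w] norm_ge_zero)
    also have "\<dots> \<le> e * cmod (kern r w) + K"
    proof (cases "cmod (1 - w) < \<delta>")
      case True
      have \<Psi>: "cmod (\<Psi> w - l) \<le> e / 6"
        using \<delta>0(2)[OF w] True \<delta>(2) by (simp add: norm_minus_commute less_imp_le)
      have d: "cmod (kern r (phi w) - kern r w) \<le> 2 * \<delta> * cmod (kern r w)"
        using kd(1) True by (meson mult_right_mono mult_left_mono norm_ge_zero less_imp_le order_trans zero_le_numeral)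
      then have "cmod (kern r (phi w) - kern r w) \<le> 2 * cmod (kern r w)"
        using \<delta>(3) mult_right_mono[of \<delta> 1 "cmod (kern r w)"] by simp
      then have k3: "cmod (kern r (phi w)) \<le> 3 * cmod (kern r w)"
        using norm_triangle_ineq2[of "kern r (phi w)" "kern r w"] by linarith
      have "\<Psi> w * kern r (phi w) - l * kern r w = (\<Psi> w - l) * kern r (phi w) + l * (kern r (phi w) - kern r w)"
        by (simp add: algebra_simps)
      then have "cmod (\<Psi> w * kern r (phi w) - l * kern r w)
          \<le> cmod (\<Psi> w - l) * cmod (kern r (phi w)) + cmod l * cmod (kern r (phi w) - kern r w)"
        by (metis norm_mult norm_triangle_ineq)
      also have "\<dots> \<le> (e / 6) * (3 * cmod (kern r w)) + cmod l * (2 * \<delta> * cmod (kern r w))"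
        using \<Psi> k3 d e by (intro add_mono mult_mono mult_left_mono) auto
      also have "\<dots> = (e / 2 + 2 * (cmod l * \<delta>)) * cmod (kern r w)" by (simp add: algebra_simps)
      also have "\<dots> \<le> e * cmod (kern r w)"
      proof (rule mult_right_mono)
        have "cmod l * \<delta> \<le> (cmod l + 1) * \<delta>" using \<delta>(1) by (simp add: distrib_right)
        also have "\<dots> \<le> (cmod l + 1) * (e / (4 * (cmod l + 1)))" by (intro mult_left_mono \<delta>(4)) simp
        also have "\<dots> = e / 4"
        proof -
          have "c * (e / (4 * c)) = e / 4" if "0 < c" for c :: real using that by simp
          from this[of "cmod l + 1"] show ?thesis using l1 by simp
        qed
        finally show "e / 2 + 2 * (cmod l * \<delta>) \<le> e" by simp
      qed simp
      finally show ?thesis using K0 by linarith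
    next
      case False
      have "Re (1 / (1 + w)) \<ge> 0" using Re_inverse_one_plus[OF w] by linarith
      then have "cmod (exp (- of_real t / (1 + w))) \<le> 1"
        using norm_exp_disc[of t "- w"] t by simp
      then have \<Psi>: "cmod (\<Psi> w) \<le> M"
        unfolding \<Psi>_def norm_mult using M[OF w] M0 mult_mono[of "cmod (\<psi> w)" M _ 1] by simp
      have inv: "c / cmod (1 - w) \<le> c / \<delta>" if "0 \<le> c" for c
        using False \<delta>(1) that by (intro divide_left_mono mult_pos_pos) auto
      have "cmod (\<Psi> w * kern r (phi w) - l * kern r w)
          \<le> cmod (\<Psi> w) * cmod (kern r (phi w)) + cmod l * cmod (kern r w)"
        by (metis norm_mult norm_triangle_ineq4)
      also have "\<dots> \<le> M * (4 / \<delta>) + cmod l * (2 / \<delta>)"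
        using \<Psi> M0 order_trans[OF kd(2) inv] order_trans[OF norm_kern_le(1)[OF r w] inv]
        by (intro add_mono mult_mono mult_left_mono) auto
      finally show ?thesis using e by (simp add: K_def add_increasing)
    qed
    finally show "cmod (\<psi> (phi z) * approx_eig t r (phi (phi z)) - l * approx_eig t r (phi z)) \<le> e * cmod (kern r (phi z)) + K"
      by (simp only: w_def mult_1)
  qed
qed

section \<open>Lower bounds and failure of invertibility\<close>

lemma H2_invertible_lower_bound:
  assumes "H2_invertible T"
  obtains C where "0 \<le> C" "\<And>f. f \<in> H2 \<Longrightarrow> T f \<in> H2 \<Longrightarrow> H2_norm f \<le> C * H2_norm (T f)"
proof -
  obtain S C where S: "\<And>f. f \<in> H2 \<Longrightarrow> S f \<in> H2 \<and> H2_norm (S f) \<le> C * H2_norm f"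
    and ST: "\<And>f z. f \<in> H2 \<Longrightarrow> z \<in> ball 0 1 \<Longrightarrow> S (T f) z = f z"
    using assms unfolding H2_invertible_def by metis
  show thesis
  proof (rule that[of "max C 0"])
    fix f assume f: "f \<in> H2" and Tf: "T f \<in> H2"
    have "H2_norm f = H2_norm (S (T f))"
      using H2_cong(2)[OF f, of "S (T f)"] ST[OF f] by simp
    also have "\<dots> \<le> C * H2_norm (T f)" using S[OF Tf] by simp
    also have "\<dots> \<le> max C 0 * H2_norm (T f)" by (intro mult_right_mono H2_norm_nonneg Tf) simp
    finally show "H2_norm f \<le> max C 0 * H2_norm (T f)" .
  qed simp
qed

text \<open>For t > 0 the factor exp(- t v) decays along the radius to 1, where Re v tends to
  infinity. The mass of the approximate eigenvector is therefore sought on a tangential arc: Re (1 /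
  (1 - z)) \<le> 1 is equivalent to Re z \<le> |z|^2, that is cos \<open>\<theta>\<close> \<le> cos
  \<open>\<eta>\<close> at radius cos \<open>\<eta>\<close>.\<close>

lemma arc_bounds:
  fixes \<eta> \<theta> :: real
  assumes \<eta>: "0 < \<eta>" "\<eta> \<le> 1 / 3" and \<theta>: "\<eta> \<le> \<theta>" "\<theta> \<le> 2 * \<eta>"
  defines "z \<equiv> of_real (cos \<eta>) * exp (\<i> * of_real \<theta>)"
  shows "cmod (1 - z) \<le> 3 * \<eta>" "z \<in> ball 0 1" "Re (1 / (1 - z)) \<le> 1"
proof -
  have c0: "0 < cos \<eta>" using \<eta> pi_gt3 by (intro cos_gt_zero_pi) auto
  have c1: "cos \<eta> < 1" using cos_monotone_0_pi[of 0 \<eta>] \<eta> pi_gt3 by simp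
  have nz: "cmod z = cos \<eta>" using c0 by (simp add: z_def norm_mult)
  then show disc: "z \<in> ball 0 1" using c1 by simp
  have c2: "1 - cos \<eta> \<le> \<eta>"
  proof -
    have "1 - cos \<eta> = 2 * (sin (\<eta> / 2))\<^sup>2" using cos_double_sin[of "\<eta> / 2"] by simp
    also have "\<dots> \<le> 2 * (\<eta> / 2)\<^sup>2"
      using abs_sin_le_one[of "\<eta> / 2"] abs_sin_x_le_abs_x[of "\<eta> / 2"] by (simp add: abs_le_square_iff[symmetric])
    also have "\<dots> \<le> \<eta>" using \<eta> mult_left_le[of \<eta> \<eta>] by (simp add: power2_eq_square)
    finally show ?thesis .
  qed
  have e: "cmod (1 - exp (\<i> * of_real \<theta>)) \<le> \<theta>"
    using dist_exp_i_1[of \<theta>] abs_sin_x_le_abs_x[of "\<theta> / 2"] \<eta> \<theta> by (simp add: norm_minus_commute)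
  have "1 - z = of_real (1 - cos \<eta>) + of_real (cos \<eta>) * (1 - exp (\<i> * of_real \<theta>))"
    by (simp add: z_def algebra_simps)
  then have "cmod (1 - z) \<le> cmod (of_real (1 - cos \<eta>)) + cmod (of_real (cos \<eta>) * (1 - exp (\<i> * of_real \<theta>)))"
    by (simp only: norm_triangle_ineq)
  also have "\<dots> \<le> \<eta> + 1 * \<theta>"
    unfolding norm_mult norm_of_real using c0 c1 c2 e by (intro add_mono mult_mono) auto
  finally show "cmod (1 - z) \<le> 3 * \<eta>" using \<theta> by simp
  have "Re z = cos \<eta> * cos \<theta>" by (simp add: z_def Re_exp)
  moreover have "cos \<theta> \<le> cos \<eta>" using \<eta> \<theta> pi_gt3 by (intro cos_monotone_0_pi_le) auto
  ultimately have Rez: "Re z \<le> (cmod z)\<^sup>2" using c0 by (simp add: nz power2_eq_square)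
  have "(cmod (1 - z))\<^sup>2 = 1 - 2 * Re z + (cmod z)\<^sup>2"
    unfolding cmod_power2 by (simp add: power2_eq_square algebra_simps)
  then have "Re (1 - z) \<le> (cmod (1 - z))\<^sup>2" using Rez by simp
  moreover have "Re (1 / (1 - z)) = Re (1 - z) / (cmod (1 - z))\<^sup>2" by (simp add: Re_divide cmod_power2)
  moreover have "0 < (cmod (1 - z))\<^sup>2" using disc_ne_one[OF disc] by simp
  ultimately show "Re (1 / (1 - z)) \<le> 1" by (simp add: divide_le_eq)
qed

text \<open>On an arc of length of order \<open>\<eta>\<close> the function has modulus at least b /
  \<open>\<eta>\<close>, so its squared norm grows at least like 1 / \<open>\<eta>\<close>, the
  growth rate of the squared norm of the kernel.\<close>

lemma approx_eig_norm_ge: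
  fixes \<psi> :: "complex \<Rightarrow> complex"
  assumes \<psi>: "continuous_on (ball 0 1 \<union> {1}) \<psi>" "\<psi> 1 \<noteq> 0" and t: "0 \<le> t"
  obtains L \<eta>0 where "0 < L" "0 < \<eta>0" "\<And>\<eta>. 0 < \<eta> \<Longrightarrow> \<eta> < \<eta>0 \<Longrightarrow>
     wcomp \<psi> phi (approx_eig t (1 - \<eta>)) \<in> H2 \<Longrightarrow>
     L / \<eta> \<le> (H2_norm (wcomp \<psi> phi (approx_eig t (1 - \<eta>))))\<^sup>2"
proof -
  define a where "a = cmod (\<psi> 1)"
  have a: "0 < a" using \<psi>(2) by (simp add: a_def)
  obtain \<delta> where \<delta>: "0 < \<delta>" "\<And>w. w \<in> ball 0 1 \<Longrightarrow> cmod (w - 1) < \<delta> \<Longrightarrow> cmod (\<psi> w - \<psi> 1) < a / 2"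
    using a \<psi>(1) unfolding continuous_on_iff dist_norm
    by (metis UnI1 UnI2 singletonI half_gt_zero)
  \<comment> \<open>The factors are lower bounds on the arc: a / 2 for |\<psi>|, exp(- 2 t) for the
    exponential, since Re (1 / (1 - phi z)) \<le> 2, and 1/4 from |1 - (1 - \<eta>) phi z| \<le> 4
    \<eta>.\<close>
  define b where "b = a / 2 * exp (- 2 * t) / 4"
  have b: "0 < b" using a by (simp add: b_def)
  define \<eta>0 where "\<eta>0 = min (1 / 3) (\<delta> / 3)"
  show thesis
  proof (rule that[of "b\<^sup>2 / (2 * pi)" \<eta>0])
    show "0 < b\<^sup>2 / (2 * pi)" using b by simp
    show "0 < \<eta>0" using \<delta> by (simp add: \<eta>0_def)
    fix \<eta> :: real assume \<eta>: "0 < \<eta>" "\<eta> < \<eta>0"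
    then have \<eta>': "\<eta> \<le> 1 / 3" "3 * \<eta> < \<delta>" by (simp_all add: \<eta>0_def)
    let ?x = "wcomp \<psi> phi (approx_eig t (1 - \<eta>))"
    assume x: "?x \<in> H2"
    have pt: "b / \<eta> \<le> cmod (?x z)"
      if z: "cmod (1 - z) \<le> 3 * \<eta>" "z \<in> ball 0 1" "Re (1 / (1 - z)) \<le> 1" for z
    proof -
      have pz: "phi z \<in> ball 0 1" by (rule phi_in_disc[OF z(2)])
      have "cmod (\<psi> z - \<psi> 1) < a / 2"
        using \<delta>(2)[OF z(2)] z(1) \<eta>'(2) by (simp add: norm_minus_commute)
      then have \<psi>z: "a / 2 \<le> cmod (\<psi> z)"
        using norm_triangle_ineq3[of "\<psi> z" "\<psi> 1"] unfolding a_def by linarith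
      have "1 \<le> cmod (1 + z)"
        using norm_triangle_ineq2[of 2 "1 - z"] z(1) \<eta>'(1) by simp
      then have "cmod (1 / (1 + z)) \<le> 1" by (simp add: norm_divide divide_le_eq)
      then have "Re (1 / (1 + z)) \<le> 1" using complex_Re_le_cmod[of "1 / (1 + z)"] by linarith
      then have R: "Re (1 / (1 - phi z)) \<le> 2"
        unfolding inverse_one_minus_phi[OF z(2)] using z(3) by simp
      then have E: "exp (- 2 * t) \<le> cmod (exp (- of_real t / (1 - phi z)))"
        unfolding norm_exp_disc using mult_left_mono[OF R t] by simp
      have "cmod (1 + z) \<le> 2" using norm_triangle_ineq[of 1 z] z(2) by simp
      from mult_left_mono[OF this norm_ge_zero[of "1 - z"]]
      have "cmod (1 - phi z) \<le> cmod (1 - z)"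
        unfolding one_minus_phi by (simp add: norm_mult norm_divide)
      then have p: "cmod (1 - phi z) \<le> 3 * \<eta>" using z(1) by simp
      have "1 - of_real (1 - \<eta>) * phi z = (1 - phi z) + of_real \<eta> * phi z" by (simp add: algebra_simps)
      then have "cmod (1 - of_real (1 - \<eta>) * phi z) \<le> cmod (1 - phi z) + cmod (of_real \<eta> * phi z)"
        by (simp only: norm_triangle_ineq)
      also have "\<dots> \<le> 3 * \<eta> + \<eta> * 1"
        unfolding norm_mult norm_of_real using p pz \<eta> by (intro add_mono mult_mono) auto
      finally have k1: "cmod (1 - of_real (1 - \<eta>) * phi z) \<le> 4 * \<eta>" by simp
      have "0 < cmod (1 - of_real (1 - \<eta>) * phi z)"
        using norm_kern_le(2)[OF _ _ pz, of "1 - \<eta>"] disc_ne_one[OF pz] \<eta> \<eta>'(1) by auto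
      then have k: "1 / (4 * \<eta>) \<le> cmod (kern (1 - \<eta>) (phi z))"
        unfolding kern_def norm_divide norm_one using k1 \<eta> by (intro divide_left_mono mult_pos_pos) auto
      have "b / \<eta> = (a / 2) * (exp (- 2 * t) * (1 / (4 * \<eta>)))" by (simp add: b_def)
      also have "\<dots> \<le> cmod (\<psi> z) * (cmod (exp (- of_real t / (1 - phi z))) * cmod (kern (1 - \<eta>) (phi z)))"
        using a \<eta> by (intro mult_mono \<psi>z E k mult_nonneg_nonneg) auto
      also have "\<dots> = cmod (?x z)" by (simp add: wcomp_def approx_eig_def norm_mult)
      finally show ?thesis .
    qed
    define \<rho> where "\<rho> = cos \<eta>"
    have \<rho>: "0 \<le> \<rho>" "\<rho> < 1"
      using arc_bounds(2)[OF \<eta>(1) \<eta>'(1), of \<eta>] \<eta> cos_gt_zero_pi[of \<eta>] \<eta>'(1) pi_gt3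
      by (auto simp: \<rho>_def norm_mult)
    \<comment> \<open>These are the parameters of the angles \<open>\<eta>\<close> and 2
      \<open>\<eta>\<close> on the circle.\<close>
    define p q where "p = \<eta> / (2 * pi)" and "q = \<eta> / pi"
    have pq: "0 \<le> p" "p \<le> q" "q \<le> 1" using \<eta> \<eta>'(1) pi_gt3 by (auto simp: p_def q_def divide_simps)
    let ?g = "\<lambda>s. (cmod (?x (circlepath 0 \<rho> s)))\<^sup>2"
    have arc: "(b / \<eta>)\<^sup>2 \<le> ?g s" if s: "s \<in> {p..q}" for s
    proof -
      have "\<eta> \<le> 2 * pi * s" "2 * pi * s \<le> 2 * \<eta>"
        using s pi_gt_zero by (auto simp: p_def q_def field_simps)
      note arc_bounds[OF \<eta>(1) \<eta>'(1) this]
      moreover have "of_real (cos \<eta>) * exp (\<i> * of_real (2 * pi * s)) = circlepath 0 \<rho> s"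
        by (simp add: circlepath \<rho>_def mult_ac)
      ultimately have "b / \<eta> \<le> cmod (?x (circlepath 0 \<rho> s))" by (intro pt) simp_all
      then show ?thesis using b \<eta> by (intro power_mono) auto
    qed
    have int: "?g integrable_on {0..1}"
      by (rule circle_mean_integrable[OF H2_holomorphic[OF x] \<rho>])
    have "b\<^sup>2 / (2 * pi) / \<eta> = (b / \<eta>)\<^sup>2 * (q - p)"
      using \<eta> by (simp add: p_def q_def power2_eq_square field_simps)
    also have "\<dots> = integral {p..q} (\<lambda>s. (b / \<eta>)\<^sup>2)"
      using pq by simp
    also have "\<dots> \<le> integral {p..q} ?g"
      by (rule integral_le) (use arc pq int in \<open>auto intro: integrable_on_subinterval\<close>)
    also have "\<dots> \<le> integral {0..1} ?g"
      by (rule integral_subset_le) (use pq int in \<open>auto intro: integrable_on_subinterval\<close>)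
    also have "\<dots> \<le> (H2_norm ?x)\<^sup>2"
      using circle_mean_le_H2_norm[OF x \<rho>] by (simp add: circle_mean_def)
    finally show "b\<^sup>2 / (2 * pi) / \<eta> \<le> (H2_norm ?x)\<^sup>2" .
  qed
qed

theorem not_invertible_on_segment:
  fixes \<psi> :: "complex \<Rightarrow> complex"
  assumes \<psi>: "\<psi> \<in> Hinf" "continuous_on (ball 0 1 \<union> {1}) \<psi>" "\<psi> 1 \<noteq> 0" and t: "0 \<le> t"
  defines "l \<equiv> \<psi> 1 * complex_of_real (exp (- t / 2))"
  shows "\<not> H2_invertible (\<lambda>f z. wcomp \<psi> phi f z - l * f z)"
proof
  let ?T = "\<lambda>f z. wcomp \<psi> phi f z - l * f z"
  assume "H2_invertible ?T"
  then obtain C where C: "0 \<le> C" "\<And>f. f \<in> H2 \<Longrightarrow> ?T f \<in> H2 \<Longrightarrow> H2_norm f \<le> C * H2_norm (?T f)"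
    by (rule H2_invertible_lower_bound) blast
  have hol: "\<psi> holomorphic_on ball 0 1" using \<psi>(1) by (simp add: Hinf_def)
  obtain M where M: "\<And>z. z \<in> ball 0 1 \<Longrightarrow> cmod (\<psi> z) \<le> M"
    using \<psi>(1) unfolding Hinf_def bounded_iff by blast
  have M0: "0 \<le> M" using order_trans[OF norm_ge_zero M[of 0]] by simp
  have W: "wcomp \<psi> phi f \<in> H2" if "f \<in> H2" for f
    by (rule wcomp_H2(1)[OF hol M0 M phi_holomorphic phi_in_disc that])
  have TH: "?T f \<in> H2" if "f \<in> H2" for f
    using H2_lincomb(1)[OF W[OF that] that, of 1 "- l"] by simp
  obtain L \<eta>0 where L: "0 < L" "0 < \<eta>0" "\<And>\<eta>. 0 < \<eta> \<Longrightarrow> \<eta> < \<eta>0 \<Longrightarrow>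
     wcomp \<psi> phi (approx_eig t (1 - \<eta>)) \<in> H2 \<Longrightarrow>
     L / \<eta> \<le> (H2_norm (wcomp \<psi> phi (approx_eig t (1 - \<eta>))))\<^sup>2"
    by (rule approx_eig_norm_ge[OF \<psi>(2,3) t]) blast
  define D where "D = C\<^sup>2 * (2 * M\<^sup>2)"
  have D0: "0 \<le> D" by (simp add: D_def)
  \<comment> \<open>The final comparison will be L / \<eta> \<le> 3 D e^2 / \<eta> + D K^2, where 3
    is the squared subordination constant for \<open>phi 0\<close> = 1/2. This e makes 3 D e^2 \<le>
    L / 2, and D + 1 covers D = 0.\<close>
  define e where "e = sqrt (L / (6 * (D + 1)))"
  have D1: "0 < 6 * (D + 1)" using D0 by simp
  have e: "0 < e" "e\<^sup>2 = L / (6 * (D + 1))"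
    using L(1) D1 by (simp_all add: e_def)
  obtain K where K: "0 \<le> K" "\<And>r z. 0 \<le> r \<Longrightarrow> r < 1 \<Longrightarrow> z \<in> ball 0 1 \<Longrightarrow>
      cmod (\<psi> (phi z) * approx_eig t r (phi (phi z)) - l * approx_eig t r (phi z)) \<le> e * cmod (kern r (phi z)) + K"
    using approx_eig_residual[OF \<psi>(2) M t e(1)] unfolding l_def by blast
  have main: "L / 2 \<le> D * K\<^sup>2 * \<eta>" if \<eta>: "0 < \<eta>" "\<eta> < \<eta>0" "\<eta> < 1" for \<eta>
  proof -
    let ?f = "approx_eig t (1 - \<eta>)" and ?k = "kern (1 - \<eta>)"
    let ?x = "wcomp \<psi> phi ?f"
    have f: "?f \<in> H2" and k: "?k \<in> H2" "(H2_norm ?k)\<^sup>2 \<le> 1 / \<eta>"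
      using \<eta> t approx_eig_H2[of t "1 - \<eta>"] kern_H2[of "1 - \<eta>"] by simp_all
    have x: "?x \<in> H2" by (rule W[OF f])
    have kp: "(\<lambda>z. ?k (phi z)) \<in> H2" "H2_norm (\<lambda>z. ?k (phi z)) \<le> sqrt 3 * H2_norm ?k"
    proof -
      have s3: "sqrt ((1 + cmod (phi 0)) / (1 - cmod (phi 0))) = sqrt 3" by (simp add: phi_def norm_divide)
      show "(\<lambda>z. ?k (phi z)) \<in> H2" by (rule littlewood_subordination(1)[OF k(1) phi_holomorphic phi_in_disc])
      show "H2_norm (\<lambda>z. ?k (phi z)) \<le> sqrt 3 * H2_norm ?k"
        unfolding s3[symmetric] by (rule littlewood_subordination(2)[OF k(1) phi_holomorphic phi_in_disc])
    qed
    from power_mono[OF kp(2) H2_norm_nonneg[OF kp(1)], of 2]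
    have kp2: "(H2_norm (\<lambda>z. ?k (phi z)))\<^sup>2 \<le> 3 * (1 / \<eta>)"
      using k(2) by (simp add: power_mult_distrib)
    have y_pt: "(cmod (?T ?x z))\<^sup>2 \<le> 2 * M\<^sup>2 * e\<^sup>2 * (cmod (?k (phi z)))\<^sup>2 + 2 * M\<^sup>2 * K\<^sup>2"
      if z: "z \<in> ball 0 1" for z
    proof -
      \<comment> \<open>W commutes with W - l, so testing on x = W f turns the residual of f into
        its values at \<open>phi z\<close> only. The neighbourhood of -1, where f is not an
        approximate eigenvector, is thus avoided.\<close>
      have "?T ?x z = \<psi> z * (\<psi> (phi z) * ?f (phi (phi z)) - l * ?f (phi z))"
        by (simp add: wcomp_def algebra_simps)
      then have "cmod (?T ?x z) \<le> M * (e * cmod (?k (phi z)) + K)"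
        using \<eta> M[OF z] M0 K(2)[of "1 - \<eta>", OF _ _ z] by (simp only: norm_mult) (intro mult_mono, auto)
      from power_mono[OF this norm_ge_zero, of 2]
      have "(cmod (?T ?x z))\<^sup>2 \<le> M\<^sup>2 * (e * cmod (?k (phi z)) + K)\<^sup>2" by (simp only: power_mult_distrib)
      also have "\<dots> \<le> M\<^sup>2 * (2 * (e * cmod (?k (phi z)))\<^sup>2 + 2 * K\<^sup>2)"
        using sum_squares_bound[of "e * cmod (?k (phi z))" K] by (intro mult_left_mono) (simp_all add: power2_sum)
      also have "\<dots> = 2 * M\<^sup>2 * e\<^sup>2 * (cmod (?k (phi z)))\<^sup>2 + 2 * M\<^sup>2 * K\<^sup>2"
        by (simp add: power_mult_distrib algebra_simps)
      finally show ?thesis .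
    qed
    have "(H2_norm (?T ?x))\<^sup>2 \<le> 2 * M\<^sup>2 * e\<^sup>2 * (H2_norm (\<lambda>z. ?k (phi z)))\<^sup>2 + 2 * M\<^sup>2 * K\<^sup>2"
      by (rule H2_I_pointwise(2)[OF H2_holomorphic[OF TH[OF x]] kp(1) _ _ y_pt]) auto
    also have "\<dots> \<le> 2 * M\<^sup>2 * e\<^sup>2 * (3 * (1 / \<eta>)) + 2 * M\<^sup>2 * K\<^sup>2"
      by (intro add_right_mono mult_left_mono kp2) simp
    finally have y: "(H2_norm (?T ?x))\<^sup>2 \<le> 2 * M\<^sup>2 * e\<^sup>2 * (3 * (1 / \<eta>)) + 2 * M\<^sup>2 * K\<^sup>2" .
    have "L / \<eta> \<le> (H2_norm ?x)\<^sup>2" by (rule L(3)[OF \<eta>(1,2) x])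
    also have "\<dots> \<le> (C * H2_norm (?T ?x))\<^sup>2"
      by (rule power_mono[OF C(2)[OF x TH[OF x]] H2_norm_nonneg[OF x]])
    also have "\<dots> \<le> C\<^sup>2 * (2 * M\<^sup>2 * e\<^sup>2 * (3 * (1 / \<eta>)) + 2 * M\<^sup>2 * K\<^sup>2)"
      unfolding power_mult_distrib by (intro mult_left_mono y) simp
    also have "\<dots> = (3 * D * e\<^sup>2) / \<eta> + D * K\<^sup>2" by (simp add: D_def algebra_simps)
    finally have "L / \<eta> * \<eta> \<le> ((3 * D * e\<^sup>2) / \<eta> + D * K\<^sup>2) * \<eta>" using \<eta>(1) by (intro mult_right_mono) auto
    then have "L \<le> 3 * D * e\<^sup>2 + D * K\<^sup>2 * \<eta>" using \<eta>(1) by (simp add: distrib_right)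
    moreover have "3 * D * e\<^sup>2 \<le> L / 2"
    proof -
      have "3 * D * e\<^sup>2 \<le> 3 * (D + 1) * e\<^sup>2" by (intro mult_right_mono) auto
      also have "\<dots> = L / 2"
      proof -
        have "3 * c * (L / (6 * c)) = L / 2" if "0 < c" for c :: real using that by simp
        from this[of "D + 1"] show ?thesis using D0 unfolding e(2) by simp
      qed
      finally show ?thesis .
    qed
    ultimately show ?thesis by linarith
  qed
  \<comment> \<open>Small enough that D K^2 \<eta> \<le> L / 4, against the lower bound L / 2 just
    derived.\<close>
  define \<eta> where "\<eta> = min (\<eta>0 / 2) (min (1 / 2) (L / (4 * (D * K\<^sup>2 + 1))))"
  have DK: "0 \<le> D * K\<^sup>2" using D0 by simp
  have DK1: "0 < 4 * (D * K\<^sup>2 + 1)" using DK by (simp add: add_nonneg_pos)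
  have \<eta>: "0 < \<eta>" "\<eta> < \<eta>0" "\<eta> < 1" "\<eta> \<le> L / (4 * (D * K\<^sup>2 + 1))"
    using L(1,2) DK1 by (auto simp: \<eta>_def)
  have "L / 2 \<le> D * K\<^sup>2 * \<eta>" by (rule main[OF \<eta>(1-3)])
  also have "\<dots> \<le> (D * K\<^sup>2 + 1) * \<eta>" using \<eta>(1) by (intro mult_right_mono) auto
  also have "\<dots> \<le> (D * K\<^sup>2 + 1) * (L / (4 * (D * K\<^sup>2 + 1)))" using \<eta>(4) DK by (intro mult_left_mono) auto
  also have "\<dots> = L / 4"
  proof -
    have "c * (L / (4 * c)) = L / 4" if "0 < c" for c :: real using that by simp
    from this[of "D * K\<^sup>2 + 1"] show ?thesis using DK by simp
  qed
  finally show False using L(1) by simp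
qed

text \<open>Since \<open>phi\<close> takes the same value at 1/2 and -1/2, the pairs of values at
  these points of functions in the range are multiples of one fixed vector. The functions 1 and z
  give the independent pairs (1, 1) and (1/2, -1/2), so they are not both in the range.\<close>

lemma wcomp_not_invertible: "\<not> H2_invertible (\<lambda>f z. wcomp \<psi> phi f z - 0 * f z)"
proof
  assume "H2_invertible (\<lambda>f z. wcomp \<psi> phi f z - 0 * f z)"
  then obtain S where "\<forall>f\<in>H2. \<forall>z\<in>ball 0 1. wcomp \<psi> phi (S f) z - 0 * S f z = f z"
    unfolding H2_invertible_def by (elim exE conjE) (rule that)
  then have S: "\<psi> z * S f (phi z) = f z" if "f \<in> H2" "z \<in> ball 0 1" for f z
    using that unfolding wcomp_def by simp
  have 1: "ev (basis 0 1) z = 1" and z: "ev (basis 1 1) z = z" if "z \<in> ball 0 1" for z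
    using ev_basis[OF that] by simp_all
  have b: "1 / 2 \<in> ball (0::complex) 1" "- 1 / 2 \<in> ball (0::complex) 1" by (simp_all add: norm_divide)
  have p: "phi (- 1 / 2) = phi (1 / 2)" by (simp add: phi_def power2_eq_square)
  let ?g = "S (ev (basis 0 1)) (phi (1 / 2))" and ?h = "S (ev (basis 1 1)) (phi (1 / 2))"
  have v: "\<psi> (1 / 2) * ?g = 1" "\<psi> (- 1 / 2) * ?g = 1" "\<psi> (1 / 2) * ?h = 1 / 2" "\<psi> (- 1 / 2) * ?h = - 1 / 2"
    using S[OF ev_in_H2[of "basis 0 1"] b(1)] S[OF ev_in_H2[of "basis 0 1"] b(2)]
      S[OF ev_in_H2[of "basis 1 1"] b(1)] S[OF ev_in_H2[of "basis 1 1"] b(2)]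
    unfolding p 1[OF b(1)] 1[OF b(2)] z[OF b(1)] z[OF b(2)] by this+
  have "(\<psi> (1 / 2) * ?h) * (\<psi> (- 1 / 2) * ?g) = (\<psi> (1 / 2) * ?g) * (\<psi> (- 1 / 2) * ?h)"
    by (simp only: mult_ac)
  then show False unfolding v by simp
qed

theorem mainTheorem8:
  fixes \<psi> :: "complex \<Rightarrow> complex"
  assumes "\<psi> \<in> Hinf"
    and "continuous_on (ball 0 1 \<union> {1}) \<psi>"
  shows "H2_spectrum (wcomp \<psi> (\<lambda>z. z\<^sup>2 / 2 + 1 / 2))
         = {\<psi> 1 * complex_of_real (exp (- t / 2)) | t. t \<ge> 0} \<union> {0}"
proof -
  have phi: "(\<lambda>z. z\<^sup>2 / 2 + 1 / 2) = phi" by (simp add: fun_eq_iff phi_def)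
  show ?thesis
    unfolding phi H2_spectrum_def
  proof (intro equalityI subsetI)
    fix l assume "l \<in> {c. \<not> H2_invertible (\<lambda>f z. wcomp \<psi> phi f z - c * f z)}"
    then have "\<not> H2_invertible (\<lambda>f z. wcomp \<psi> phi f z - l * f z)" by simp
    then obtain x where x: "0 \<le> x" "x \<le> 1" "l = \<psi> 1 * complex_of_real x"
      using invertible_off_segment[OF assms, of l] by blast
    show "l \<in> {\<psi> 1 * complex_of_real (exp (- t / 2)) | t. t \<ge> 0} \<union> {0}"
    proof (cases "x = 0")
      case False
      \<comment> \<open>A positive point x of the segment is reached by t = - 2 ln x. The endpoint x
        = 0 is reached by no t and is supplied by the set {0}.\<close>
      then have "exp (- (- 2 * ln x) / 2) = x" "0 \<le> - 2 * ln x" using x by simp_all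
      then show ?thesis using x(3) by (metis (mono_tags, lifting) UnI1 mem_Collect_eq)
    qed (use x in simp)
  next
    fix l assume "l \<in> {\<psi> 1 * complex_of_real (exp (- t / 2)) | t. t \<ge> 0} \<union> {0}"
    then have l: "l = 0 \<or> (\<exists>t\<ge>0. l = \<psi> 1 * complex_of_real (exp (- t / 2)))" by blast
    have "\<not> H2_invertible (\<lambda>f z. wcomp \<psi> phi f z - l * f z)"
    proof (cases "l = 0")
      case True
      then show ?thesis using wcomp_not_invertible by (simp only: not_False_eq_True)
    next
      case False
      with l obtain t where t: "0 \<le> t" "l = \<psi> 1 * complex_of_real (exp (- t / 2))" by blast
      with False have "\<psi> 1 \<noteq> 0" by auto
      from not_invertible_on_segment[OF assms this t(1)] show ?thesis unfolding t(2) .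
    qed
    then show "l \<in> {c. \<not> H2_invertible (\<lambda>f z. wcomp \<psi> phi f z - c * f z)}" by simp
  qed
qed

end
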